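(* Let $\mathcal U(\mathcal L)[[t]]$ be the algebra of formal power series in $t$ with coefficients in $\mathcal U(\mathcal L)$, with its usual (super)algebra structure. Define $\mathbb F[[t]]$-linear maps $\Delta$, $\epsilon$, $S$ on generators by, for $i\in\mathbb Z$, $k\in K$: $$\Delta(L_i)=\sum_{r=0}^{\infty}\alpha^r\left[\begin{matrix}(r-2)m-i\\ r\end{matrix}\right]_m L_{i-rm}\otimes(1-Yt)^{\frac im-r}Y^rt^r+\sum_{r=0}^{\infty}(-1)^r\sum_{s=0}^{2r}\alpha^s a_s(r,i)\,X^{<r>}\otimes(1-Yt)^{-r}L_{i+(r-s)m}t^r,$$ $$\Delta(G_k)=\sum_{r=0}^{\infty}\alpha^r\left[\begin{matrix}(r-\frac32)m-k\\ r\end{matrix}\right]_m G_{k-rm}\otimes(1-Yt)^{\frac km-r}Y^rt^r+\sum_{r=0}^{\infty}(-1)^r\sum_{s=0}^{2r}\alpha^s b_s(r,k)\,X^{<r>}\otimes(1-Yt)^{-r}G_{k+(r-s)m}t^r,$$ $\epsilon(L_i)=\epsilon(G_k)=0$, $\epsilon(1)=1$, $$S(L_i)=-(1-Yt)^{-\frac im}\sum_{r=0}^{\infty}\sum_{p=0}^{\infty}\sum_{q=0}^{2p}(-1)^r\alpha^{r+q}\left[\begin{matrix}(r-2)m-i\\ r\end{matrix}\right]_m a_q(p,i-rm)\,X_{-\frac im}^{[p]}L_{i+(p-r-q)m}Y^rt^{r+p},$$ $$S(G_k)=-(1-Yt)^{-\frac km}\sum_{r=0}^{\infty}\sum_{p=0}^{\infty}\sum_{q=0}^{2p}(-1)^r\alpha^{r+q}\left[\begin{matrix}(r-\frac32)m-k\\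 r\end{matrix}\right]_m b_q(p,k-rm)\,X_{-\frac km}^{[p]}G_{k+(p-r-q)m}Y^rt^{r+p},$$ with $\Delta$ extended to an algebra homomorphism into $(\mathcal U(\mathcal L)\otimes\mathcal U(\mathcal L))[[t]]$, $\epsilon$ to an algebra homomorphism, and $S$ to a super-anti-homomorphism ($S(xy)=(-1)^{[x][y]}S(y)S(x)$). Then $(\mathcal U(\mathcal L)[[t]],\Delta,\epsilon,S)$ is a Hopf superalgebra, which is noncommutative and noncocommutative.
   Context: Let $\mathbb F$ be a field of characteristic zero. Fix $\varepsilon\in\{0,\tfrac12\}$ and set $K=\varepsilon+\mathbb Z$. The super-Virasoro algebra (without central extension) $\mathcal L$ is the Lie superalgebra over $\mathbb F$ with even basis $\{L_i\}_{i\in\mathbb Z}$, odd basis $\{G_k\}_{k\in K}$, and brackets $[L_i,L_j]=(j-i)L_{i+j}$, $[L_i,G_k]=(k-\frac i2)G_{i+k}$, $[G_k,G_l]=2L_{k+l}$. $\mathcal U(\mathcal L)$ is its universal enveloping superalgebra; tensor products of superalgebras use the sign rule $(a\otimes b)(c\otimes d)=(-1)^{[b][c]}ac\otimes bd$. Fix a nonzero integer $m$ and $\alpha\in\mathbb F$. Put $X=\frac1m(L_0+\alpha mL_{-m})$ and $Y=\exp(\alpha\,\mathrm{ad}\,L_{-m})(L_m)=L_m+2\alpha mL_0+\alpha^2m^2L_{-m}$ (both even; $[X,Y]=Y$). For an element $x$ of an algebra, $a\in\mathbb F$, $r\in\mathbb Z_{\ge0}$: $x_a^{<r>}=(x+a)(x+a+1)\cdots(x+a+r-1)$,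 $x_a^{[r]}=(x+a)(x+a-1)\cdots(x+a-r+1)$ (both $=1$ for $r=0$), $x^{<r>}=x_0^{<r>}$. For $a,c\in\mathbb F$, $r\in\mathbb Z_{\ge0}$: $\left[\begin{matrix}a\\ r\end{matrix}\right]_c=\frac{a(a-c)(a-2c)\cdots(a-(r-1)c)}{r!}$ ($=1$ if $r=0$). For $c\in\mathbb F$, $(1-Yt)^c=\sum_{p\ge0}\binom{c}{p}(-1)^pY^pt^p$. For $r\in\mathbb Z_{\ge0}$, $s\in\mathbb Z_{\ge0}$, $i\in\mathbb Z$, $k\in\frac12\mathbb Z$: $a_s(r,i)=\sum_{p=0}^{s}(-1)^p\left[\begin{matrix}i+m\\ p\end{matrix}\right]_m\left[\begin{matrix}i+(r-p-2)m\\ r\end{matrix}\right]_m\left[\begin{matrix}i+(r-p+1)m\\ s-p\end{matrix}\right]_m$, $b_s(r,k)=\sum_{p=0}^{s}(-1)^p\left[\begin{matrix}k+\frac m2\\ p\end{matrix}\right]_m\left[\begin{matrix}k+(r-p-\frac32)m\\ r\end{matrix}\right]_m\left[\begin{matrix}k+(r-p+\frac12)m\\ s-p\end{matrix}\right]_m$. *)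

theory Defs
  imports Complex_Main
begin

text \<open>An element of the free associative algebra over the scalar ring 'a on the
generator set 'g is a coefficient function on words (finite support is imposed
where needed).  A presented (super)algebra is represented by the free algebra
together with a set of relations; equality in the quotient is congruence modulo
the two-sided ideal generated by the relations.  Formal power series in t with
coefficients in such an algebra are functions nat => free algebra element,
compared coefficientwise modulo the ideal.\<close>

type_synonym ('g,'a) fa = "'g list \<Rightarrow> 'a"
type_synonym ('g,'a) ps = "nat \<Rightarrow> ('g,'a) fa"

definition fa_supp :: "('g,'a::zero) fa \<Rightarrow> 'g list set" where
  "fa_supp f = {w. f w \<noteq> 0}"

definition fa_zero :: "('g,'a::zero) fa" where "fa_zero = (\<lambda>w. 0)"
definition fa_add :: "('g,'a::plus) fa \<Rightarrow> ('g,'a) fa \<Rightarrow> ('g,'a) fa" where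
  "fa_add f g = (\<lambda>w. f w + g w)"
definition fa_diff :: "('g,'a::minus) fa \<Rightarrow> ('g,'a) fa \<Rightarrow> ('g,'a) fa" where
  "fa_diff f g = (\<lambda>w. f w - g w)"
definition fa_smul :: "'a::times \<Rightarrow> ('g,'a) fa \<Rightarrow> ('g,'a) fa" where
  "fa_smul c f = (\<lambda>w. c * f w)"
definition fa_word :: "'g list \<Rightarrow> ('g,'a::{zero,one}) fa" where
  "fa_word u = (\<lambda>w. if w = u then 1 else 0)"
definition fa_one :: "('g,'a::{zero,one}) fa" where "fa_one = fa_word []"
definition fa_gen :: "'g \<Rightarrow> ('g,'a::{zero,one}) fa" where "fa_gen g = fa_word [g]"

definition fa_mult :: "('g,'a::comm_ring_1) fa \<Rightarrow> ('g,'a) fa \<Rightarrow> ('g,'a) fa" where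
  "fa_mult f g = (\<lambda>w. \<Sum>i\<le>length w. f (take i w) * g (drop i w))"

primrec fa_pow :: "('g,'a::comm_ring_1) fa \<Rightarrow> nat \<Rightarrow> ('g,'a) fa" where
  "fa_pow x 0 = fa_one"
| "fa_pow x (Suc n) = fa_mult x (fa_pow x n)"

definition fa_rename :: "('g \<Rightarrow> 'h) \<Rightarrow> ('g,'a::comm_ring_1) fa \<Rightarrow> ('h,'a) fa" where
  "fa_rename h f = (\<lambda>w. \<Sum>u\<in>{u. map h u = w}. f u)"

inductive_set fa_ideal :: "('g,'a::comm_ring_1) fa set \<Rightarrow> ('g,'a) fa set" for R where
  rel: "r \<in> R \<Longrightarrow> r \<in> fa_ideal R"
| zero: "fa_zero \<in> fa_ideal R"
| add: "a \<in> fa_ideal R \<Longrightarrow> b \<in> fa_ideal R \<Longrightarrow> fa_add a b \<in> fa_ideal R"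
| smul: "a \<in> fa_ideal R \<Longrightarrow> fa_smul c a \<in> fa_ideal R"
| mult: "a \<in> fa_ideal R \<Longrightarrow> fa_mult (fa_word u) (fa_mult a (fa_word v)) \<in> fa_ideal R"

definition ps_zero :: "('g,'a::zero) ps" where "ps_zero = (\<lambda>n. fa_zero)"
definition ps_add :: "('g,'a::plus) ps \<Rightarrow> ('g,'a) ps \<Rightarrow> ('g,'a) ps" where
  "ps_add A B = (\<lambda>n. fa_add (A n) (B n))"
definition ps_smul :: "'a::times \<Rightarrow> ('g,'a) ps \<Rightarrow> ('g,'a) ps" where
  "ps_smul c A = (\<lambda>n. fa_smul c (A n))"
definition ps_sumset :: "('i \<Rightarrow> ('g,'a::comm_monoid_add) ps) \<Rightarrow> 'i set \<Rightarrow> ('g,'a) ps" where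
  "ps_sumset F I = (\<lambda>n w. \<Sum>i\<in>I. F i n w)"
definition ps_const :: "('g,'a::zero) fa \<Rightarrow> ('g,'a) ps" where
  "ps_const f = (\<lambda>n. if n = 0 then f else fa_zero)"
definition ps_one :: "('g,'a::{zero,one}) ps" where "ps_one = ps_const fa_one"
definition ps_tpow :: "nat \<Rightarrow> ('g,'a::zero) ps \<Rightarrow> ('g,'a) ps" where
  "ps_tpow r A = (\<lambda>n. if r \<le> n then A (n - r) else fa_zero)"
definition ps_mult :: "('g,'a::comm_ring_1) ps \<Rightarrow> ('g,'a) ps \<Rightarrow> ('g,'a) ps" where
  "ps_mult A B = (\<lambda>n w. \<Sum>i\<le>n. fa_mult (A i) (B (n - i)) w)"
definition ps_rename :: "('g \<Rightarrow> 'h) \<Rightarrow> ('g,'a::comm_ring_1) ps \<Rightarrow> ('h,'a) ps" where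
  "ps_rename h A = (\<lambda>n. fa_rename h (A n))"
text \<open>t-adic infinite sum  sum_{r>=0} F r  of a family in which the r-th term is
divisible by t^r (this is the case for all sums used below); the coefficient of
t^n only receives contributions from r <= n.\<close>
definition ps_tsum :: "(nat \<Rightarrow> ('g,'a::comm_monoid_add) ps) \<Rightarrow> ('g,'a) ps" where
  "ps_tsum F = (\<lambda>n w. \<Sum>r\<le>n. F r n w)"
text \<open>(1 - Y t)^c = sum_p (c choose p) (-1)^p Y^p t^p.\<close>
definition ps_binom :: "('g,'a::field_char_0) fa \<Rightarrow> 'a \<Rightarrow> ('g,'a) ps" where
  "ps_binom Y c = (\<lambda>p. fa_smul ((c gchoose p) * (-1)^p) (fa_pow Y p))"

definition ps_eqv :: "('g,'a::comm_ring_1) fa set \<Rightarrow> ('g,'a) ps \<Rightarrow> ('g,'a) ps \<Rightarrow> bool" where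
  "ps_eqv R A B \<longleftrightarrow> (\<forall>n. fa_diff (A n) (B n) \<in> fa_ideal R)"

definition ps_fin :: "('g,'a::zero) ps \<Rightarrow> bool" where
  "ps_fin A \<longleftrightarrow> (\<forall>n. finite (fa_supp (A n)))"

definition lin_ext :: "('g list \<Rightarrow> ('h,'a::comm_ring_1) ps) \<Rightarrow> ('g,'a) fa \<Rightarrow> ('h,'a) ps" where
  "lin_ext \<phi> f = (\<lambda>n w. \<Sum>u\<in>fa_supp f. f u * \<phi> u n w)"
definition ser_ext :: "('g list \<Rightarrow> ('h,'a::comm_ring_1) ps) \<Rightarrow> ('g,'a) ps \<Rightarrow> ('h,'a) ps" where
  "ser_ext \<phi> x = (\<lambda>n w. \<Sum>j\<le>n. lin_ext \<phi> (x j) (n - j) w)"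

fun ps_word :: "('g \<Rightarrow> ('h,'a::comm_ring_1) ps) \<Rightarrow> 'g list \<Rightarrow> ('h,'a) ps" where
  "ps_word \<phi> [] = ps_one"
| "ps_word \<phi> (g # u) = ps_mult (\<phi> g) (ps_word \<phi> u)"
definition hom_ext :: "('g \<Rightarrow> ('h,'a::comm_ring_1) ps) \<Rightarrow> ('g,'a) ps \<Rightarrow> ('h,'a) ps" where
  "hom_ext \<phi> = ser_ext (ps_word \<phi>)"

text \<open>Super-anti-homomorphism S(xy) = (-1)^{[x][y]} S(y) S(x) determined by the images
of generators; par g = True means g is odd.\<close>
fun ps_aword :: "('g \<Rightarrow> bool) \<Rightarrow> ('g \<Rightarrow> ('h,'a::comm_ring_1) ps) \<Rightarrow> 'g list \<Rightarrow> ('h,'a) ps" where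
  "ps_aword par \<phi> [] = ps_one"
| "ps_aword par \<phi> (g # u) =
     ps_smul (if par g \<and> odd (length (filter par u)) then -1 else 1)
       (ps_mult (ps_aword par \<phi> u) (\<phi> g))"
definition anti_ext :: "('g \<Rightarrow> bool) \<Rightarrow> ('g \<Rightarrow> ('h,'a::comm_ring_1) ps) \<Rightarrow> ('g,'a) ps \<Rightarrow> ('h,'a) ps" where
  "anti_ext par \<phi> = ser_ext (ps_aword par \<phi>)"

text \<open>For presented superalgebras A = <'g | R1>, B = <'h | R2>, the super tensor product
A (x) B (with (a(x)b)(c(x)d) = (-1)^{[b][c]} ac (x) bd) is presented on the generators
'g + 'h by R1, R2 and the super-commutation of the two copies.  The element a (x) b is
represented by (a on Inl-letters) * (b on Inr-letters).\<close>
definition sum_par :: "('g \<Rightarrow> bool) \<Rightarrow> ('h \<Rightarrow> bool) \<Rightarrow> 'g + 'h \<Rightarrow> bool" where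
  "sum_par p1 p2 = case_sum p1 p2"

definition supcomm :: "('g \<Rightarrow> bool) \<Rightarrow> ('h \<Rightarrow> bool) \<Rightarrow> 'g \<Rightarrow> 'h \<Rightarrow> ('g + 'h,'a::comm_ring_1) fa" where
  "supcomm p1 p2 a b =
     fa_diff (fa_mult (fa_gen (Inl a)) (fa_gen (Inr b)))
             (fa_smul (if p1 a \<and> p2 b then -1 else 1) (fa_mult (fa_gen (Inr b)) (fa_gen (Inl a))))"

definition tens_rel :: "('g \<Rightarrow> bool) \<Rightarrow> ('g,'a::comm_ring_1) fa set \<Rightarrow> ('h \<Rightarrow> bool) \<Rightarrow> ('h,'a) fa set
     \<Rightarrow> ('g + 'h,'a) fa set" where
  "tens_rel p1 R1 p2 R2 = fa_rename Inl ` R1 \<union> fa_rename Inr ` R2 \<union> {supcomm p1 p2 a b | a b. True}"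

definition fa_tens :: "('g,'a::comm_ring_1) fa \<Rightarrow> ('h,'a) fa \<Rightarrow> ('g + 'h,'a) fa" where
  "fa_tens a b = fa_mult (fa_rename Inl a) (fa_rename Inr b)"
definition ps_tens :: "('g,'a::comm_ring_1) ps \<Rightarrow> ('h,'a) ps \<Rightarrow> ('g + 'h,'a) ps" where
  "ps_tens A B = (\<lambda>n w. \<Sum>i\<le>n. fa_tens (A i) (B (n - i)) w)"

fun lefts :: "('g + 'h) list \<Rightarrow> 'g list" where
  "lefts [] = []" | "lefts (Inl a # u) = a # lefts u" | "lefts (Inr b # u) = lefts u"
fun rights :: "('g + 'h) list \<Rightarrow> 'h list" where
  "rights [] = []" | "rights (Inl a # u) = rights u" | "rights (Inr b # u) = b # rights u"
text \<open>Sign produced by moving all Inl-letters of a word to the left of all Inr-letters.\<close>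
fun tens_sign :: "('g \<Rightarrow> bool) \<Rightarrow> ('h \<Rightarrow> bool) \<Rightarrow> ('g + 'h) list \<Rightarrow> 'a::comm_ring_1" where
  "tens_sign p1 p2 [] = 1"
| "tens_sign p1 p2 (Inl a # u) = tens_sign p1 p2 u"
| "tens_sign p1 p2 (Inr b # u) =
     (if p2 b \<and> odd (length (filter p1 (lefts u))) then -1 else 1) * tens_sign p1 p2 u"

text \<open>Lg i = L_i;  Gg j = G_(j + eps) where eps = 1/2 if the flag h is True, else 0,
so that K = eps + Z.\<close>
datatype sv_gen = Lg int | Gg int

fun sv_par :: "sv_gen \<Rightarrow> bool" where
  "sv_par (Lg i) = False" | "sv_par (Gg j) = True"

definition eps_val :: "bool \<Rightarrow> 'a::field" where
  "eps_val h = (if h then 1 / 2 else 0)"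

fun sv_br :: "bool \<Rightarrow> sv_gen \<Rightarrow> sv_gen \<Rightarrow> (sv_gen,'a::field) fa" where
  "sv_br h (Lg i) (Lg j) = fa_smul (of_int (j - i)) (fa_gen (Lg (i + j)))"
| "sv_br h (Lg i) (Gg j) = fa_smul (of_int j + eps_val h - of_int i / 2) (fa_gen (Gg (i + j)))"
| "sv_br h (Gg j) (Lg i) = fa_smul (- (of_int j + eps_val h - of_int i / 2)) (fa_gen (Gg (i + j)))"
| "sv_br h (Gg j) (Gg l) = fa_smul 2 (fa_gen (Lg (j + l + (if h then 1 else 0))))"

definition sv_rel :: "bool \<Rightarrow> (sv_gen,'a::field) fa set" where
  "sv_rel h = {fa_diff (fa_diff (fa_mult (fa_gen x) (fa_gen y))
                   (fa_smul (if sv_par x \<and> sv_par y then -1 else 1) (fa_mult (fa_gen y) (fa_gen x))))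
                 (sv_br h x y) | x y. True}"

definition sv_rel2 :: "bool \<Rightarrow> (sv_gen + sv_gen,'a::field) fa set" where
  "sv_rel2 h = tens_rel sv_par (sv_rel h) sv_par (sv_rel h)"
definition sv_rel3 :: "bool \<Rightarrow> (sv_gen + (sv_gen + sv_gen),'a::field) fa set" where
  "sv_rel3 h = tens_rel sv_par (sv_rel h) (sum_par sv_par sv_par) (sv_rel2 h)"

definition sv_L :: "int \<Rightarrow> (sv_gen,'a::field) fa" where "sv_L i = fa_gen (Lg i)"
definition sv_G :: "int \<Rightarrow> (sv_gen,'a::field) fa" where "sv_G j = fa_gen (Gg j)"

definition sv_X :: "int \<Rightarrow> 'a::field \<Rightarrow> (sv_gen,'a) fa" where
  "sv_X m \<alpha> = fa_smul (1 / of_int m) (fa_add (sv_L 0) (fa_smul (\<alpha> * of_int m) (sv_L (- m))))"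
definition sv_Y :: "int \<Rightarrow> 'a::field \<Rightarrow> (sv_gen,'a) fa" where
  "sv_Y m \<alpha> = fa_add (sv_L m) (fa_add (fa_smul (2 * \<alpha> * of_int m) (sv_L 0))
                                       (fa_smul (\<alpha>^2 * (of_int m)^2) (sv_L (- m))))"

primrec fa_rise :: "('g,'a::comm_ring_1) fa \<Rightarrow> 'a \<Rightarrow> nat \<Rightarrow> ('g,'a) fa" where
  "fa_rise x a 0 = fa_one"
| "fa_rise x a (Suc r) = fa_mult (fa_rise x a r) (fa_add x (fa_smul (a + of_nat r) fa_one))"
primrec fa_fall :: "('g,'a::comm_ring_1) fa \<Rightarrow> 'a \<Rightarrow> nat \<Rightarrow> ('g,'a) fa" where
  "fa_fall x a 0 = fa_one"
| "fa_fall x a (Suc r) = fa_mult (fa_fall x a r) (fa_add x (fa_smul (a - of_nat r) fa_one))"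

definition qbin :: "'a::field_char_0 \<Rightarrow> 'a \<Rightarrow> nat \<Rightarrow> 'a" where
  "qbin a c r = (\<Prod>j<r. a - of_nat j * c) / fact r"

definition coef_a :: "int \<Rightarrow> nat \<Rightarrow> nat \<Rightarrow> int \<Rightarrow> 'a::field_char_0" where
  "coef_a m s r i = (\<Sum>p\<le>s. (-1)^p
      * qbin (of_int i + of_int m) (of_int m) p
      * qbin (of_int i + (of_nat r - of_nat p - 2) * of_int m) (of_int m) r
      * qbin (of_int i + (of_nat r - of_nat p + 1) * of_int m) (of_int m) (s - p))"

definition coef_b :: "int \<Rightarrow> nat \<Rightarrow> nat \<Rightarrow> 'a \<Rightarrow> 'a::field_char_0" where
  "coef_b m s r k = (\<Sum>p\<le>s. (-1)^p
      * qbin (k + of_int m / 2) (of_int m) p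
      * qbin (k + (of_nat r - of_nat p - 3 / 2) * of_int m) (of_int m) r
      * qbin (k + (of_nat r - of_nat p + 1 / 2) * of_int m) (of_int m) (s - p))"

definition sv_DeltaL :: "int \<Rightarrow> 'a::field_char_0 \<Rightarrow> int \<Rightarrow> (sv_gen + sv_gen,'a) ps" where
  "sv_DeltaL m \<alpha> i = (let M = (of_int m :: 'a); X = sv_X m \<alpha>; Y = sv_Y m \<alpha> in
     ps_add
      (ps_tsum (\<lambda>r. ps_smul (\<alpha>^r * qbin ((of_nat r - 2) * M - of_int i) M r)
         (ps_tens (ps_const (sv_L (i - int r * m)))
            (ps_tpow r (ps_mult (ps_binom Y (of_int i / M - of_nat r)) (ps_const (fa_pow Y r)))))))
      (ps_tsum (\<lambda>r. ps_smul ((-1)^r)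
         (ps_sumset (\<lambda>s. ps_smul (\<alpha>^s * coef_a m s r i)
            (ps_tens (ps_const (fa_rise X 0 r))
               (ps_tpow r (ps_mult (ps_binom Y (- of_nat r))
                                   (ps_const (sv_L (i + (int r - int s) * m)))))))
          {0..2*r}))))"

definition sv_DeltaG :: "bool \<Rightarrow> int \<Rightarrow> 'a::field_char_0 \<Rightarrow> int \<Rightarrow> (sv_gen + sv_gen,'a) ps" where
  "sv_DeltaG h m \<alpha> j = (let M = (of_int m :: 'a); X = sv_X m \<alpha>; Y = sv_Y m \<alpha>;
                            k = of_int j + eps_val h in
     ps_add
      (ps_tsum (\<lambda>r. ps_smul (\<alpha>^r * qbin ((of_nat r - 3 / 2) * M - k) M r)
         (ps_tens (ps_const (sv_G (j - int r * m)))
            (ps_tpow r (ps_mult (ps_binom Y (k / M - of_nat r)) (ps_const (fa_pow Y r)))))))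
      (ps_tsum (\<lambda>r. ps_smul ((-1)^r)
         (ps_sumset (\<lambda>s. ps_smul (\<alpha>^s * coef_b m s r k)
            (ps_tens (ps_const (fa_rise X 0 r))
               (ps_tpow r (ps_mult (ps_binom Y (- of_nat r))
                                   (ps_const (sv_G (j + (int r - int s) * m)))))))
          {0..2*r}))))"

definition sv_SL :: "int \<Rightarrow> 'a::field_char_0 \<Rightarrow> int \<Rightarrow> (sv_gen,'a) ps" where
  "sv_SL m \<alpha> i = (let M = (of_int m :: 'a); X = sv_X m \<alpha>; Y = sv_Y m \<alpha> in
     ps_smul (-1) (ps_mult (ps_binom Y (- (of_int i / M)))
      (ps_tsum (\<lambda>r. ps_tsum (\<lambda>p. ps_sumset (\<lambda>q.
          ps_smul ((-1)^r * \<alpha>^(r + q) * qbin ((of_nat r - 2) * M - of_int i) M r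
                   * coef_a m q p (i - int r * m))
            (ps_tpow (r + p) (ps_const
               (fa_mult (fa_fall X (- (of_int i / M)) p)
                  (fa_mult (sv_L (i + (int p - int r - int q) * m)) (fa_pow Y r))))))
        {0..2*p})))))"

definition sv_SG :: "bool \<Rightarrow> int \<Rightarrow> 'a::field_char_0 \<Rightarrow> int \<Rightarrow> (sv_gen,'a) ps" where
  "sv_SG h m \<alpha> j = (let M = (of_int m :: 'a); X = sv_X m \<alpha>; Y = sv_Y m \<alpha>;
                         k = of_int j + eps_val h in
     ps_smul (-1) (ps_mult (ps_binom Y (- (k / M)))
      (ps_tsum (\<lambda>r. ps_tsum (\<lambda>p. ps_sumset (\<lambda>q.
          ps_smul ((-1)^r * \<alpha>^(r + q) * qbin ((of_nat r - 3 / 2) * M - k) M r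
                   * coef_b m q p (k - of_nat r * M))
            (ps_tpow (r + p) (ps_const
               (fa_mult (fa_fall X (- (k / M)) p)
                  (fa_mult (sv_G (j + (int p - int r - int q) * m)) (fa_pow Y r))))))
        {0..2*p})))))"

definition sv_Delta_gen :: "bool \<Rightarrow> int \<Rightarrow> 'a::field_char_0 \<Rightarrow> sv_gen \<Rightarrow> (sv_gen + sv_gen,'a) ps" where
  "sv_Delta_gen h m \<alpha> g = (case g of Lg i \<Rightarrow> sv_DeltaL m \<alpha> i | Gg j \<Rightarrow> sv_DeltaG h m \<alpha> j)"
definition sv_S_gen :: "bool \<Rightarrow> int \<Rightarrow> 'a::field_char_0 \<Rightarrow> sv_gen \<Rightarrow> (sv_gen,'a) ps" where
  "sv_S_gen h m \<alpha> g = (case g of Lg i \<Rightarrow> sv_SL m \<alpha> i | Gg j \<Rightarrow> sv_SG h m \<alpha> j)"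

definition sv_Delta :: "bool \<Rightarrow> int \<Rightarrow> 'a::field_char_0 \<Rightarrow> (sv_gen,'a) ps \<Rightarrow> (sv_gen + sv_gen,'a) ps" where
  "sv_Delta h m \<alpha> = hom_ext (sv_Delta_gen h m \<alpha>)"

text \<open>epsilon: algebra homomorphism to F[[t]] (identified with F[[t]] 1 inside U(L)[[t]])
with epsilon(L_i) = epsilon(G_k) = 0, epsilon(1) = 1.\<close>
definition sv_eps :: "(sv_gen,'a::field_char_0) ps \<Rightarrow> (sv_gen,'a) ps" where
  "sv_eps = hom_ext (\<lambda>g. ps_zero)"

definition sv_S :: "bool \<Rightarrow> int \<Rightarrow> 'a::field_char_0 \<Rightarrow> (sv_gen,'a) ps \<Rightarrow> (sv_gen,'a) ps" where
  "sv_S h m \<alpha> = anti_ext sv_par (sv_S_gen h m \<alpha>)"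

definition sv_Delta_id :: "bool \<Rightarrow> int \<Rightarrow> 'a::field_char_0 \<Rightarrow> (sv_gen + sv_gen,'a) ps
     \<Rightarrow> (sv_gen + (sv_gen + sv_gen),'a) ps" where
  "sv_Delta_id h m \<alpha> = hom_ext (\<lambda>c. case c of
       Inl g \<Rightarrow> ps_rename (case_sum Inl (\<lambda>b. Inr (Inl b))) (sv_Delta_gen h m \<alpha> g)
     | Inr g \<Rightarrow> ps_const (fa_gen (Inr (Inr g))))"
definition sv_id_Delta :: "bool \<Rightarrow> int \<Rightarrow> 'a::field_char_0 \<Rightarrow> (sv_gen + sv_gen,'a) ps
     \<Rightarrow> (sv_gen + (sv_gen + sv_gen),'a) ps" where
  "sv_id_Delta h m \<alpha> = hom_ext (\<lambda>c. case c of
       Inl g \<Rightarrow> ps_const (fa_gen (Inl g))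
     | Inr g \<Rightarrow> ps_rename Inr (sv_Delta_gen h m \<alpha> g))"

definition sv_eps_id :: "(sv_gen + sv_gen,'a::field_char_0) ps \<Rightarrow> (sv_gen,'a) ps" where
  "sv_eps_id = hom_ext (case_sum (\<lambda>g. ps_zero) (\<lambda>g. ps_const (fa_gen g)))"
definition sv_id_eps :: "(sv_gen + sv_gen,'a::field_char_0) ps \<Rightarrow> (sv_gen,'a) ps" where
  "sv_id_eps = hom_ext (case_sum (\<lambda>g. ps_const (fa_gen g)) (\<lambda>g. ps_zero))"

definition sv_mult_S_id :: "bool \<Rightarrow> int \<Rightarrow> 'a::field_char_0 \<Rightarrow> (sv_gen + sv_gen,'a) ps \<Rightarrow> (sv_gen,'a) ps" where
  "sv_mult_S_id h m \<alpha> = ser_ext (\<lambda>u. ps_smul (tens_sign sv_par sv_par u)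
       (ps_mult (ps_aword sv_par (sv_S_gen h m \<alpha>) (lefts u)) (ps_const (fa_word (rights u)))))"
definition sv_mult_id_S :: "bool \<Rightarrow> int \<Rightarrow> 'a::field_char_0 \<Rightarrow> (sv_gen + sv_gen,'a) ps \<Rightarrow> (sv_gen,'a) ps" where
  "sv_mult_id_S h m \<alpha> = ser_ext (\<lambda>u. ps_smul (tens_sign sv_par sv_par u)
       (ps_mult (ps_const (fa_word (lefts u))) (ps_aword sv_par (sv_S_gen h m \<alpha>) (rights u))))"

text \<open>The super flip tau(a (x) b) = (-1)^{[a][b]} b (x) a on (U (x) U)[[t]] (an algebra
automorphism of the super tensor product, given by exchanging the two copies of the
generators).\<close>
definition sv_flip :: "(sv_gen + sv_gen,'a::field_char_0) ps \<Rightarrow> (sv_gen + sv_gen,'a) ps" where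
  "sv_flip = hom_ext (\<lambda>c. ps_const (fa_gen (case c of Inl a \<Rightarrow> Inr a | Inr b \<Rightarrow> Inl b)))"

end

theory Submission
  imports Defs "HOL-Computational_Algebra.Formal_Power_Series" "HOL-Library.Product_Plus"
begin

text \<open>Put \<open>F = \<Sum>\<^sub>n (-1)\<^sup>n/n! X(X-1)\<dots>(X-n+1) \<otimes> Y\<^sup>n t\<^sup>n\<close>, that is \<open>(1 - Y\<^sub>2 t)\<close> to the power \<open>X\<^sub>1\<close> in the tensor square,
and \<open>u = exp (t X Y)\<close>. On generators the coproduct is \<open>\<Delta>(g) = F (g \<otimes> 1 + 1 \<otimes> g) F\<^sup>-\<^sup>1\<close> and the antipode
is \<open>S(g) = - u g u\<^sup>-\<^sup>1\<close>: conjugating \<open>g \<otimes> 1\<close> by \<open>F\<close> only involves \<open>ad X\<close>, which leads out of the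
eigenvectors of \<open>ad L\<^sub>0\<close> by a first order recursion, and conjugating \<open>1 \<otimes> g\<close> only involves the divided
powers of \<open>ad Y\<close>, whose coefficients are \<open>a\<^sub>s\<close> and \<open>b\<^sub>s\<close>. Hence \<open>\<Delta>\<close> and \<open>S\<close> respect the relations,
and coassociativity becomes the cocycle identity for \<open>F\<close>. The identities between power series in \<open>t\<close> hold because
both sides solve the same linear differential equation. For the antipode axioms, multiplication after
\<open>S \<otimes> id\<close> is realised by the tensor square acting on \<open>U\<close> from both sides, where
\<open>\<Delta>(g)\<close> kills the unit because \<open>u\<close> implements the action of \<open>F\<close>.\<close>

section \<open>Free algebras and their quotients\<close>

text \<open>No basis of U(L) is used: equality in it is membership of a difference in an ideal, and
  there is no normal form to compare. Identities are therefore proved in an arbitrary algebra whose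
  elements satisfy the relations, and the presented algebras are instances of this. For the same
  reason the explicit coproduct cannot be rewritten inside the free algebra. A second series,
  \<open>Delta_raw\<close>, is the conjugate by F under every assignment of the generators and
  replaces the explicit formula before a homomorphism is applied. Inequalities need a concrete
  module, since a presentation alone might collapse. The series u is obtained from F by applying the
  untwisted antipode S0(g) = -g to the second tensor factor and multiplying the two factors, which
  is how a twist changes an antipode in general. Multiplication after S \<otimes> id is not an
  algebra homomorphism, hence the detour through actions from two sides. Their signs require
  anticommuting J and K with squares -1 and 1; scalars cannot provide these, which is why U is
  doubled.\<close>

definition fa_fin :: "('g,'a::zero) fa \<Rightarrow> bool" where
  "fa_fin f \<longleftrightarrow> finite (fa_supp f)"

lemma fa_diff_eq: "fa_diff f g = fa_add f (fa_smul (-1) (g::('g,'a::ring_1) fa))"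
  by (rule ext) (simp add: fa_diff_def fa_add_def fa_smul_def)

lemma fa_fin_subset: "fa_fin f \<Longrightarrow> fa_supp g \<subseteq> fa_supp f \<Longrightarrow> fa_fin g"
  by (auto simp: fa_fin_def intro: finite_subset)

lemma fa_fin_zero [simp]: "fa_fin fa_zero"
  by (simp add: fa_fin_def fa_supp_def fa_zero_def)

lemma fa_fin_word [simp]: "fa_fin (fa_word u)"
  by (simp add: fa_fin_def fa_supp_def fa_word_def)

lemma fa_fin_one [simp]: "fa_fin fa_one" and fa_fin_gen [simp]: "fa_fin (fa_gen g)"
  by (simp_all add: fa_one_def fa_gen_def)

lemma fa_fin_add [simp]: "fa_fin f \<Longrightarrow> fa_fin g \<Longrightarrow> fa_fin (fa_add f (g::('g,'a::comm_ring_1) fa))"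
  unfolding fa_fin_def
  by (rule finite_subset[of _ "fa_supp f \<union> fa_supp g"]) (auto simp: fa_supp_def fa_add_def)

lemma fa_fin_smul [simp]: "fa_fin f \<Longrightarrow> fa_fin (fa_smul c (f::('g,'a::comm_ring_1) fa))"
  by (erule fa_fin_subset) (auto simp: fa_supp_def fa_smul_def)

lemma fa_fin_diff [simp]: "fa_fin f \<Longrightarrow> fa_fin g \<Longrightarrow> fa_fin (fa_diff f (g::('g,'a::comm_ring_1) fa))"
  by (simp add: fa_diff_eq)

lemma fa_fin_mult [simp]:
  fixes f g :: "('g,'a::comm_ring_1) fa"
  assumes "fa_fin f" "fa_fin g" shows "fa_fin (fa_mult f g)"
proof -
  have "fa_supp (fa_mult f g) \<subseteq> (\<lambda>(u, v). u @ v) ` (fa_supp f \<times> fa_supp g)"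
  proof
    fix w assume "w \<in> fa_supp (fa_mult f g)"
    then have "(\<Sum>i\<le>length w. f (take i w) * g (drop i w)) \<noteq> 0"
      by (simp add: fa_supp_def fa_mult_def)
    then obtain i where "f (take i w) * g (drop i w) \<noteq> 0"
      by (meson sum.not_neutral_contains_not_neutral)
    then have "(take i w, drop i w) \<in> fa_supp f \<times> fa_supp g"
      by (auto simp: fa_supp_def)
    then show "w \<in> (\<lambda>(u, v). u @ v) ` (fa_supp f \<times> fa_supp g)"
      by (rule rev_image_eqI) simp
  qed
  then show ?thesis
    using assms by (auto simp: fa_fin_def intro: finite_subset)
qed

lemma fa_fin_pow [simp]: "fa_fin f \<Longrightarrow> fa_fin (fa_pow f n)"
  by (induction n) auto

lemma fa_fin_rise [simp]: "fa_fin f \<Longrightarrow> fa_fin (fa_rise f a n)"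
  and fa_fin_fall [simp]: "fa_fin f \<Longrightarrow> fa_fin (fa_fall f a n)"
  by (induction n) auto

lemma fa_mult_add_left: "fa_mult (fa_add f g) k = fa_add (fa_mult f k) (fa_mult g k)"
  and fa_mult_add_right: "fa_mult k (fa_add f g) = fa_add (fa_mult k f) (fa_mult k g)"
  and fa_mult_smul_left: "fa_mult (fa_smul c f) k = fa_smul c (fa_mult f k)"
  and fa_mult_smul_right: "fa_mult k (fa_smul c f) = fa_smul c (fa_mult k f)"
  by (auto simp: fa_mult_def fa_add_def fa_smul_def sum.distrib sum_distrib_left algebra_simps
      intro!: ext)

text \<open>Both sides run over the pairs (j, k) with j + k at most n. Applied to the two cut points
  of a word, or to degrees in t, this is associativity of a convolution.\<close>

lemma sum_triangle:
  fixes F :: "nat \<Rightarrow> nat \<Rightarrow> 'a::comm_monoid_add"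
  shows "(\<Sum>i\<le>n. \<Sum>j\<le>i. F j (i - j)) = (\<Sum>j\<le>n. \<Sum>k\<le>n - j. F j k)"
  using fps_mult_assoc_lemma[of "\<lambda>i j _. F i j" n n] by (simp add: atMost_atLeast0)

lemma fa_mult_assoc: "fa_mult (fa_mult f g) k = fa_mult f (fa_mult g k)"
proof
  fix w
  have "fa_mult (fa_mult f g) k w =
    (\<Sum>i\<le>length w. \<Sum>j\<le>i. f (take j w) * g (take (i - j) (drop j w)) * k (drop (j + (i - j)) w))"
    by (auto simp: fa_mult_def sum_distrib_right min_def drop_take intro!: sum.cong)
  also have "\<dots> = (\<Sum>j\<le>length w. \<Sum>i\<le>length w - j. f (take j w) * g (take i (drop j w)) * k (drop (j + i) w))"
    by (rule sum_triangle)
  also have "\<dots> = fa_mult f (fa_mult g k) w"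
    by (auto simp: fa_mult_def sum_distrib_left mult.assoc add.commute intro!: sum.cong)
  finally show "fa_mult (fa_mult f g) k w = fa_mult f (fa_mult g k) w" .
qed

lemma fa_mult_one_left [simp]: "fa_mult fa_one f = f"
proof
  fix w
  have "fa_mult fa_one f w = (\<Sum>i\<le>length w. if i = 0 then f w else 0)"
    unfolding fa_mult_def by (rule sum.cong) (auto simp: fa_one_def fa_word_def)
  then show "fa_mult fa_one f w = f w" by simp
qed

lemma fa_mult_one_right [simp]: "fa_mult f fa_one = f"
proof
  fix w
  have "fa_mult f fa_one w = (\<Sum>i\<le>length w. if i = length w then f w else 0)"
    unfolding fa_mult_def by (rule sum.cong) (auto simp: fa_one_def fa_word_def)
  then show "fa_mult f fa_one w = f w" by simp
qed

lemma fa_mult_word: "fa_mult (fa_word u) (fa_word v) = (fa_word (u @ v) :: ('g,'a::comm_ring_1) fa)"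
proof
  fix w
  have "fa_mult (fa_word u) (fa_word v) w =
      (\<Sum>i\<le>length w. if i = length u then (if w = u @ v then 1 else (0::'a)) else 0)"
    unfolding fa_mult_def
  proof (rule sum.cong)
    fix i assume "i \<in> {..length w}"
    then have "take i w = u \<and> drop i w = v \<longleftrightarrow> i = length u \<and> w = u @ v" by auto
    then show "fa_word u (take i w) * fa_word v (drop i w) =
        (if i = length u then (if w = u @ v then 1 else (0::'a)) else 0)"
      unfolding fa_word_def by (cases "take i w = u"; cases "drop i w = v") auto
  qed simp
  then show "fa_mult (fa_word u) (fa_word v) w = (fa_word (u @ v) w :: 'a)"
    by (cases "w = u @ v") (simp_all add: fa_word_def[of "u @ v"])
qed

lemma fa_mult_zero [simp]: "fa_mult fa_zero f = fa_zero" "fa_mult f fa_zero = fa_zero"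
  by (simp_all add: fa_mult_def fa_zero_def)

lemma fa_mult_Nil: "fa_mult f g [] = f [] * g []"
  by (simp add: fa_mult_def)

text \<open>Linear induction: an element of finite support loses one word at a time, so identities
  between linear maps reduce to words.\<close>

lemma fa_fin_induct [consumes 1, case_names zero add]:
  fixes f :: "('g,'a::comm_ring_1) fa"
  assumes "fa_fin f" and z: "P fa_zero"
    and s: "\<And>c u f. fa_fin f \<Longrightarrow> P f \<Longrightarrow> P (fa_add (fa_smul c (fa_word u)) f)"
  shows "P f"
proof -
  have "fa_supp f \<subseteq> A \<Longrightarrow> P f" if "finite A" for A
    using that
  proof (induction A arbitrary: f rule: finite_induct)
    case empty
    then have "f = fa_zero" by (auto simp: fa_supp_def fa_zero_def)
    then show ?case using z by simp
  next
    case (insert u A)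
    let ?g = "f(u := 0)"
    have sub: "fa_supp ?g \<subseteq> A" using insert.prems by (auto simp: fa_supp_def)
    then have "fa_fin ?g" using insert.hyps by (auto simp: fa_fin_def intro: finite_subset)
    moreover have "P ?g" using sub by (rule insert.IH)
    ultimately have "P (fa_add (fa_smul (f u) (fa_word u)) ?g)" by (rule s)
    moreover have "fa_add (fa_smul (f u) (fa_word u)) ?g = f"
      by (auto simp: fa_add_def fa_smul_def fa_word_def)
    ultimately show ?case by simp
  qed
  then show ?thesis using assms(1) by (auto simp: fa_fin_def)
qed

text \<open>\<open>fa_ideal\<close> is closed under multiplication by words only; finite support of
  b turns the product into a finite sum of such multiples.\<close>

lemma fa_ideal_mult_right:
  assumes "a \<in> fa_ideal R" "fa_fin b"
  shows "fa_mult a b \<in> fa_ideal R"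
  using assms(2)
proof (induction b rule: fa_fin_induct)
  case zero
  then show ?case by (simp add: fa_ideal.zero)
next
  case (add c u f)
  have "fa_mult a (fa_word u) \<in> fa_ideal R"
    using fa_ideal.mult[OF assms(1), of "[]" u] by (simp flip: fa_one_def)
  then show ?case using add
    by (simp add: fa_mult_add_right fa_mult_smul_right fa_ideal.add fa_ideal.smul)
qed

lemma fa_ideal_mult_left:
  assumes "a \<in> fa_ideal R" "fa_fin b"
  shows "fa_mult b a \<in> fa_ideal R"
  using assms(2)
proof (induction b rule: fa_fin_induct)
  case zero
  then show ?case by (simp add: fa_ideal.zero)
next
  case (add c u f)
  have "fa_mult (fa_word u) a \<in> fa_ideal R"
    using fa_ideal.mult[OF assms(1), of u "[]"] by (simp flip: fa_one_def)
  then show ?case using add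
    by (simp add: fa_mult_add_left fa_mult_smul_left fa_ideal.add fa_ideal.smul)
qed

text \<open>Finite support belongs to the relation because the ideal absorbs only factors of finite
  support. Hence the quotient below is by a partial equivalence.\<close>

definition fa_cong :: "('g,'a::comm_ring_1) fa set \<Rightarrow> ('g,'a) fa \<Rightarrow> ('g,'a) fa \<Rightarrow> bool" where
  "fa_cong R f g \<longleftrightarrow> fa_fin f \<and> fa_fin g \<and> fa_diff f g \<in> fa_ideal R"

lemma fa_cong_refl: "fa_fin f \<Longrightarrow> fa_cong R f f"
proof -
  have "fa_diff f f = fa_zero" by (simp add: fa_diff_def fa_zero_def)
  then show "fa_fin f \<Longrightarrow> fa_cong R f f" by (simp add: fa_cong_def fa_ideal.zero)
qed

lemma fa_cong_sym: "fa_cong R f g \<Longrightarrow> fa_cong R g f"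
proof -
  have "fa_diff g f = fa_smul (-1) (fa_diff f g)" by (auto simp: fa_diff_def fa_smul_def)
  then show "fa_cong R f g \<Longrightarrow> fa_cong R g f" by (simp add: fa_cong_def fa_ideal.smul)
qed

lemma fa_cong_trans: "fa_cong R f g \<Longrightarrow> fa_cong R g k \<Longrightarrow> fa_cong R f k"
proof -
  have "fa_diff f k = fa_add (fa_diff f g) (fa_diff g k)" by (auto simp: fa_diff_def fa_add_def)
  then show "fa_cong R f g \<Longrightarrow> fa_cong R g k \<Longrightarrow> fa_cong R f k"
    by (simp add: fa_cong_def fa_ideal.add)
qed

lemma fa_cong_add: "fa_cong R f f' \<Longrightarrow> fa_cong R g g' \<Longrightarrow> fa_cong R (fa_add f g) (fa_add f' g')"
proof -
  have "fa_diff (fa_add f g) (fa_add f' g') = fa_add (fa_diff f f') (fa_diff g g')"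
    by (auto simp: fa_diff_def fa_add_def)
  then show "fa_cong R f f' \<Longrightarrow> fa_cong R g g' \<Longrightarrow> fa_cong R (fa_add f g) (fa_add f' g')"
    by (simp add: fa_cong_def fa_ideal.add)
qed

lemma fa_cong_smul: "fa_cong R f f' \<Longrightarrow> fa_cong R (fa_smul c f) (fa_smul c f')"
proof -
  have "fa_diff (fa_smul c f) (fa_smul c f') = fa_smul c (fa_diff f f')"
    by (auto simp: fa_diff_def fa_smul_def algebra_simps)
  then show "fa_cong R f f' \<Longrightarrow> fa_cong R (fa_smul c f) (fa_smul c f')"
    by (simp add: fa_cong_def fa_ideal.smul)
qed

lemma fa_cong_mult:
  assumes "fa_cong R f f'" "fa_cong R g g'"
  shows "fa_cong R (fa_mult f g) (fa_mult f' g')"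
proof -
  have "fa_diff (fa_mult f g) (fa_mult f' g') =
      fa_add (fa_mult (fa_diff f f') g) (fa_mult f' (fa_diff g g'))"
    by (auto simp: fa_diff_def fa_add_def fa_mult_def algebra_simps sum.distrib sum_subtractf)
  then show ?thesis
    using assms by (simp add: fa_cong_def fa_ideal.add fa_ideal_mult_left fa_ideal_mult_right)
qed

section \<open>Presented algebras as a ring type\<close>

definition qalg_rel :: "(('g,'a::comm_ring_1) fa set \<Rightarrow> ('g,'a) fa) \<Rightarrow> (('g,'a) fa set \<Rightarrow> ('g,'a) fa) \<Rightarrow> bool"
  where "qalg_rel f g \<longleftrightarrow> (\<forall>R. fa_cong R (f R) (g R))"

lemma part_equivp_qalg_rel: "part_equivp qalg_rel"
proof (rule part_equivpI)
  show "\<exists>x. qalg_rel x x"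
    by (rule exI[of _ "\<lambda>_. fa_zero"]) (simp add: qalg_rel_def fa_cong_refl)
  show "symp qalg_rel"
    by (auto simp: symp_def qalg_rel_def intro: fa_cong_sym)
  show "transp qalg_rel"
    unfolding transp_def qalg_rel_def by (meson fa_cong_trans)
qed

text \<open>A HOL type cannot depend on a set of relations.  The product over all \<open>R\<close> of the
algebras presented by \<open>R\<close> is a single ring containing each of them.\<close>

quotient_type (overloaded) ('g,'a) qalg =
  "('g,'a::comm_ring_1) fa set \<Rightarrow> ('g,'a) fa" / partial: qalg_rel
  by (rule part_equivp_qalg_rel)

instantiation qalg :: (type, comm_ring_1) ring_1
begin

lift_definition zero_qalg :: "('a,'b) qalg" is "\<lambda>R. fa_zero" by (simp add: qalg_rel_def fa_cong_refl)
lift_definition one_qalg :: "('a,'b) qalg" is "\<lambda>R. fa_one" by (simp add: qalg_rel_def fa_cong_refl)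
lift_definition plus_qalg :: "('a,'b) qalg \<Rightarrow> ('a,'b) qalg \<Rightarrow> ('a,'b) qalg"
  is "\<lambda>f g R. fa_add (f R) (g R)" by (simp add: qalg_rel_def fa_cong_add)
lift_definition uminus_qalg :: "('a,'b) qalg \<Rightarrow> ('a,'b) qalg"
  is "\<lambda>f R. fa_smul (-1) (f R)" by (simp add: qalg_rel_def fa_cong_smul)
lift_definition minus_qalg :: "('a,'b) qalg \<Rightarrow> ('a,'b) qalg \<Rightarrow> ('a,'b) qalg"
  is "\<lambda>f g R. fa_diff (f R) (g R)" by (simp add: qalg_rel_def fa_cong_add fa_cong_smul fa_diff_eq)
lift_definition times_qalg :: "('a,'b) qalg \<Rightarrow> ('a,'b) qalg \<Rightarrow> ('a,'b) qalg"
  is "\<lambda>f g R. fa_mult (f R) (g R)" by (simp add: qalg_rel_def fa_cong_mult)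

instance
proof
  fix a b c :: "('a,'b) qalg"
  have fin: "fa_fin (x R)" if "qalg_rel x x" for x :: "('a,'b) fa set \<Rightarrow> ('a,'b) fa" and R
    using that by (auto simp: qalg_rel_def fa_cong_def)
  show "a * b * c = a * (b * c)"
    by transfer (simp add: qalg_rel_def fa_mult_assoc fa_cong_refl fin)
  show "1 * a = a" by transfer simp
  show "a * 1 = a" by transfer simp
  show "(a + b) * c = a * c + b * c"
    by transfer (simp add: qalg_rel_def fa_mult_add_left fa_cong_refl fin)
  show "a * (b + c) = a * b + a * c"
    by transfer (simp add: qalg_rel_def fa_mult_add_right fa_cong_refl fin)
  have add: "fa_add (fa_add f g) k = fa_add f (fa_add g k)" "fa_add f g = fa_add g f"
    "fa_add fa_zero f = f" "fa_add (fa_smul (-1) f) f = fa_zero" "fa_add f (fa_smul (-1) f) = fa_zero" for f g k :: "('a,'b) fa"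
    by (auto simp: fa_add_def fa_zero_def fa_smul_def add.assoc add.commute)
  show "a + b + c = a + (b + c)" by transfer (simp add: qalg_rel_def add(1) fa_cong_refl fin)
  show "a + b = b + a"
    by transfer (subst add(2), simp add: qalg_rel_def fa_cong_refl fin)
  show "0 + a = a" by transfer (simp add: add(3))
  show "- a + a = 0" by transfer (simp add: qalg_rel_def add(4) fa_cong_refl)
  show "a - b = a + - b" by transfer (simp add: qalg_rel_def fa_diff_eq fa_cong_refl fin)
  \<comment> \<open>The factor at the empty set of relations is the free algebra itself, where 1
    differs from 0; this suffices for the whole product.\<close>
  have "f = fa_zero" if "f \<in> fa_ideal {}" for f :: "('a,'b) fa"
    using that by induction (auto simp: fa_zero_def fa_add_def fa_smul_def fa_mult_def)
  moreover have "fa_diff fa_zero fa_one \<noteq> (fa_zero :: ('a,'b) fa)"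
    by (auto simp: fa_diff_def fa_zero_def fa_one_def fa_word_def fun_eq_iff)
  ultimately have "\<not> fa_cong {} fa_zero (fa_one :: ('a,'b) fa)"
    by (auto simp: fa_cong_def)
  then show "(0::('a,'b) qalg) \<noteq> 1"
    by transfer (auto simp: qalg_rel_def)
qed

end

unbundle fps_syntax

section \<open>Evaluation in an algebra\<close>

locale calg =
  fixes sc :: "'a::field_char_0 \<Rightarrow> 'b::ring_1"
  assumes sc_add: "sc (x + y) = sc x + sc y"
    and sc_mult: "sc (x * y) = sc x * sc y"
    and sc_1 [simp]: "sc 1 = 1"
    and sc_comm: "b * sc x = sc x * b"
begin

lemma sc_0 [simp]: "sc 0 = 0" using sc_add[of 0 0] by simp
lemma sc_minus: "sc (- x) = - sc x" using sc_add[of x "- x"] by (simp add: eq_neg_iff_add_eq_0 add.commute)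
lemma sc_diff: "sc (x - y) = sc x - sc y" using sc_add[of x "- y"] by (simp add: sc_minus)
lemma sc_of_nat [simp]: "sc (of_nat n) = of_nat n" by (induction n) (simp_all add: sc_add)
lemma sc_neg1 [simp]: "sc (- 1) = - 1" by (simp add: sc_minus)
lemma sc_power: "sc (x ^ n) = sc x ^ n" by (induction n) (simp_all add: sc_mult)
lemma sc_left_commute: "b * (sc x * d) = sc x * (b * d)"
  by (metis mult.assoc sc_comm)

lemma of_nat_cancel: "of_nat (Suc n) * b = of_nat (Suc n) * c \<Longrightarrow> b = c"
  for b c :: 'b
proof -
  assume "of_nat (Suc n) * b = of_nat (Suc n) * c"
  then have "sc (1 / of_nat (Suc n)) * (sc (of_nat (Suc n)) * b) = sc (1 / of_nat (Suc n)) * (sc (of_nat (Suc n)) * c)"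
    unfolding sc_of_nat by (rule arg_cong)
  moreover have "sc (1 / of_nat (Suc n)) * (sc (of_nat (Suc n)) * d) = d" for d
    using of_nat_neq_0[of n, where 'a = 'a]
    by (simp add: mult.assoc[symmetric] sc_mult[symmetric] del: of_nat_Suc sc_of_nat)
  ultimately show "b = c" by simp
qed

end

abbreviation (input) fsc :: "('a \<Rightarrow> 'b::zero) \<Rightarrow> 'a \<Rightarrow> 'b fps" where
  "fsc sc c \<equiv> fps_const (sc c)"

lemma (in calg) calg_fps: "calg (fsc sc)"
proof
  show "b * fsc sc x = fsc sc x * b" for b x
    by (rule fps_ext) (simp add: sc_comm)
qed (simp_all add: sc_add sc_mult)

text \<open>W is an arbitrary function of words: besides homomorphisms it has to cover
  super-antihomomorphisms, words with signs and actions on a module.\<close>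

definition lin :: "('a::zero \<Rightarrow> 'b::ring_1) \<Rightarrow> ('g list \<Rightarrow> 'b) \<Rightarrow> ('g,'a) fa \<Rightarrow> 'b" where
  "lin sc W f = (\<Sum>u\<in>fa_supp f. sc (f u) * W u)"

abbreviation wd :: "('g \<Rightarrow> 'b::monoid_mult) \<Rightarrow> 'g list \<Rightarrow> 'b" where
  "wd A u \<equiv> prod_list (map A u)"

abbreviation hv :: "('a::zero \<Rightarrow> 'b::ring_1) \<Rightarrow> ('g \<Rightarrow> 'b) \<Rightarrow> ('g,'a) fa \<Rightarrow> 'b" where
  "hv sc A \<equiv> lin sc (wd A)"

primrec rise :: "'b::ring_1 \<Rightarrow> nat \<Rightarrow> 'b" where
  "rise x 0 = 1" | "rise x (Suc n) = rise x n * (x + of_nat n)"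
primrec fall :: "'b::ring_1 \<Rightarrow> nat \<Rightarrow> 'b" where
  "fall x 0 = 1" | "fall x (Suc n) = fall x n * (x - of_nat n)"

context calg
begin

lemma lin_superset: "finite A \<Longrightarrow> fa_supp f \<subseteq> A \<Longrightarrow> lin sc W f = (\<Sum>u\<in>A. sc (f u) * W u)"
  unfolding lin_def by (rule sum.mono_neutral_left) (auto simp: fa_supp_def)

lemma lin_zero [simp]: "lin sc W fa_zero = 0"
  by (simp add: lin_def fa_supp_def fa_zero_def)

lemma lin_add: "fa_fin f \<Longrightarrow> fa_fin g \<Longrightarrow> lin sc W (fa_add f g) = lin sc W f + lin sc W g"
proof -
  assume fin: "fa_fin f" "fa_fin g"
  let ?A = "fa_supp f \<union> fa_supp g"
  have "finite ?A" using fin by (simp add: fa_fin_def)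
  moreover have "fa_supp (fa_add f g) \<subseteq> ?A" by (auto simp: fa_supp_def fa_add_def)
  ultimately show ?thesis
    by (simp add: lin_superset[of ?A] fa_add_def sc_add distrib_right sum.distrib)
qed

lemma lin_smul: "fa_fin f \<Longrightarrow> lin sc W (fa_smul c f) = sc c * lin sc W f"
proof -
  assume fin: "fa_fin f"
  have "fa_supp (fa_smul c f) \<subseteq> fa_supp f" by (auto simp: fa_supp_def fa_smul_def)
  then show ?thesis using fin
    by (simp add: lin_superset[of "fa_supp f"] fa_smul_def fa_fin_def sc_mult sum_distrib_left mult.assoc)
qed

lemma lin_diff: "fa_fin f \<Longrightarrow> fa_fin g \<Longrightarrow> lin sc W (fa_diff f g) = lin sc W f - lin sc W g"
  by (simp add: fa_diff_eq lin_add lin_smul)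

lemma lin_word [simp]: "lin sc W (fa_word u) = W u"
proof -
  have "fa_supp (fa_word u :: ('c,'a) fa) = {u}" by (auto simp: fa_supp_def fa_word_def)
  then show ?thesis by (simp add: lin_def fa_word_def)
qed

lemma lin_mult:
  assumes W: "\<And>u v. W (u @ v) = W u * W v" and "fa_fin f" "fa_fin g"
  shows "lin sc W (fa_mult f g) = lin sc W f * lin sc W g"
  using assms(2)
proof (induction f rule: fa_fin_induct)
  case zero
  have "fa_mult fa_zero g = fa_zero" by (simp add: fa_mult_def fa_zero_def)
  show ?case by simp
next
  case (add c u f)
  have "lin sc W (fa_mult (fa_word u) g) = W u * lin sc W g"
    using assms(3)
  proof (induction g rule: fa_fin_induct)
    case zero
    show ?case by simp
  next
    case (add d v g)
    then show ?case
      by (simp add: fa_mult_add_right fa_mult_smul_right fa_mult_word lin_add lin_smul W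
          distrib_left sc_left_commute)
  qed
  then show ?case using add assms(3)
    by (simp add: fa_mult_add_left fa_mult_smul_left lin_add lin_smul distrib_right mult.assoc)
qed

lemma hv_one [simp]: "hv sc A fa_one = 1" and hv_gen [simp]: "hv sc A (fa_gen g) = A g"
  by (simp_all add: fa_one_def fa_gen_def)

lemma hv_mult: "fa_fin f \<Longrightarrow> fa_fin g \<Longrightarrow> hv sc A (fa_mult f g) = hv sc A f * hv sc A g"
  by (rule lin_mult) simp_all

lemma hv_pow: "fa_fin f \<Longrightarrow> hv sc A (fa_pow f n) = hv sc A f ^ n"
  by (induction n) (simp_all add: hv_mult)

lemma hv_rise: "fa_fin f \<Longrightarrow> hv sc A (fa_rise f a n) = rise (hv sc A f + sc a) n"
  by (induction n) (simp_all add: hv_mult lin_add lin_smul sc_add add.assoc)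

lemma hv_fall: "fa_fin f \<Longrightarrow> hv sc A (fa_fall f a n) = fall (hv sc A f + sc a) n"
  by (induction n) (simp_all add: hv_mult lin_add lin_smul sc_diff add_diff_eq)

end

lemma fa_rename_add: "fa_rename h (fa_add f g) = fa_add (fa_rename h f) (fa_rename h g)"
  and fa_rename_smul: "fa_rename h (fa_smul c f) = fa_smul c (fa_rename h f)"
  and fa_rename_zero: "fa_rename h fa_zero = fa_zero"
  by (auto simp: fa_rename_def fa_add_def fa_smul_def fa_zero_def sum.distrib sum_distrib_left)

lemma fa_rename_word:
  assumes "inj h" shows "fa_rename h (fa_word u) = (fa_word (map h u) :: ('h,'a::comm_ring_1) fa)"
proof
  fix w
  show "fa_rename h (fa_word u) w = (fa_word (map h u) w :: 'a)"
  proof (cases "w = map h u")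
    case True
    then have "{v. map h v = w} = {u}" using assms by (auto simp: inj_map_eq_map)
    then show ?thesis using True by (simp add: fa_rename_def fa_word_def)
  next
    case False
    then show ?thesis by (auto simp: fa_rename_def fa_word_def intro!: sum.neutral)
  qed
qed

lemma fa_fin_rename [simp]:
  assumes "inj h" "fa_fin f" shows "fa_fin (fa_rename h f)"
  using assms(2) by (induction f rule: fa_fin_induct)
    (simp_all add: fa_rename_zero fa_rename_add fa_rename_smul fa_rename_word assms(1))

lemma (in calg) lin_rename:
  assumes "inj h" "fa_fin f" shows "lin sc W (fa_rename h f) = lin sc (\<lambda>u. W (map h u)) f"
  using assms(2) by (induction f rule: fa_fin_induct)
    (simp_all add: fa_rename_zero fa_rename_add fa_rename_smul fa_rename_word assms(1) lin_add lin_smul)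

lemma (in calg) hv_rename:
  assumes "inj h" "fa_fin f" shows "hv sc A (fa_rename h f) = hv sc (A \<circ> h) f"
  using assms by (simp add: lin_rename)

lemma fa_fin_sum: "finite I \<Longrightarrow> (\<And>i. i \<in> I \<Longrightarrow> fa_fin (f i)) \<Longrightarrow> fa_fin (\<lambda>w. \<Sum>i\<in>I. f i w :: 'a::comm_ring_1)"
proof (induction I rule: finite_induct)
  case empty
  then show ?case using fa_fin_zero by (simp add: fa_zero_def)
next
  case (insert i I)
  have "fa_fin (fa_add (f i) (\<lambda>w. \<Sum>i\<in>I. f i w))" using insert by simp
  then show ?case using insert.hyps by (simp add: fa_add_def)
qed

lemma (in calg) lin_fun_sum:
  "finite I \<Longrightarrow> (\<And>i. i \<in> I \<Longrightarrow> fa_fin (f i)) \<Longrightarrow> lin sc W (\<lambda>w. \<Sum>i\<in>I. f i w) = (\<Sum>i\<in>I. lin sc W (f i))"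
proof (induction I rule: finite_induct)
  case empty
  then show ?case using lin_zero by (simp add: fa_zero_def)
next
  case (insert i I)
  have "lin sc W (fa_add (f i) (\<lambda>w. \<Sum>i\<in>I. f i w)) = lin sc W (f i) + (\<Sum>i\<in>I. lin sc W (f i))"
    using insert by (simp add: lin_add fa_fin_sum)
  then show ?case using insert.hyps by (simp add: fa_add_def)
qed

lemma (in calg) hv_ideal:
  assumes "f \<in> fa_ideal R" "\<And>r. r \<in> R \<Longrightarrow> fa_fin r \<and> hv sc A r = 0"
  shows "fa_fin f \<and> hv sc A f = 0"
  using assms(1)
  by induction (auto simp: assms(2) lin_add lin_smul hv_mult)

section \<open>Sums f 0 + f 1 t + f 2 t^2 + ... of power series\<close>

definition tsum :: "(nat \<Rightarrow> 'b::ring_1 fps) \<Rightarrow> 'b fps" where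
  "tsum f = Abs_fps (\<lambda>n. \<Sum>j\<le>n. f j $ (n - j))"

lemma sum_triangle_swap:
  fixes G :: "nat \<Rightarrow> nat \<Rightarrow> 'a::comm_monoid_add"
  shows "(\<Sum>i\<le>n. \<Sum>j\<le>n - i. G i j) = (\<Sum>j\<le>n. \<Sum>i\<le>n - j. G i j)"
  by (simp add: sum.Sigma)
    (rule sum.reindex_bij_witness[where i = "\<lambda>(j, i). (i, j)" and j = "\<lambda>(j, i). (i, j)"], auto)

lemma tsum_add: "tsum (\<lambda>j. f j + g j) = tsum f + tsum g"
  by (rule fps_ext) (simp add: tsum_def sum.distrib)

lemma tsum_mult_left: "tsum (\<lambda>j. V * f j) = V * tsum f"
proof (rule fps_ext)
  fix n
  have "(V * tsum f) $ n = (\<Sum>i\<le>n. \<Sum>j\<le>n - i. V $ i * f j $ (n - i - j))"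
    by (simp add: tsum_def fps_mult_nth sum_distrib_left atMost_atLeast0)
  also have "\<dots> = (\<Sum>j\<le>n. \<Sum>i\<le>n - j. V $ i * f j $ (n - i - j))"
    by (rule sum_triangle_swap)
  finally show "tsum (\<lambda>j. V * f j) $ n = (V * tsum f) $ n"
    by (simp add: tsum_def fps_mult_nth atMost_atLeast0 add.commute)
qed

lemma tsum_mult_right: "tsum (\<lambda>j. f j * V) = tsum f * V"
proof (rule fps_ext)
  fix n
  have "(tsum f * V) $ n = (\<Sum>i\<le>n. \<Sum>j\<le>i. f j $ (i - j) * V $ (n - (j + (i - j))))"
    by (simp add: tsum_def fps_mult_nth sum_distrib_right atMost_atLeast0)
  also have "\<dots> = (\<Sum>j\<le>n. \<Sum>k\<le>n - j. f j $ k * V $ (n - (j + k)))"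
    by (rule sum_triangle)
  finally show "tsum (\<lambda>j. f j * V) $ n = (tsum f * V) $ n"
    by (simp add: tsum_def fps_mult_nth atMost_atLeast0)
qed

lemma tsum_tsum: "tsum (\<lambda>i. tsum (h i)) = tsum (\<lambda>n. \<Sum>i\<le>n. h i (n - i))"
proof (rule fps_ext)
  fix n
  have "tsum (\<lambda>n. \<Sum>i\<le>n. h i (n - i)) $ n = (\<Sum>k\<le>n. \<Sum>i\<le>k. h i (k - i) $ (n - (i + (k - i))))"
    by (simp add: tsum_def fps_sum_nth)
  also have "\<dots> = (\<Sum>i\<le>n. \<Sum>j\<le>n - i. h i j $ (n - (i + j)))"
    by (rule sum_triangle)
  finally show "tsum (\<lambda>i. tsum (h i)) $ n = tsum (\<lambda>n. \<Sum>i\<le>n. h i (n - i)) $ n"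
    by (simp add: tsum_def)
qed

lemma tsum_prod: "tsum f * tsum g = tsum (\<lambda>n. \<Sum>i\<le>n. f i * g (n - i))"
  by (simp add: tsum_tsum tsum_mult_left flip: tsum_mult_right)
     (simp add: tsum_tsum flip: tsum_mult_left)

lemma tsum_sum: "tsum (\<lambda>j. \<Sum>i\<in>I. f i j) = (\<Sum>i\<in>I. tsum (f i))"
  by (rule fps_ext) (auto simp: tsum_def fps_sum_nth intro: sum.swap)

lemma tsum_0: "tsum (\<lambda>j. if j = 0 then a else 0) = a"
proof (rule fps_ext)
  fix n
  have "tsum (\<lambda>j. if j = 0 then a else 0) $ n = (\<Sum>j\<le>n. if j = 0 then a $ n else 0)"
    unfolding tsum_def fps_nth_Abs_fps by (rule sum.cong) auto
  then show "tsum (\<lambda>j. if j = 0 then a else 0) $ n = a $ n" by simp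
qed

lemma tsum_const: "tsum (\<lambda>j. fps_const (f j)) = Abs_fps f"
proof (rule fps_ext)
  fix n
  have "tsum (\<lambda>j. fps_const (f j)) $ n = (\<Sum>j\<le>n. if j = n then f n else 0)"
    unfolding tsum_def fps_nth_Abs_fps by (rule sum.cong) auto
  then show "tsum (\<lambda>j. fps_const (f j)) $ n = Abs_fps f $ n" by simp
qed

section \<open>Evaluation of series over the free algebra\<close>

definition ser :: "('a::zero \<Rightarrow> 'b::ring_1) \<Rightarrow> ('g list \<Rightarrow> 'b fps) \<Rightarrow> ('g,'a) ps \<Rightarrow> 'b fps" where
  "ser sc W x = tsum (\<lambda>j. lin (fsc sc) W (x j))"

abbreviation hs :: "('a::zero \<Rightarrow> 'b::ring_1) \<Rightarrow> ('g \<Rightarrow> 'b fps) \<Rightarrow> ('g,'a) ps \<Rightarrow> 'b fps" where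
  "hs sc A \<equiv> ser sc (wd A)"

lemma ps_fin_iff: "ps_fin A \<longleftrightarrow> (\<forall>n. fa_fin (A n))"
  by (simp add: ps_fin_def fa_fin_def)

lemma ps_finD: "ps_fin A \<Longrightarrow> fa_fin (A n)" by (simp add: ps_fin_iff)

lemma ps_fin_const [simp]: "fa_fin f \<Longrightarrow> ps_fin (ps_const f)"
  by (simp add: ps_fin_iff ps_const_def)

lemma ps_fin_zero [simp]: "ps_fin ps_zero" by (simp add: ps_fin_iff ps_zero_def)

lemma ps_fin_add [simp]: "ps_fin A \<Longrightarrow> ps_fin B \<Longrightarrow> ps_fin (ps_add A (B::('g,'a::comm_ring_1) ps))"
  by (simp add: ps_fin_iff ps_add_def)

lemma ps_fin_smul [simp]: "ps_fin A \<Longrightarrow> ps_fin (ps_smul c (A::('g,'a::comm_ring_1) ps))"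
  by (simp add: ps_fin_iff ps_smul_def)

lemma ps_fin_tpow [simp]: "ps_fin A \<Longrightarrow> ps_fin (ps_tpow r A)"
  by (simp add: ps_fin_iff ps_tpow_def)

lemma ps_mult_eq: "ps_mult A B n = (\<lambda>w. \<Sum>i\<in>{..n}. fa_mult (A i) (B (n - i)) w)"
  by (simp add: ps_mult_def)

lemma ps_fin_mult [simp]: "ps_fin A \<Longrightarrow> ps_fin B \<Longrightarrow> ps_fin (ps_mult A B)"
  unfolding ps_fin_iff ps_mult_eq by (auto intro!: fa_fin_sum)

lemma ps_fin_one [simp]: "ps_fin ps_one" by (simp add: ps_one_def)

lemma ps_fin_binom [simp]: "fa_fin Y \<Longrightarrow> ps_fin (ps_binom Y c)"
  by (simp add: ps_fin_iff ps_binom_def)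

lemma ps_fin_sumset [simp]:
  "finite I \<Longrightarrow> (\<And>i. i \<in> I \<Longrightarrow> ps_fin (F i)) \<Longrightarrow> ps_fin (ps_sumset F I :: ('g,'a::comm_ring_1) ps)"
  unfolding ps_fin_iff ps_sumset_def by (auto intro!: fa_fin_sum)

lemma ps_fin_tsum [simp]: "(\<And>r. ps_fin (F r)) \<Longrightarrow> ps_fin (ps_tsum F :: ('g,'a::comm_ring_1) ps)"
  unfolding ps_fin_iff ps_tsum_def by (auto intro!: fa_fin_sum)

lemma ps_fin_rename [simp]: "inj h \<Longrightarrow> ps_fin A \<Longrightarrow> ps_fin (ps_rename h A)"
  by (simp add: ps_fin_iff ps_rename_def)

lemma fa_fin_tens [simp]: "fa_fin a \<Longrightarrow> fa_fin b \<Longrightarrow> fa_fin (fa_tens a b)"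
  by (simp add: fa_tens_def)

lemma ps_fin_tens [simp]: "ps_fin A \<Longrightarrow> ps_fin B \<Longrightarrow> ps_fin (ps_tens A B)"
  unfolding ps_fin_iff ps_tens_def by (auto intro!: fa_fin_sum)

lemma ps_fin_word: "(\<And>g. ps_fin (\<phi> g)) \<Longrightarrow> ps_fin (ps_word \<phi> u)"
  by (induction u) auto

lemma ps_fin_aword: "(\<And>g. ps_fin (\<phi> g)) \<Longrightarrow> ps_fin (ps_aword par \<phi> u)"
  by (induction u) auto

lemma fa_fin_lin_ext: "fa_fin f \<Longrightarrow> (\<And>u. ps_fin (\<phi> u)) \<Longrightarrow> fa_fin (lin_ext \<phi> f n)"
proof -
  assume f: "fa_fin f" and p: "\<And>u. ps_fin (\<phi> u)"
  have "lin_ext \<phi> f n = (\<lambda>w. \<Sum>u\<in>fa_supp f. fa_smul (f u) (\<phi> u n) w)"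
    by (simp add: lin_ext_def fa_smul_def)
  then show ?thesis using f p by (auto simp: fa_fin_def[of f] ps_fin_iff intro!: fa_fin_sum)
qed

lemma ps_fin_ser_ext [simp]: "ps_fin x \<Longrightarrow> (\<And>u. ps_fin (\<phi> u)) \<Longrightarrow> ps_fin (ser_ext \<phi> x)"
  unfolding ps_fin_iff[of "ser_ext \<phi> x"] by (auto simp: ser_ext_def dest: ps_finD intro!: fa_fin_sum fa_fin_lin_ext)

lemma ps_fin_hom_ext: "ps_fin x \<Longrightarrow> (\<And>g. ps_fin (\<phi> g)) \<Longrightarrow> ps_fin (hom_ext \<phi> x)"
  by (simp add: hom_ext_def ps_fin_word)

context calg
begin

interpretation F: calg "fsc sc" by (rule calg_fps)

lemma ser_add: "ps_fin A \<Longrightarrow> ps_fin B \<Longrightarrow> ser sc W (ps_add A B) = ser sc W A + ser sc W B"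
  by (simp add: ser_def ps_add_def F.lin_add ps_fin_iff tsum_add)

lemma ser_smul: "ps_fin A \<Longrightarrow> ser sc W (ps_smul c A) = fsc sc c * ser sc W A"
  by (simp add: ser_def ps_smul_def F.lin_smul ps_fin_iff tsum_mult_left)

lemma ser_const: "ser sc W (ps_const f) = lin (fsc sc) W f"
proof -
  have "(\<lambda>j. lin (fsc sc) W (ps_const f j)) = (\<lambda>j. if j = 0 then lin (fsc sc) W f else 0)"
    by (auto simp: ps_const_def)
  then show ?thesis by (simp add: ser_def tsum_0)
qed

lemma hs_one [simp]: "hs sc A ps_one = 1"
  by (simp add: ps_one_def ser_const)

lemma hs_gen [simp]: "hs sc A (ps_const (fa_gen g)) = A g"
  by (simp add: ser_const)

lemma hs_mult:
  assumes "ps_fin x" "ps_fin y" shows "hs sc A (ps_mult x y) = hs sc A x * hs sc A y"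
proof -
  have "lin (fsc sc) (wd A) (ps_mult x y n) =
      (\<Sum>i\<le>n. lin (fsc sc) (wd A) (x i) * lin (fsc sc) (wd A) (y (n - i)))" for n
    using assms by (simp add: ps_mult_eq F.lin_fun_sum F.hv_mult ps_fin_iff)
  then show ?thesis by (simp add: ser_def tsum_prod)
qed

lemma ser_sumset:
  "finite I \<Longrightarrow> (\<And>i. i \<in> I \<Longrightarrow> ps_fin (x i)) \<Longrightarrow> ser sc W (ps_sumset x I) = (\<Sum>i\<in>I. ser sc W (x i))"
  by (simp add: ser_def ps_sumset_def F.lin_fun_sum ps_fin_iff tsum_sum)

lemma ser_rename:
  "inj h \<Longrightarrow> ps_fin x \<Longrightarrow> ser sc W (ps_rename h x) = ser sc (\<lambda>u. W (map h u)) x"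
  by (simp add: ser_def ps_rename_def F.lin_rename ps_fin_iff)

lemma hs_rename: "inj h \<Longrightarrow> ps_fin x \<Longrightarrow> hs sc A (ps_rename h x) = hs sc (A \<circ> h) x"
  by (simp add: ser_rename)

lemma lin_ext_eq: "lin_ext \<phi> f n = (\<lambda>w. \<Sum>u\<in>fa_supp f. fa_smul (f u) (\<phi> u n) w)"
  by (simp add: lin_ext_def fa_smul_def)

text \<open>Extending a map of words to series and then evaluating is a single evaluation, in which
  each word goes to the value of its image. Composites such as (\<Delta> \<otimes> id) \<Delta>
  thereby become evaluations in one ring.\<close>

lemma ser_ser_ext:
  assumes x: "ps_fin x" and \<phi>: "\<And>u. ps_fin (\<phi> u)"
  shows "ser sc W (ser_ext \<phi> x) = ser sc (\<lambda>u. ser sc W (\<phi> u)) x"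
proof -
  have fin: "finite (fa_supp (x j))" for j using x by (simp add: ps_fin_iff fa_fin_def)
  have 1: "tsum (\<lambda>k. lin (fsc sc) W (lin_ext \<phi> (x j) k)) = lin (fsc sc) (\<lambda>u. ser sc W (\<phi> u)) (x j)" for j
  proof -
    have "lin (fsc sc) W (lin_ext \<phi> (x j) k) =
        (\<Sum>u\<in>fa_supp (x j). fsc sc (x j u) * lin (fsc sc) W (\<phi> u k))" for k
      unfolding lin_ext_eq using x \<phi> by (subst F.lin_fun_sum) (auto simp: ps_fin_iff F.lin_smul fin)
    then show ?thesis
      by (simp add: lin_def[of _ "\<lambda>u. tsum (\<lambda>k. lin (fsc sc) W (\<phi> u k))"] ser_def
          tsum_sum tsum_mult_left)
  qed
  have "lin (fsc sc) W (ser_ext \<phi> x n) = (\<Sum>j\<le>n. lin (fsc sc) W (lin_ext \<phi> (x j) (n - j)))" for n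
    unfolding ser_ext_def using x \<phi> by (subst F.lin_fun_sum) (auto intro: fa_fin_lin_ext ps_finD)
  then have "ser sc W (ser_ext \<phi> x) = tsum (\<lambda>j. tsum (\<lambda>k. lin (fsc sc) W (lin_ext \<phi> (x j) k)))"
    by (simp add: ser_def tsum_tsum)
  then show ?thesis by (simp add: 1) (simp add: ser_def)
qed

lemma hs_word: "(\<And>g. ps_fin (\<phi> g)) \<Longrightarrow> hs sc A (ps_word \<phi> u) = wd (\<lambda>g. hs sc A (\<phi> g)) u"
  by (induction u) (simp_all add: hs_mult ps_fin_word)

lemma hs_hom_ext:
  "ps_fin x \<Longrightarrow> (\<And>g. ps_fin (\<phi> g)) \<Longrightarrow> hs sc A (hom_ext \<phi> x) = hs sc (\<lambda>g. hs sc A (\<phi> g)) x"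
  by (simp add: hom_ext_def ser_ser_ext ps_fin_word hs_word)

lemma hs_tens:
  assumes "ps_fin x" "ps_fin y"
  shows "hs sc A (ps_tens x y) = hs sc (A \<circ> Inl) x * hs sc (A \<circ> Inr) y"
proof -
  have "ps_tens x y = ps_mult (ps_rename Inl x) (ps_rename Inr y)"
    by (simp add: ps_tens_def ps_mult_def fa_tens_def ps_rename_def)
  then show ?thesis using assms by (simp add: hs_mult hs_rename)
qed

lemma wd_fps_const: "wd (\<lambda>g. fps_const (A g)) u = fps_const (wd A u)"
  by (induction u) simp_all

lemma lin_fps_const: "lin (fsc sc) (\<lambda>u. fps_const (W u)) f = fps_const (lin sc W f)"
proof -
  have "(\<Sum>u\<in>B. fps_const (sc (f u) * W u)) = fps_const (\<Sum>u\<in>B. sc (f u) * W u)" for B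
    by (induction B rule: infinite_finite_induct) (auto simp flip: fps_const_add)
  then show ?thesis by (simp add: lin_def)
qed

lemma hs_fps_const: "hs sc (\<lambda>g. fps_const (A g)) x = Abs_fps (\<lambda>n. hv sc A (x n))"
  by (simp add: ser_def wd_fps_const lin_fps_const tsum_const)

end

section \<open>The generic evaluation into the presented algebra\<close>

definition qsc :: "'a::comm_ring_1 \<Rightarrow> ('g,'a) qalg" where
  "qsc c = abs_qalg (\<lambda>R. fa_smul c fa_one)"

text \<open>Outside the factor \<open>R\<close> the generators are sent to \<open>0\<close>, which makes the embedding unital.\<close>
definition qgen :: "('g,'a::comm_ring_1) fa set \<Rightarrow> 'g \<Rightarrow> ('g,'a) qalg" where
  "qgen R g = abs_qalg (\<lambda>R'. if R' = R then fa_gen g else fa_zero)"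

lemma qalg_abs_simps:
  assumes "\<And>R. fa_fin (f R)" "\<And>R. fa_fin (g R)"
  shows "abs_qalg f + abs_qalg g = abs_qalg (\<lambda>R. fa_add (f R) (g R))"
    "abs_qalg f * abs_qalg g = abs_qalg (\<lambda>R. fa_mult (f R) (g R))"
  using assms by (simp_all add: plus_qalg.abs_eq times_qalg.abs_eq qalg_rel_def fa_cong_refl)

interpretation qalg: calg "qsc :: 'a::field_char_0 \<Rightarrow> ('g,'a) qalg"
proof
  fix x y :: 'a and b :: "('g,'a) qalg"
  have add: "fa_add (fa_smul x f) (fa_smul y f) = fa_smul (x + y) f"
    "fa_smul x (fa_smul y f) = fa_smul (x * y) f" "fa_smul 1 f = f" for f :: "('g,'a) fa"
    by (auto simp: fa_add_def fa_smul_def distrib_right mult.assoc)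
  show "qsc (x + y) = (qsc x + qsc y :: ('g,'a) qalg)"
    by (simp add: qsc_def qalg_abs_simps add)
  show "qsc (x * y) = (qsc x * qsc y :: ('g,'a) qalg)"
    by (simp add: qsc_def qalg_abs_simps fa_mult_smul_left add)
  show "qsc 1 = (1 :: ('g,'a) qalg)"
    by (simp add: qsc_def add one_qalg_def)
  have "\<exists>f. b = abs_qalg f \<and> (\<forall>R. fa_fin (f R))"
    using Quotient_abs_rep[OF Quotient_qalg, of b] Quotient_rep_reflp[OF Quotient_qalg, of b]
    by (metis qalg_rel_def fa_cong_def)
  then obtain f where "b = abs_qalg f" "\<And>R. fa_fin (f R)" by blast
  then show "b * qsc x = qsc x * b"
    by (simp add: qsc_def qalg_abs_simps fa_mult_smul_left fa_mult_smul_right)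
qed

abbreviation ev :: "('g,'a::field_char_0) fa set \<Rightarrow> ('g,'a) fa \<Rightarrow> ('g,'a) qalg" where
  "ev R \<equiv> hv qsc (qgen R)"

abbreviation evs :: "('g,'a::field_char_0) fa set \<Rightarrow> ('g,'a) ps \<Rightarrow> ('g,'a) qalg fps" where
  "evs R \<equiv> hs qsc (\<lambda>g. fps_const (qgen R g))"

text \<open>In the factors other than R all generators vanish, so only the coefficient of the empty
  word remains visible there.\<close>

lemma ev_eq_abs:
  fixes f :: "('g,'a::field_char_0) fa"
  assumes "fa_fin f"
  shows "ev R f = abs_qalg (\<lambda>R'. if R' = R then f else fa_smul (f []) fa_one)"
  using assms
proof (induction f rule: fa_fin_induct)
  case zero
  have "fa_smul 0 fa_one = (fa_zero :: ('g,'a) fa)" by (simp add: fa_smul_def fa_zero_def)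
  moreover have "(fa_zero :: ('g,'a) fa) [] = 0" by (simp add: fa_zero_def)
  ultimately show ?case by (simp add: zero_qalg_def cong: if_cong)
next
  case (add c u f)
  have w: "wd (qgen R) u = abs_qalg (\<lambda>R'. if R' = R then fa_word u else fa_smul (if u = [] then 1 else 0) fa_one)" for u
  proof (induction u)
    case Nil
    have "fa_smul 1 fa_one = (fa_one :: ('g,'a) fa)" by (simp add: fa_smul_def)
    then show ?case by (simp add: one_qalg_def fa_one_def cong: if_cong)
  next
    case (Cons g u)
    have "fa_smul 0 f = fa_zero" for f :: "('g,'a) fa"
      by (auto simp: fa_smul_def fa_zero_def)
    then show ?case
      by (simp only: list.map prod_list.Cons Cons.IH)
        (auto simp: qgen_def qalg_abs_simps fa_gen_def fa_mult_word intro!: arg_cong[of _ _ abs_qalg])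
  qed
  have "fa_add (fa_smul c (fa_smul (if u = [] then 1 else 0) fa_one)) (fa_smul (f []) fa_one)
      = fa_smul (fa_add (fa_smul c (fa_word u)) f []) fa_one"
    by (auto simp: fa_add_def fa_smul_def fa_word_def distrib_right)
  note eq = this
  have "ev R (fa_add (fa_smul c (fa_word u)) f) = qsc c * wd (qgen R) u + ev R f"
    using add.hyps by (simp add: qalg.lin_add qalg.lin_smul)
  also have "\<dots> = abs_qalg (\<lambda>R'. if R' = R then fa_add (fa_smul c (fa_word u)) f
      else fa_smul (fa_add (fa_smul c (fa_word u)) f []) fa_one)"
    unfolding add.IH unfolding w qsc_def eq[symmetric] using add.hyps
    by (auto simp: qalg_abs_simps fa_mult_smul_left intro!: arg_cong[of _ _ abs_qalg])
  finally show ?case .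
qed

lemma fa_ideal_Nil:
  assumes "f \<in> fa_ideal R" "\<And>r. r \<in> R \<Longrightarrow> r [] = 0" shows "f [] = 0"
  using assms by induction (auto simp: fa_zero_def fa_add_def fa_smul_def fa_mult_Nil)

text \<open>Relations without constant term generate an ideal without constant terms, so the factors
  other than R impose no further condition.\<close>

lemma ev_eq_0_iff:
  fixes f :: "('g,'a::field_char_0) fa"
  assumes "fa_fin f" "\<And>r. r \<in> R \<Longrightarrow> r [] = 0"
  shows "ev R f = 0 \<longleftrightarrow> f \<in> fa_ideal R"
proof -
  let ?f = "\<lambda>R'. if R' = R then f else fa_smul (f []) fa_one"
  have d: "fa_diff k fa_zero = k" for k :: "('g,'a) fa" by (simp add: fa_diff_def fa_zero_def)
  have "ev R f = 0 \<longleftrightarrow> qalg_rel ?f (\<lambda>R. fa_zero)"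
    using Quotient_rel[OF Quotient_qalg, of ?f "\<lambda>R. fa_zero"] assms(1)
    by (auto simp: ev_eq_abs zero_qalg_def qalg_rel_def fa_cong_refl)
  also have "\<dots> \<longleftrightarrow> f \<in> fa_ideal R"
  proof
    assume "qalg_rel ?f (\<lambda>R. fa_zero)"
    then show "f \<in> fa_ideal R" by (auto simp: qalg_rel_def fa_cong_def d dest: spec[of _ R])
  next
    assume f: "f \<in> fa_ideal R"
    then have "f [] = 0" using assms(2) by (rule fa_ideal_Nil)
    moreover have "fa_smul 0 fa_one = (fa_zero :: ('g,'a) fa)" by (simp add: fa_smul_def fa_zero_def)
    ultimately show "qalg_rel ?f (\<lambda>R. fa_zero)"
      using f assms(1) by (auto simp: qalg_rel_def fa_cong_def d fa_ideal.zero)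
  qed
  finally show ?thesis .
qed

lemma ps_eqv_iff:
  assumes "ps_fin x" "ps_fin y" "\<And>r. r \<in> R \<Longrightarrow> r [] = 0"
  shows "ps_eqv R x y \<longleftrightarrow> evs R x = evs R y"
proof -
  have "ev R (x n) = ev R (y n) \<longleftrightarrow> fa_diff (x n) (y n) \<in> fa_ideal R" for n
    using assms by (simp add: qalg.lin_diff ps_fin_iff flip: ev_eq_0_iff)
  then show ?thesis by (simp add: ps_eqv_def qalg.hs_fps_const fps_eq_iff)
qed

text \<open>The transport principle: an identity in the algebra presented by R holds in every
  algebra, and under every assignment by power series, in which the relations of R hold.\<close>

lemma (in calg) hs_cong_evs:
  assumes "ps_fin x" "ps_fin y" "evs R x = evs R y" "\<And>r. r \<in> R \<Longrightarrow> r [] = 0"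
    "\<And>r. r \<in> R \<Longrightarrow> fa_fin r \<and> hv (fsc sc) A r = 0"
  shows "hs sc A x = hs sc A y"
proof -
  interpret F: calg "fsc sc" by (rule calg_fps)
  have "hv (fsc sc) A (x n) = hv (fsc sc) A (y n)" for n
  proof -
    have "fa_diff (x n) (y n) \<in> fa_ideal R"
      using assms(1-4) ps_eqv_iff[of x y R] by (simp add: ps_eqv_def)
    then show ?thesis using F.hv_ideal[OF _ assms(5), of _ R] assms(1,2)
      by (force simp: F.lin_diff ps_fin_iff)
  qed
  then show ?thesis by (simp add: ser_def)
qed

declare fps_const_neg [simp del]

section \<open>Binomial series and linear differential equations\<close>

definition cm :: "'b::ring_1 \<Rightarrow> 'b \<Rightarrow> bool" where "cm a b \<longleftrightarrow> a * b = b * a"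

named_theorems cm_intros

lemma cmD: "cm a b \<Longrightarrow> a * b = b * a" by (simp add: cm_def)
lemma cm_left_commute: "cm a b \<Longrightarrow> a * (b * c) = b * (a * c)"
  by (metis cm_def mult.assoc)
lemma cm_sym: "cm a b \<Longrightarrow> cm b a" by (simp add: cm_def)
lemma cm_refl [simp, cm_intros]: "cm a a" by (simp add: cm_def)
lemma cm_simps [simp, cm_intros]: "cm a 0" "cm a 1" "cm 0 a" "cm 1 a" "cm a (of_nat n)" "cm (of_nat n) a"
  by (simp_all add: cm_def mult_of_nat_commute)
lemma cm_add [cm_intros]: "cm a b \<Longrightarrow> cm a c \<Longrightarrow> cm a (b + c)" "cm b a \<Longrightarrow> cm c a \<Longrightarrow> cm (b + c) a"
  by (simp_all add: cm_def distrib_left distrib_right)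
lemma cm_diff [cm_intros]: "cm a b \<Longrightarrow> cm a c \<Longrightarrow> cm a (b - c)" "cm b a \<Longrightarrow> cm c a \<Longrightarrow> cm (b - c) a"
  by (simp_all add: cm_def algebra_simps)
lemma cm_minus [cm_intros]: "cm a b \<Longrightarrow> cm a (- b)" "cm b a \<Longrightarrow> cm (- b) a"
  by (simp_all add: cm_def)
lemma cm_mult [cm_intros]: "cm a b \<Longrightarrow> cm a c \<Longrightarrow> cm a (b * c)" "cm b a \<Longrightarrow> cm c a \<Longrightarrow> cm (b * c) a"
  by (metis cm_def mult.assoc)+
lemma cm_power [cm_intros]: "cm a b \<Longrightarrow> cm a (b ^ n)" "cm b a \<Longrightarrow> cm (b ^ n) a"
  by (induction n) (simp_all add: cm_mult)
lemma cm_sum [cm_intros]: "(\<And>i. i \<in> I \<Longrightarrow> cm a (f i)) \<Longrightarrow> cm a (sum f I)"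
  "(\<And>i. i \<in> I \<Longrightarrow> cm (f i) a) \<Longrightarrow> cm (sum f I) a"
  by (simp_all add: cm_def sum_distrib_left sum_distrib_right)
lemma cm_fall [cm_intros]: "cm a b \<Longrightarrow> cm a (fall b n)" "cm b a \<Longrightarrow> cm (fall b n) a"
  by (induction n) (auto intro!: cm_intros)
lemma cm_rise [cm_intros]: "cm a b \<Longrightarrow> cm a (rise b n)" "cm b a \<Longrightarrow> cm (rise b n) a"
  by (induction n) (auto intro!: cm_intros)
lemma cm_fps: "(\<And>i j. cm (f $ i) (g $ j)) \<Longrightarrow> cm f g"
proof -
  assume *: "\<And>i j. cm (f $ i) (g $ j)"
  have "(f * g) $ n = (g * f) $ n" for n
  proof -
    have "(\<Sum>i=0..n. f $ i * g $ (n - i)) = (\<Sum>i=0..n. g $ (n - i) * f $ i)"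
      using * by (simp add: cm_def)
    also have "\<dots> = (\<Sum>i=0..n. g $ i * f $ (n - i))"
      by (subst sum.atLeastAtMost_rev) simp
    finally show ?thesis by (simp add: fps_mult_nth)
  qed
  then show "cm f g" by (simp add: cm_def fps_ext)
qed
lemma cm_fps_const [cm_intros]: "cm a b \<Longrightarrow> cm (fps_const a) (fps_const b)"
  by (simp add: cm_def)
lemma cm_fps_X [simp, cm_intros]: "cm a fps_X" "cm fps_X a"
  by (simp_all add: cm_def fps_mult_fps_X_commute)

section \<open>Falling powers and binomial series\<close>

lemma fall_Suc_left: "fall x (Suc n) = x * fall (x - 1) n"
proof (induction n)
  case (Suc n)
  have "fall x (Suc (Suc n)) = x * fall (x - 1) n * (x - of_nat (Suc n))"
    using Suc.IH by simp
  then show ?case by (simp add: mult.assoc diff_diff_eq add.commute)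
qed simp

lemma fall_add: "fall x (m + n) = fall x m * fall (x - of_nat m) n"
  by (induction n) (simp_all add: mult.assoc diff_diff_eq)

lemma rise_fall: "rise x n = (-1) ^ n * fall (- x) n"
proof (induction n)
  case (Suc n)
  have "rise x (Suc n) = (-1) ^ n * fall (- x) n * (- (- x - of_nat n))"
    by (simp add: Suc add.commute)
  also have "\<dots> = (-1) ^ Suc n * fall (- x) (Suc n)" by (simp only: fall.simps) (simp add: algebra_simps)
  finally show ?case .
qed simp

definition bin :: "('a::field_char_0 \<Rightarrow> 'b::ring_1) \<Rightarrow> 'b \<Rightarrow> nat \<Rightarrow> 'b" where
  "bin sc x n = sc (1 / fact n) * fall x n"

text \<open>The series \<open>(1 - Z t)\<^sup>x\<close>, for commuting \<open>Z\<close> and \<open>x\<close>.\<close>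
definition pw :: "('a::field_char_0 \<Rightarrow> 'b::ring_1) \<Rightarrow> 'b fps \<Rightarrow> 'b fps \<Rightarrow> 'b fps" where
  "pw sc Z x = tsum (\<lambda>n. (-1) ^ n * bin (fsc sc) x n * Z ^ n)"

abbreviation pwc :: "('a::field_char_0 \<Rightarrow> 'b::ring_1) \<Rightarrow> 'b \<Rightarrow> 'b \<Rightarrow> 'b fps" where
  "pwc sc Z x \<equiv> pw sc (fps_const Z) (fps_const x)"

definition uexp :: "('a::field_char_0 \<Rightarrow> 'b::ring_1) \<Rightarrow> 'b \<Rightarrow> 'b fps" where
  "uexp sc x = Abs_fps (\<lambda>n. sc (1 / fact n) * x ^ n)"

context calg
begin

lemma cm_sc [simp, cm_intros]: "cm a (sc c)" "cm (sc c) a"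
  by (simp_all add: cm_def sc_comm)

lemma cm_bin [cm_intros]: "cm a b \<Longrightarrow> cm a (bin sc b n)" "cm b a \<Longrightarrow> cm (bin sc b n) a"
  unfolding bin_def by (auto intro!: cm_intros)

lemma bin_0 [simp]: "bin sc x 0 = 1" by (simp add: bin_def)

lemma sc_fact_Suc: "of_nat (Suc n) * sc (1 / fact (Suc n)) = sc (1 / fact n)"
proof -
  have "of_nat (Suc n) * sc (1 / fact (Suc n)) = sc (of_nat (Suc n) * (1 / fact (Suc n)))"
    by (simp only: sc_mult sc_of_nat)
  also have "of_nat (Suc n) * (1 / fact (Suc n)) = (1 / fact n :: 'a)"
    using of_nat_neq_0[of n, where 'a = 'a] by (simp del: of_nat_Suc)
  finally show ?thesis .
qed

lemma bin_Suc: "of_nat (Suc n) * bin sc x (Suc n) = bin sc x n * (x - of_nat n)"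
  unfolding bin_def by (simp only: mult.assoc[symmetric] sc_fact_Suc fall.simps)

lemma bin_sc: "bin sc (sc c) n = sc (c gchoose n)"
proof -
  have "fall (sc c) n = sc (\<Prod>i = 0..<n. c - of_nat i)"
    by (induction n) (simp_all add: sc_mult sc_diff)
  then show ?thesis by (simp add: bin_def gbinomial_prod_rev flip: sc_mult)
qed

lemma bin_fps_const: "bin (fsc sc) (fps_const x) n = fps_const (bin sc x n)"
proof -
  have "fall (fps_const x) n = fps_const (fall x n)"
    by (induction n) (simp_all flip: fps_const_sub fps_const_mult add: fps_of_nat)
  then show ?thesis by (simp add: bin_def)
qed

lemma fps_neg1_power: "(-1) ^ n = fps_const ((-1) ^ n :: 'c::ring_1)"
  by (simp add: fps_const_neg[symmetric] fps_const_power[symmetric])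

lemma pwc_nth: "pwc sc Z x $ n = (-1) ^ n * bin sc x n * Z ^ n"
proof -
  have "pwc sc Z x = tsum (\<lambda>n. fps_const ((-1) ^ n * bin sc x n * Z ^ n))"
    by (simp add: pw_def bin_fps_const fps_const_power fps_neg1_power)
  then show ?thesis by (simp add: tsum_const)
qed

lemma pwc_0 [simp]: "pwc sc Z x $ 0 = 1"
  by (simp add: pwc_nth)

lemma pwc_zero [simp]: "pw sc (fps_const Z) 0 = 1"
proof -
  have "pwc sc Z 0 $ n = (1 :: 'b fps) $ n" for n
    unfolding pwc_nth by (cases n) (simp_all add: bin_def fall_Suc_left del: fall.simps(2))
  then have "pwc sc Z 0 = (1 :: 'b fps)" by (rule fps_ext)
  then show ?thesis by simp
qed

lemma cm_pwc [cm_intros]: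
  assumes "cm a Z" "cm a x" shows "cm (fps_const a) (pwc sc Z x)" "cm (pwc sc Z x) (fps_const a)"
proof -
  have "cm a ((-1) ^ j * bin sc x j * Z ^ j)" for j using assms by (auto intro!: cm_intros)
  then have "cm (fps_const a $ i) (pwc sc Z x $ j)" for i j by (simp add: pwc_nth)
  then show "cm (fps_const a) (pwc sc Z x)" by (rule cm_fps)
  then show "cm (pwc sc Z x) (fps_const a)" by (rule cm_sym)
qed

text \<open>Since B has constant term 1, the coefficient of t^k in B P' is (k + 1) times the next
  coefficient of P plus terms in earlier ones, and k + 1 can be cancelled. The factor B will be 1 -
  Zt or a product of such series, which avoids inverting them.\<close>

lemma ode_unique:
  assumes B: "B $ 0 = 1" and P: "B * fps_deriv P = A * P" and Q: "B * fps_deriv Q = A * Q"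
    and PQ: "P $ 0 = Q $ (0::nat)"
  shows "P = (Q :: 'b fps)"
proof -
  have "P $ n = Q $ n" for n
  proof (induction n rule: less_induct)
    case (less n)
    show ?case
    proof (cases n)
      case (Suc k)
      have eq: "fps_deriv V $ k = (A * V) $ k - (\<Sum>i=1..k. B $ i * fps_deriv V $ (k - i))"
        if "B * fps_deriv V = A * V" for V
      proof -
        have "(A * V) $ k = (\<Sum>i=0..k. B $ i * fps_deriv V $ (k - i))"
          using that by (metis fps_mult_nth)
        also have "\<dots> = fps_deriv V $ k + (\<Sum>i=1..k. B $ i * fps_deriv V $ (k - i))"
          using B by (simp add: sum.atLeast_Suc_atMost del: fps_deriv_nth)
        finally show ?thesis by simp
      qed
      have "(A * P) $ k = (A * Q) $ k"
        unfolding fps_mult_nth using less.IH Suc by (intro sum.cong) auto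
      moreover have "(\<Sum>i=1..k. B $ i * fps_deriv P $ (k - i)) = (\<Sum>i=1..k. B $ i * fps_deriv Q $ (k - i))"
        using less.IH Suc by (intro sum.cong) auto
      ultimately have "fps_deriv P $ k = fps_deriv Q $ k"
        using eq[OF P] eq[OF Q] by simp
      then have "of_nat (Suc k) * P $ Suc k = of_nat (Suc k) * Q $ Suc k" by simp
      then show ?thesis unfolding Suc by (rule of_nat_cancel)
    qed (simp add: PQ)
  qed
  then show ?thesis by (simp add: fps_ext)
qed

lemma pwc_rec:
  assumes "cm x Z"
  shows "of_nat (Suc n) * pwc sc Z x $ Suc n = (of_nat n - x) * Z * pwc sc Z x $ n"
proof -
  have c: "cm (x - of_nat n) (bin sc x n)" "cm Z (bin sc x n)"
    using assms by (auto intro!: cm_intros intro: cm_sym)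
  have "of_nat (Suc n) * pwc sc Z x $ Suc n = (-1) ^ Suc n * (of_nat (Suc n) * bin sc x (Suc n)) * Z ^ Suc n"
    by (simp only: pwc_nth mult.assoc cm_left_commute[OF cm_simps(6)])
  also have "\<dots> = (-1) ^ n * ((of_nat n - x) * (bin sc x n * (Z * Z ^ n)))"
    unfolding bin_Suc cmD[OF c(1), symmetric] by (simp add: algebra_simps)
  also have "\<dots> = (of_nat n - x) * Z * pwc sc Z x $ n"
    using cm_left_commute[OF c(2)]
    by (simp add: pwc_nth mult.assoc cm_left_commute[OF cm_power(2)[OF cm_minus(2)[OF cm_simps(4)]]])
  finally show ?thesis .
qed

lemma pwc_deriv:
  assumes "cm x Z"
  shows "(1 - fps_const Z * fps_X) * fps_deriv (pwc sc Z x) = - (fps_const (x * Z) * pwc sc Z x)"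
proof (rule fps_ext)
  fix n
  show "((1 - fps_const Z * fps_X) * fps_deriv (pwc sc Z x)) $ n = (- (fps_const (x * Z) * pwc sc Z x)) $ n"
  proof (cases n)
    case 0
    then show ?thesis using pwc_rec[OF assms, of 0] by (simp add: left_diff_distrib mult.assoc)
  next
    case (Suc k)
    have "((1 - fps_const Z * fps_X) * fps_deriv (pwc sc Z x)) $ n =
        of_nat (Suc n) * pwc sc Z x $ Suc n - Z * (of_nat n * pwc sc Z x $ n)"
      using Suc by (simp add: left_diff_distrib mult.assoc)
    then show ?thesis unfolding pwc_rec[OF assms]
      by (simp add: algebra_simps mult_of_nat_commute)
  qed
qed

lemma pwc_add:
  assumes xZ: "cm x Z" and yZ: "cm y Z" and xy: "cm x y"
  shows "pwc sc Z x * pwc sc Z y = pwc sc Z (x + y)"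
proof (rule ode_unique)
  let ?D = "1 - fps_const Z * fps_X" and ?A = "- fps_const ((x + y) * Z)"
  show "?D $ 0 = 1" by simp
  have c: "cm ?D (pwc sc Z x)" "cm (pwc sc Z x) (fps_const (y * Z))"
    using assms by (auto intro!: cm_intros cm_fps_X intro: cm_sym)
  have "?D * fps_deriv (pwc sc Z x * pwc sc Z y) =
      pwc sc Z x * (?D * fps_deriv (pwc sc Z y)) + (?D * fps_deriv (pwc sc Z x)) * pwc sc Z y"
    using cm_left_commute[OF c(1)] by (simp add: distrib_left mult.assoc)
  also have "\<dots> = ?A * (pwc sc Z x * pwc sc Z y)"
    unfolding pwc_deriv[OF xZ] pwc_deriv[OF yZ] using cm_left_commute[OF c(2)]
    by (simp add: distrib_right left_diff_distrib mult.assoc flip: fps_const_add)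
  finally show "?D * fps_deriv (pwc sc Z x * pwc sc Z y) = ?A * (pwc sc Z x * pwc sc Z y)" .
  show "?D * fps_deriv (pwc sc Z (x + y)) = ?A * pwc sc Z (x + y)"
    using assms by (subst pwc_deriv) (auto intro!: cm_intros)
qed simp

lemma pwc_inverse:
  assumes "cm x Z" shows "pwc sc Z x * pwc sc Z (- x) = 1" "pwc sc Z (- x) * pwc sc Z x = 1"
  using pwc_add[of x Z "- x"] pwc_add[of "- x" Z x] assms by (auto intro!: cm_intros)

text \<open>These are the coefficients of \<open>pwc_add\<close> for Z = -1.\<close>

lemma bin_vandermonde:
  assumes "cm x y" shows "(\<Sum>j\<le>n. bin sc x j * bin sc y (n - j)) = bin sc (x + y) n"
proof -
  have "pwc sc (- 1) x * pwc sc (- 1) y = pwc sc (- 1) (x + y)"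
    using assms by (intro pwc_add) (auto intro!: cm_intros)
  moreover have "pwc sc (- 1) z $ n = bin sc z n" for z n
  proof -
    have "(- 1) ^ n * b * (- 1) ^ n = b" for b :: 'b
      by (cases "even n") simp_all
    then show ?thesis by (simp add: pwc_nth)
  qed
  ultimately show ?thesis by (metis (no_types, lifting) fps_mult_nth atMost_atLeast0 sum.cong)
qed

text \<open>R is the sum of v_r (1 - Zt)^(c - r) Z^r t^r. If v_0 were an eigenvector of ad X with
  eigenvalue c, the term r = 0 alone would be the conjugate; the further v_r account for the
  failure. Both sides solve (1 - Zt) V' = - X Z V.\<close>

lemma conj_first:
  fixes v :: "nat \<Rightarrow> 'b" and c :: 'a
  assumes v: "\<And>r. X * v r - v r * X = sc (c - of_nat r) * v r - of_nat (Suc r) * v (Suc r)"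
    and XZ: "cm X Z" and vZ: "\<And>r. cm (v r) Z"
  defines "R \<equiv> Abs_fps (\<lambda>n. (\<Sum>r\<le>n. sc (((c - of_nat r) gchoose (n - r)) * (-1) ^ (n - r)) * v r) * Z ^ n)"
  shows "pwc sc Z X * fps_const (v 0) = R * pwc sc Z X"
proof (rule ode_unique)
  let ?D = "1 - fps_const Z * fps_X" and ?A = "- fps_const (X * Z)"
  define \<rho> where "\<rho> n = (\<Sum>r\<le>n. sc (((c - of_nat r) gchoose (n - r)) * (-1) ^ (n - r)) * v r)" for n
  have R: "R $ n = \<rho> n * Z ^ n" for n by (simp add: R_def \<rho>_def)
  show "?D $ 0 = 1" by simp
  show "(pwc sc Z X * fps_const (v 0)) $ 0 = (R * pwc sc Z X) $ 0"
    by (simp add: R \<rho>_def)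
  show "?D * fps_deriv (pwc sc Z X * fps_const (v 0)) = ?A * (pwc sc Z X * fps_const (v 0))"
    using pwc_deriv[OF XZ] by (simp flip: mult.assoc)
  have \<rho>Z: "cm (\<rho> n) Z" for n unfolding \<rho>_def using vZ by (auto intro!: cm_intros)
  \<comment> \<open>Up to powers of Z this is (1 - Zt) R' = - Z [X, R], read off
    coefficientwise.\<close>
  have rec: "of_nat (Suc n) * \<rho> (Suc n) = of_nat n * \<rho> n - (X * \<rho> n - \<rho> n * X)" for n
  proof -
    define b where "b r k = ((c - of_nat r) gchoose k) * (-1) ^ k" for r k
    \<comment> \<open>Extended by 0 to r = n + 1, so that all sums run over the same range and can
      be compared term by term.\<close>
    define \<beta> where "\<beta> r = (if r \<le> n then b r (n - r) else 0)" for r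
    have "X * \<rho> n - \<rho> n * X = (\<Sum>r\<le>n. sc (b r (n - r)) * (X * v r - v r * X))"
      by (simp add: \<rho>_def b_def sum_distrib_left sum_distrib_right sum_subtractf right_diff_distrib
          sc_left_commute mult.assoc)
    also have "\<dots> = (\<Sum>r\<le>n. sc (b r (n - r) * (c - of_nat r)) * v r)
        - (\<Sum>r\<le>n. sc (b r (n - r) * of_nat (Suc r)) * v (Suc r))"
      by (simp only: v right_diff_distrib[of "sc x" for x] sum_subtractf sc_mult mult.assoc sc_of_nat)
    also have "(\<Sum>r\<le>n. sc (b r (n - r) * (c - of_nat r)) * v r) = (\<Sum>r\<le>Suc n. sc (\<beta> r * (c - of_nat r)) * v r)"
      by (simp add: \<beta>_def)
    also have "(\<Sum>r\<le>n. sc (b r (n - r) * of_nat (Suc r)) * v (Suc r)) =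
        (\<Sum>r\<le>Suc n. sc ((if r = 0 then 0 else \<beta> (r - 1)) * of_nat r) * v r)"
      by (subst sum.atMost_Suc_shift) (simp add: \<beta>_def)
    finally have 1: "X * \<rho> n - \<rho> n * X = (\<Sum>r\<le>Suc n. sc (\<beta> r * (c - of_nat r)) * v r) -
        (\<Sum>r\<le>Suc n. sc ((if r = 0 then 0 else \<beta> (r - 1)) * of_nat r) * v r)" .
    have 2: "of_nat n * \<rho> n = (\<Sum>r\<le>Suc n. sc (of_nat n * \<beta> r) * v r)"
      by (simp add: \<rho>_def b_def \<beta>_def sum_distrib_left sc_mult mult.assoc)
    have 3: "of_nat (Suc n) * \<rho> (Suc n) = (\<Sum>r\<le>Suc n. sc (of_nat (Suc n) * b r (Suc n - r)) * v r)"
      by (simp add: \<rho>_def b_def sum_distrib_left sc_mult mult.assoc distrib_left sc_add del: sum.atMost_Suc of_nat_Suc)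
    have "of_nat (Suc n) * b r (Suc n - r) =
        of_nat n * \<beta> r - \<beta> r * (c - of_nat r) + (if r = 0 then 0 else \<beta> (r - 1)) * of_nat r"
      if "r \<le> Suc n" for r
    proof -
      define a where "a = c - of_nat r"
      show ?thesis
      proof (cases "r \<le> n")
        case True
        define k where "k = n - r"
        have n: "n = k + r" and sk: "Suc n - r = Suc k" using True by (auto simp: k_def)
        \<comment> \<open>Absorption here and Pascal's rule in \<open>g2\<close> reduce the
          comparison to ring arithmetic.\<close>
        have g1: "of_nat (Suc k) * (a gchoose Suc k) = (a - of_nat k) * (a gchoose k)"
          using gbinomial_absorb_comp[of a k] gbinomial_absorption[of k a]
          by (metis gbinomial_mult_1 add_diff_cancel_left' diff_add_cancel gbinomial_absorption gbinomial_absorb_comp)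
        have g2: "(a + 1) gchoose Suc k = (a gchoose k) + (a gchoose Suc k)"
          by (rule gbinomial_Suc_Suc)
        have \<beta>r: "\<beta> r = (a gchoose k) * (-1) ^ k" using True by (simp add: \<beta>_def b_def a_def k_def)
        have "b r (Suc n - r) = (a gchoose Suc k) * (-1) ^ Suc k" by (simp add: b_def a_def sk)
        moreover have "of_nat (Suc n) * (a gchoose Suc k) =
            (a - of_nat k) * (a gchoose k) + of_nat r * (a gchoose Suc k)"
          using g1 n by (simp add: algebra_simps)
        ultimately have lhs: "of_nat (Suc n) * b r (Suc n - r) =
            ((a - of_nat k) * (a gchoose k) + of_nat r * (a gchoose Suc k)) * (-1) ^ Suc k"
          by (metis mult.assoc)
        have \<beta>': "(if r = 0 then 0 else \<beta> (r - 1)) * of_nat r =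
            ((a gchoose k) + (a gchoose Suc k)) * (-1) ^ Suc k * of_nat r"
        proof (cases r)
          case (Suc r')
          have "c - of_nat r' = a + 1" by (simp add: a_def Suc)
          moreover have "n - r' = Suc k" using n Suc by simp
          ultimately show ?thesis
            using Suc True by (simp add: \<beta>_def b_def g2 distrib_right)
        qed simp
        show ?thesis unfolding lhs unfolding \<beta>' \<beta>r a_def[symmetric] unfolding n by (simp add: algebra_simps)
      next
        case False
        then have "r = Suc n" using that by simp
        then show ?thesis by (simp add: \<beta>_def b_def)
      qed
    qed
    then have "of_nat (Suc n) * \<rho> (Suc n) = (\<Sum>r\<le>Suc n.
        sc (of_nat n * \<beta> r - \<beta> r * (c - of_nat r) + (if r = 0 then 0 else \<beta> (r - 1)) * of_nat r) * v r)"
      unfolding 3 by (intro sum.cong) auto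
    then show ?thesis unfolding 1 2
      by (simp only: sc_add sc_diff distrib_right left_diff_distrib sum.distrib sum_subtractf) simp
  qed
  let ?X = "fps_const X"
  have Rd: "?D * fps_deriv R = - (fps_const Z * (?X * R - R * ?X))"
  proof (rule fps_ext)
    fix n
    have 0: "Z * (\<rho> n * Z ^ n) = \<rho> n * Z ^ Suc n" for n
      using cm_left_commute[OF cm_sym[OF \<rho>Z]] by simp
    have "(?D * fps_deriv R) $ n = of_nat (Suc n) * R $ Suc n - Z * (of_nat n * R $ n)"
      by (cases n) (simp_all add: left_diff_distrib mult.assoc)
    also have "\<dots> = (of_nat (Suc n) * \<rho> (Suc n)) * Z ^ Suc n - of_nat n * \<rho> n * Z ^ Suc n"
      unfolding R using 0 by (simp add: mult.assoc cm_left_commute[OF cm_simps(5)] del: of_nat_Suc power_Suc)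
    also have "\<dots> = - (X * \<rho> n - \<rho> n * X) * Z ^ Suc n"
      unfolding rec by (simp add: algebra_simps)
    also have "\<dots> = - (X * (\<rho> n * Z ^ Suc n)) + \<rho> n * Z ^ Suc n * X"
      using cmD[OF cm_power(1)[OF XZ], of "Suc n"] by (simp add: left_diff_distrib mult.assoc)
    also have "\<dots> = - (Z * (X * (\<rho> n * Z ^ n) - \<rho> n * Z ^ n * X))"
      using 0[of n] cm_left_commute[OF cm_sym[OF XZ]] by (simp add: right_diff_distrib mult.assoc[symmetric]) (simp add: mult.assoc)
    finally show "(?D * fps_deriv R) $ n = (- (fps_const Z * (?X * R - R * ?X))) $ n"
      by (simp add: R)
  qed
  have cR: "cm ?D R" "cm (fps_const Z) R"
  proof -
    have "cm Z (R $ n)" for n unfolding R using \<rho>Z by (auto intro!: cm_intros intro: cm_sym)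
    then show "cm (fps_const Z) R" by (intro cm_fps) auto
    then show "cm ?D R" by (auto intro!: cm_intros)
  qed
  have "?D * fps_deriv (R * pwc sc Z X) =
      R * (?D * fps_deriv (pwc sc Z X)) + (?D * fps_deriv R) * pwc sc Z X"
    using cm_left_commute[OF cR(1)] by (simp add: distrib_left mult.assoc)
  also have "\<dots> = R * - (fps_const (X * Z) * pwc sc Z X) - fps_const Z * (?X * R - R * ?X) * pwc sc Z X"
    unfolding Rd pwc_deriv[OF XZ] by simp
  also have "\<dots> = ?A * (R * pwc sc Z X)"
    using cm_left_commute[OF cR(2)]
    by (simp add: cmD[OF XZ] algebra_simps flip: fps_const_mult)
  finally show "?D * fps_deriv (R * pwc sc Z X) = ?A * (R * pwc sc Z X)" .
qed

text \<open>Moving one Y to the left past d_k leaves the correction - (k + 1) d_(k+1); the d_k are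
  the divided powers of ad Y applied to d_0.\<close>

lemma mult_power_expand:
  fixes d :: "nat \<Rightarrow> 'b"
  assumes d: "\<And>r. of_nat (Suc r) * d (Suc r) = Y * d r - d r * Y"
  shows "d 0 * Y ^ n = (\<Sum>k\<le>n. sc ((-1) ^ k * (fact n / fact (n - k))) * Y ^ (n - k) * d k)"
proof (induction n)
  case (Suc n)
  define a where "a n k = ((-1) ^ k * (fact n / fact (n - k)) :: 'a)" for n k
  have dY: "d k * Y = Y * d k - of_nat (Suc k) * d (Suc k)" for k
    using d[of k] by (simp add: algebra_simps del: of_nat_Suc)
  have "d 0 * Y ^ Suc n = (\<Sum>k\<le>n. sc (a n k) * Y ^ (n - k) * d k) * Y"
    using Suc.IH by (simp only: power_Suc2 mult.assoc[symmetric] a_def)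
  also have "\<dots> = (\<Sum>k\<le>n. sc (a n k) * (Y ^ (Suc n - k) * d k)) -
      (\<Sum>k\<le>n. sc (a n k * of_nat (Suc k)) * (Y ^ (n - k) * d (Suc k)))"
    by (simp add: sum_distrib_right sum_subtractf[symmetric] mult.assoc dY right_diff_distrib
        Suc_diff_le power_Suc2 sc_mult cm_left_commute[OF cm_simps(5)] del: of_nat_Suc power_Suc)
  also have "(\<Sum>k\<le>n. sc (a n k * of_nat (Suc k)) * (Y ^ (n - k) * d (Suc k))) =
      (\<Sum>k\<le>Suc n. sc ((if k = 0 then 0 else a n (k - 1)) * of_nat k) * (Y ^ (Suc n - k) * d k))"
    by (subst sum.atMost_Suc_shift) simp
  also have "(\<Sum>k\<le>n. sc (a n k) * (Y ^ (Suc n - k) * d k)) =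
      (\<Sum>k\<le>Suc n. sc (if k \<le> n then a n k else 0) * (Y ^ (Suc n - k) * d k))"
    by simp
  also have "\<dots> - (\<Sum>k\<le>Suc n. sc ((if k = 0 then 0 else a n (k - 1)) * of_nat k) * (Y ^ (Suc n - k) * d k)) =
      (\<Sum>k\<le>Suc n. sc (a (Suc n) k) * (Y ^ (Suc n - k) * d k))"
    unfolding sum_subtractf[symmetric] left_diff_distrib[symmetric] sc_diff[symmetric]
  proof (intro sum.cong refl arg_cong2[of _ _ _ _ times] arg_cong[of _ _ sc])
    fix k assume k: "k \<in> {..Suc n}"
    show "(if k \<le> n then a n k else 0) - (if k = 0 then 0 else a n (k - 1)) * of_nat k = a (Suc n) k"
    proof (cases k)
      case (Suc j)
      show ?thesis
      proof (cases "k \<le> n")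
        case True
        then obtain i where n: "n = k + i" using le_Suc_ex by blast
        have "n - k = i" "n - j = Suc i" "Suc n - k = Suc i" using n Suc by auto
        moreover have "of_nat (Suc i) \<noteq> (0 :: 'a)" by (rule of_nat_neq_0)
        ultimately show ?thesis using Suc True n unfolding a_def
          by (simp add: divide_simps del: of_nat_Suc) (simp add: algebra_simps)
      next
        case False
        then have "k = Suc n" "j = n" using k Suc by auto
        then show ?thesis by (simp add: a_def)
      qed
    qed (simp add: a_def del: fact_Suc)
  qed
  finally show ?case by (simp only: a_def mult.assoc)
qed simp

text \<open>Only the right-hand factor (1 - Yt)^(-x) is moved through d_0. Each commutator with Y
  lowers its exponent by 1 and contributes a factor of \<open>rise x k\<close>; splitting (1 -
  Yt)^(-x-k) then releases (1 - Yt)^(-x) on the left, where it is cancelled.\<close>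

lemma conj_second:
  fixes d :: "nat \<Rightarrow> 'b"
  assumes d: "\<And>r. of_nat (Suc r) * d (Suc r) = Y * d r - d r * Y"
    and xY: "cm x Y" and xd: "\<And>r. cm x (d r)"
  defines "R \<equiv> Abs_fps (\<lambda>n. \<Sum>r\<le>n. (-1) ^ r * rise x r * pwc sc Y (- of_nat r) $ (n - r) * d r)"
  shows "pwc sc Y x * fps_const (d 0) * pwc sc Y (- x) = R"
proof -
  let ?P = "pwc sc Y (- x)"
  have "fps_const (d 0) * ?P = ?P * R"
  proof (rule fps_ext)
    fix n
    have cb: "cm (bin sc (- x) n) (d 0)" "cm (d 0) ((-1) ^ n)" using xd by (auto intro!: cm_intros)
    have "(fps_const (d 0) * ?P) $ n = (-1) ^ n * bin sc (- x) n * (d 0 * Y ^ n)"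
      using cm_left_commute[OF cb(1)] cmD[OF cb(1)] cm_left_commute[OF cb(2)]
      by (simp add: pwc_nth mult.assoc)
    also have "\<dots> = (\<Sum>k\<le>n. (-1) ^ n * bin sc (- x) n * sc ((-1) ^ k * (fact n / fact (n - k))) * Y ^ (n - k) * d k)"
      unfolding mult_power_expand[OF d] by (simp add: sum_distrib_left mult.assoc)
    also have "\<dots> = (\<Sum>k\<le>n. (-1) ^ k * rise x k * pwc sc Y (- x - of_nat k) $ (n - k) * d k)"
    proof (intro sum.cong refl)
      fix k assume "k \<in> {..n}"
      then obtain i where n: "n = k + i" using le_Suc_ex by auto
      \<comment> \<open>The first k factors of \<open>fall (- x) n\<close> become
        \<open>rise x k\<close> up to sign; the remaining i factors form the binomial coefficient
        for the exponent -x-k.\<close>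
      have "bin sc (- x) n * sc ((-1) ^ k * (fact n / fact i)) =
          sc ((-1) ^ k * (fact n / fact i) * (1 / fact n)) * fall (- x) n"
        unfolding sc_comm[of "bin sc (- x) n"] by (simp only: bin_def sc_mult mult.assoc)
      also have "(-1) ^ k * (fact n / fact i) * (1 / fact n) = ((-1) ^ k * (1 / fact i) :: 'a)" by simp
      also have "sc ((-1) ^ k * (1 / fact i)) * fall (- x) n =
          (-1) ^ k * fall (- x) k * bin sc (- x - of_nat k) i"
        unfolding n fall_add bin_def
        by (simp only: sc_mult sc_power sc_neg1 mult.assoc sc_left_commute[of "fall (- x) k"])
      also have "\<dots> = rise x k * bin sc (- x - of_nat k) i" by (simp add: rise_fall)
      finally have e: "bin sc (- x) n * sc ((-1) ^ k * (fact n / fact i)) =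
          rise x k * bin sc (- x - of_nat k) i" .
      have cs: "cm ((-1) ^ j) z" for j and z :: 'b by (auto intro!: cm_intros)
      have "(-1) ^ n * bin sc (- x) n * sc ((-1) ^ k * (fact n / fact i)) * Y ^ i =
          (-1) ^ n * (rise x k * bin sc (- x - of_nat k) i) * Y ^ i"
        by (simp only: mult.assoc e[symmetric])
      also have "\<dots> = (-1) ^ k * rise x k * pwc sc Y (- x - of_nat k) $ i"
        using cm_left_commute[OF cs[of i "rise x k"]] by (simp add: pwc_nth n power_add mult.assoc)
      finally show "(-1) ^ n * bin sc (- x) n * sc ((-1) ^ k * (fact n / fact (n - k))) * Y ^ (n - k) * d k =
          (-1) ^ k * rise x k * pwc sc Y (- x - of_nat k) $ (n - k) * d k"
        by (simp only: n add_diff_cancel_left')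
    qed
    also have "\<dots> = (\<Sum>k\<le>n. \<Sum>j\<le>n - k. ?P $ j * ((-1) ^ k * rise x k * pwc sc Y (- of_nat k) $ (n - k - j) * d k))"
    proof (intro sum.cong refl)
      fix k
      have c: "cm (?P $ j) ((-1) ^ k * rise x k)" for j
        using xY by (auto simp: pwc_nth intro!: cm_intros intro: cm_sym)
      have "pwc sc Y (- x - of_nat k) = ?P * pwc sc Y (- of_nat k)"
        using xY by (subst pwc_add) (auto intro!: cm_intros)
      then have "pwc sc Y (- x - of_nat k) $ (n - k) = (\<Sum>j\<le>n - k. ?P $ j * pwc sc Y (- of_nat k) $ (n - k - j))"
        by (simp add: fps_mult_nth atMost_atLeast0)
      then show "(-1) ^ k * rise x k * pwc sc Y (- x - of_nat k) $ (n - k) * d k =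
          (\<Sum>j\<le>n - k. ?P $ j * ((-1) ^ k * rise x k * pwc sc Y (- of_nat k) $ (n - k - j) * d k))"
        using cm_left_commute[OF c]
        by (simp add: sum_distrib_left sum_distrib_right mult.assoc)
    qed
    also have "\<dots> = (\<Sum>j\<le>n. \<Sum>k\<le>n - j. ?P $ j * ((-1) ^ k * rise x k * pwc sc Y (- of_nat k) $ (n - k - j) * d k))"
      by (rule sum_triangle_swap)
    also have "\<dots> = (?P * R) $ n"
      by (simp add: R_def fps_mult_nth atMost_atLeast0 sum_distrib_left add.commute)
    finally show "(fps_const (d 0) * ?P) $ n = (?P * R) $ n" .
  qed
  then show ?thesis using pwc_inverse(1)[OF xY] by (simp add: mult.assoc) (simp flip: mult.assoc)
qed

lemma uexp_deriv: "fps_deriv (uexp sc x) = fps_const x * uexp sc x"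
proof (rule fps_ext)
  fix n
  have "fps_deriv (uexp sc x) $ n = of_nat (Suc n) * sc (1 / fact (Suc n)) * x ^ Suc n"
    by (simp add: uexp_def mult.assoc)
  also have "\<dots> = (fps_const x * uexp sc x) $ n"
    unfolding sc_fact_Suc by (simp add: uexp_def sc_left_commute[of x])
  finally show "fps_deriv (uexp sc x) $ n = (fps_const x * uexp sc x) $ n" .
qed

lemma cm_uexp [cm_intros]: "cm a x \<Longrightarrow> cm (fps_const a) (uexp sc x)"
proof (rule cm_fps)
  show "cm a x \<Longrightarrow> cm (fps_const a $ i) (uexp sc x $ j)" for i j
    by (auto simp: uexp_def intro!: cm_intros)
qed

lemma uexp_inverse: "uexp sc x * uexp sc (- x) = 1" "uexp sc (- x) * uexp sc x = 1"
proof -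
  have *: "uexp sc x * uexp sc (- x) = 1" for x
  proof (rule ode_unique[where B = 1 and A = 0])
    have "cm (fps_const x) (uexp sc x)" by (auto intro!: cm_intros)
    then show "1 * fps_deriv (uexp sc x * uexp sc (- x)) = 0 * (uexp sc x * uexp sc (- x))"
      using cm_left_commute[of "fps_const x" "uexp sc x"]
      by (simp add: uexp_deriv mult.assoc flip: fps_const_neg)
  qed (simp_all add: uexp_def)
  show "uexp sc x * uexp sc (- x) = 1" "uexp sc (- x) * uexp sc x = 1"
    using *[of x] *[of "- x"] by simp_all
qed

end

section \<open>A pair with [X, Y] = Y and conjugation by exp (t X Y)\<close>

locale calg_XY = calg sc for sc :: "'a::field_char_0 \<Rightarrow> 'b::ring_1" +
  fixes X Y :: 'b
  assumes XY: "X * Y - Y * X = Y"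
begin

lemma X_Y: "X * Y = Y * X + Y" using XY by (simp add: algebra_simps)

lemma X_Ypow: "X * Y ^ n = Y ^ n * X + of_nat n * Y ^ n"
proof (induction n)
  case (Suc n)
  have "X * Y ^ Suc n = X * Y ^ n * Y" by (simp only: power_Suc2 mult.assoc)
  also have "\<dots> = Y ^ n * (X * Y) + of_nat n * Y ^ n * Y"
    unfolding Suc.IH by (simp add: distrib_right mult.assoc)
  also have "\<dots> = Y ^ Suc n * X + of_nat (Suc n) * Y ^ Suc n"
    unfolding X_Y power_Suc2 by (simp add: algebra_simps)
  finally show ?case .
qed simp

lemma Y_fall: "Y * fall (X + a) n = fall (X + a - 1) n * Y" if "cm a Y" for a
proof (induction n)
  case (Suc n)
  have *: "Y * (X + a - of_nat n) = (X + a - 1 - of_nat n) * Y"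
    using X_Y cmD[OF that] by (simp add: algebra_simps mult_of_nat_commute)
  show ?case by (simp only: fall.simps mult.assoc[symmetric] Suc.IH) (simp only: mult.assoc *)
qed simp

lemma XY_power: "(X * Y) ^ n = fall X n * Y ^ n"
proof (induction n)
  case (Suc n)
  have "(X * Y) ^ Suc n = X * (Y * fall X n) * Y ^ n"
    using Suc.IH by (simp add: mult.assoc)
  also have "Y * fall X n = fall (X - 1) n * Y" using Y_fall[of 0 n] by simp
  finally show ?case by (simp only: fall_Suc_left power_Suc mult.assoc)
qed simp

text \<open>Because [X, Y^n] = n Y^n, the derivation ad X acts on series in Yt as t d/dt.\<close>

lemma X_pwc:
  assumes "cm x X" "cm x Y"
  shows "fps_const X * pwc sc Y x = pwc sc Y x * fps_const X + fps_X * fps_deriv (pwc sc Y x)"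
proof (rule fps_ext)
  fix n
  define b where "b = (-1) ^ n * bin sc x n"
  have b: "cm X b" "cm (of_nat n) b" using assms unfolding b_def by (auto intro!: cm_intros intro: cm_sym)
  have "X * (b * Y ^ n) = b * Y ^ n * X + of_nat n * (b * Y ^ n)"
    by (simp add: cm_left_commute[OF b(1)] cm_left_commute[OF b(2)] X_Ypow distrib_left mult.assoc)
  then have "X * pwc sc Y x $ n = pwc sc Y x $ n * X + of_nat n * pwc sc Y x $ n"
    by (simp only: pwc_nth b_def)
  then show "(fps_const X * pwc sc Y x) $ n = (pwc sc Y x * fps_const X + fps_X * fps_deriv (pwc sc Y x)) $ n"
    by (cases n) simp_all
qed

definition u :: "'b fps" where "u = uexp sc (X * Y)"
definition ui :: "'b fps" where "ui = uexp sc (- (X * Y))"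

lemma u_ui [simp]: "u * ui = 1" "ui * u = 1" "u * (ui * z) = z" "ui * (u * z) = z"
  by (simp_all add: u_def ui_def uexp_inverse mult.assoc[symmetric])

text \<open>By \<open>XY_power\<close> the exponential is a binomial series with X on the left and Y
  on the right: it is F with Y replaced by -Y and the tensor sign removed.\<close>

lemma u_nth: "u $ n = bin sc X n * Y ^ n"
  by (simp add: u_def uexp_def XY_power bin_def mult.assoc)

lemma ui_nth: "ui $ n = (-1) ^ n * bin sc X n * Y ^ n"
proof -
  have "(- (X * Y)) ^ n = (-1) ^ n * (X * Y) ^ n" by (rule power_minus)
  then show ?thesis
    by (simp add: ui_def uexp_def XY_power bin_def mult.assoc sc_left_commute[of "(-1) ^ n"])
qed

text \<open>In d the index r counts steps along the chain of ad X, and p counts divided powers of ad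
  Y. The series T solves T' = (X - c) Y T - T X Y. The prefactor (1 - Yt)^(-c) turns X - c into X,
  so that the product solves V' = [X Y, V], as the conjugate by u does.\<close>

lemma u_conj_formula:
  fixes d :: "nat \<Rightarrow> nat \<Rightarrow> 'b" and c :: 'a
  assumes w: "\<And>r. X * d 0 r - d 0 r * X = sc (c - of_nat r) * d 0 r + of_nat (Suc r) * d 0 (Suc r)"
    and d: "\<And>p r. of_nat (Suc p) * d (Suc p) r = Y * d p r - d p r * Y"
  defines "T \<equiv> Abs_fps (\<lambda>n. \<Sum>r\<le>n. fall (X - sc c) (n - r) * d (n - r) r * Y ^ r)"
  shows "pwc sc Y (- sc c) * T = u * fps_const (d 0 0) * ui"
proof -
  \<comment> \<open>Each application of ad Y raises the eigenvalue of ad X by 1, hence the summand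
    p.\<close>
  have Xd: "X * d p r - d p r * X = sc (c - of_nat r + of_nat p) * d p r + of_nat (Suc r) * d p (Suc r)" for p r
  proof (induction p arbitrary: r)
    case (Suc p)
    have "of_nat (Suc p) * (X * d (Suc p) r - d (Suc p) r * X) =
        X * (of_nat (Suc p) * d (Suc p) r) - (of_nat (Suc p) * d (Suc p) r) * X"
      by (simp add: right_diff_distrib mult.assoc cm_left_commute[of X "of_nat (Suc p)"] del: of_nat_Suc)
    also have "\<dots> = (X * Y - Y * X) * d p r - d p r * (X * Y - Y * X)
        + Y * (X * d p r - d p r * X) - (X * d p r - d p r * X) * Y"
      unfolding d by (simp add: algebra_simps)
    also have "\<dots> = sc (c - of_nat r + of_nat p + 1) * (Y * d p r - d p r * Y)
        + of_nat (Suc r) * (Y * d p (Suc r) - d p (Suc r) * Y)"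
      unfolding Suc.IH XY
      by (simp add: algebra_simps sc_add sc_diff sc_left_commute[of Y] cm_left_commute[of Y "of_nat r"] cm_left_commute[of Y "of_nat p"]
          sc_left_commute[of "d p r"] sc_comm[of Y])
    also have "\<dots> = of_nat (Suc p) * (sc (c - of_nat r + of_nat (Suc p)) * d (Suc p) r + of_nat (Suc r) * d (Suc p) (Suc r))"
    proof -
      have "c - of_nat r + of_nat p + 1 = c - of_nat r + of_nat (Suc p)" by simp
      then show ?thesis unfolding d[symmetric]
        by (simp only: distrib_left sc_left_commute[of "of_nat (Suc p)"]
            cm_left_commute[OF cm_simps(5), of "of_nat (Suc p)" "Suc r"])
    qed
    finally show ?case by (rule of_nat_cancel)
  qed (use w in simp)
  define Tn where "Tn n = (\<Sum>r\<le>n. fall (X - sc c) (n - r) * d (n - r) r * Y ^ r)" for n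
  have rec: "of_nat (Suc n) * Tn (Suc n) = (X - sc c) * Y * Tn n - Tn n * (X * Y)" for n
  proof -
    define D where "D p r = fall (X - sc c) p * d p r * Y ^ r" for p r
    \<comment> \<open>The recursion for a single pair: a step of degree raises either p or r, and
      summation over p + r = n gives \<open>rec\<close>.\<close>
    have 1: "(X - sc c) * Y * D p r - D p r * (X * Y) = of_nat (Suc p) * D (Suc p) r + of_nat (Suc r) * D p (Suc r)" for p r
    proof -
      have "Y * fall (X - sc c) p = fall (X - sc c - 1) p * Y"
        using Y_fall[of "- sc c" p] by (auto intro!: cm_intros)
      then have a: "(X - sc c) * Y * fall (X - sc c) p = fall (X - sc c) (Suc p) * Y"
        by (simp only: fall_Suc_left mult.assoc)
      have YX: "Y ^ r * X = X * Y ^ r - of_nat r * Y ^ r" using X_Ypow[of r] by simp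
      have b: "d p r * Y ^ r * (X * Y) = ((X - sc c - of_nat p) * d p r - of_nat (Suc r) * d p (Suc r)) * Y ^ Suc r"
      proof -
        have "d p r * Y ^ r * (X * Y) = (d p r * X - of_nat r * d p r) * Y ^ Suc r"
          by (simp only: mult.assoc[symmetric] power_Suc2)
            (simp only: mult.assoc YX, simp add: algebra_simps mult_of_nat_commute)
        also have "d p r * X = X * d p r - (sc (c - of_nat r + of_nat p) * d p r + of_nat (Suc r) * d p (Suc r))"
          using Xd[of p r] by (simp add: algebra_simps)
        finally show ?thesis by (simp add: algebra_simps sc_add sc_diff)
      qed
      have "(X - sc c) * Y * D p r = fall (X - sc c) (Suc p) * (Y * d p r) * Y ^ r"
        unfolding D_def by (simp only: mult.assoc[symmetric] a)
      also have "Y * d p r = of_nat (Suc p) * d (Suc p) r + d p r * Y"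
        unfolding d by simp
      finally have l: "(X - sc c) * Y * D p r = of_nat (Suc p) * D (Suc p) r + fall (X - sc c) (Suc p) * d p r * Y ^ Suc r"
        unfolding D_def
        by (simp add: distrib_left distrib_right mult.assoc cm_left_commute[of "fall (X - sc c) p" "of_nat p"]
            cm_left_commute[of "X - (sc c + of_nat p)" "of_nat p"] diff_diff_eq)
      have "D p r * (X * Y) = fall (X - sc c) p * ((X - sc c - of_nat p) * d p r - of_nat (Suc r) * d p (Suc r)) * Y ^ Suc r"
        unfolding D_def by (simp only: mult.assoc b[simplified mult.assoc])
      also have "\<dots> = fall (X - sc c) (Suc p) * d p r * Y ^ Suc r - of_nat (Suc r) * D p (Suc r)"
        unfolding D_def
        by (simp add: right_diff_distrib left_diff_distrib mult.assoc cm_left_commute[of "fall (X - sc c) p" "1 + of_nat r"] cm_add del: power_Suc)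
      finally show ?thesis using l by simp
    qed
    have "(X - sc c) * Y * Tn n - Tn n * (X * Y) =
        (\<Sum>r\<le>n. of_nat (Suc (n - r)) * D (Suc (n - r)) r) + (\<Sum>r\<le>n. of_nat (Suc r) * D (n - r) (Suc r))"
      unfolding Tn_def D_def[symmetric] sum_distrib_left sum_distrib_right sum_subtractf[symmetric] 1 sum.distrib ..
    also have "(\<Sum>r\<le>n. of_nat (Suc (n - r)) * D (Suc (n - r)) r) = (\<Sum>r\<le>Suc n. of_nat (Suc n - r) * D (Suc n - r) r)"
      by (simp add: Suc_diff_le del: of_nat_Suc of_nat_diff)
    also have "(\<Sum>r\<le>n. of_nat (Suc r) * D (n - r) (Suc r)) = (\<Sum>r\<le>Suc n. of_nat r * D (Suc n - r) r)"
      by (subst sum.atMost_Suc_shift) simp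
    also have "(\<Sum>r\<le>Suc n. of_nat (Suc n - r) * D (Suc n - r) r) + \<dots> = (\<Sum>r\<le>Suc n. of_nat (Suc n) * D (Suc n - r) r)"
      unfolding sum.distrib[symmetric] distrib_right[symmetric] of_nat_add[symmetric] by (rule sum.cong) auto
    finally show ?thesis by (simp only: Tn_def D_def sum_distrib_left)
  qed
  let ?X = "fps_const X" and ?Y = "fps_const Y" and ?c = "fps_const (sc c)"
  let ?G = "pwc sc Y (- sc c)" and ?D = "1 - fps_const Y * fps_X"
  have T': "fps_deriv T = (?X - ?c) * ?Y * T - T * (?X * ?Y)"
    by (rule fps_ext) (use rec in \<open>simp add: T_def Tn_def del: of_nat_Suc\<close>)
  have cY: "cm (- sc c) Y" by (auto intro!: cm_intros)
  have DG: "?D * fps_deriv ?G = ?c * ?Y * ?G"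
    unfolding pwc_deriv[OF cY] by (simp flip: fps_const_neg)
  have XG: "?X * ?G = ?G * ?X + fps_X * fps_deriv ?G"
    by (rule X_pwc) (auto intro!: cm_intros)
  have GY: "cm ?Y ?G" and Gc: "cm ?c ?G" and Dc: "cm ?c ?D" and DY: "cm ?Y ?D" "cm ?D ?G"
    by (auto intro!: cm_intros)
  \<comment> \<open>The ring identity behind \<open>R'\<close>. W is the correction from moving X
    past G; the same term arises when 1 - Yt is pulled through C B G, so the two match.\<close>
  have alg: "D * V = D * (A * B * (G * S) - G * S * (A * B))"
    if "D * V = D * G * ((A - C) * B * S - S * (A * B)) + C * B * G * S"
      "D * (A * B * (G * S)) = D * (G * A * B) * S + W * S"
      "D * G * (C * B) = C * B * G - W" for D V G A C B S W :: "'b fps"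
  proof -
    have "D * V = D * G * A * B * S - (D * G * (C * B)) * S - D * G * S * A * B + C * B * G * S"
      unfolding that(1) by (simp add: algebra_simps)
    also have "\<dots> = D * (G * A * B) * S + W * S - D * (G * S * (A * B))"
      unfolding that(3) by (simp add: algebra_simps)
    finally show ?thesis unfolding that(2)[symmetric] by (simp add: right_diff_distrib)
  qed
  have R': "?D * fps_deriv (?G * T) = ?D * (?X * ?Y * (?G * T) - ?G * T * (?X * ?Y))"
  proof -
    have "?D * fps_deriv (?G * T) = ?D * ?G * ((?X - ?c) * ?Y * T - T * (?X * ?Y)) + ?c * ?Y * ?G * T"
      by (simp only: fps_deriv_mult T' distrib_left mult.assoc[symmetric] DG)
    moreover have "?X * ?Y * ?G = ?G * ?X * ?Y + fps_X * fps_deriv ?G * ?Y"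
    proof -
      have "?X * ?Y * ?G = ?X * ?G * ?Y" by (simp only: mult.assoc cmD[OF GY])
      then show ?thesis by (simp only: XG distrib_right)
    qed
    then have "?D * (?X * ?Y * (?G * T)) = ?D * (?G * ?X * ?Y) * T + fps_X * (?D * fps_deriv ?G) * ?Y * T"
      using cm_left_commute[OF cm_fps_X(1)[of ?D]]
      by (simp only: mult.assoc[symmetric]) (simp only: distrib_left distrib_right mult.assoc)
    then have "?D * (?X * ?Y * (?G * T)) = ?D * (?G * ?X * ?Y) * T + fps_X * (?c * ?Y * ?G) * ?Y * T"
      unfolding DG .
    moreover have "?D * ?G * (?c * ?Y) = (?c * ?Y * ?G) - fps_X * (?c * ?Y * ?G) * ?Y"
    proof -
      have "?D * ?G * (?c * ?Y) = ?D * (?c * ?Y * ?G)"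
        by (simp only: mult.assoc cmD[OF GY, symmetric] cm_left_commute[OF Gc, symmetric])
      also have "\<dots> = ?c * ?Y * ?G - ?Y * fps_X * (?c * ?Y * ?G)" by (simp only: left_diff_distrib mult_1_left)
      also have "?Y * fps_X * (?c * ?Y * ?G) = fps_X * (?c * ?Y * ?G) * ?Y"
      proof -
        have "cm ?Y (?c * ?Y * ?G)" by (intro cm_mult GY cm_refl cm_fps_const cm_sc)
        then have "fps_X * (?c * ?Y * ?G) * ?Y = fps_X * (?Y * (?c * ?Y * ?G))"
          by (simp only: mult.assoc cm_def)
        then show ?thesis
          by (simp only: mult.assoc cm_left_commute[OF cm_fps_X(1)[of ?Y]])
      qed
      finally show ?thesis .
    qed
    ultimately show ?thesis
      using alg[of ?D "fps_deriv (?G * T)" ?G ?X ?c ?Y T "fps_X * (?c * ?Y * ?G) * ?Y"]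
      by (simp only: mult.assoc)
  qed
  \<comment> \<open>Multiplying by u on the right avoids differentiating \<open>ui\<close>. Both
    sides solve V' = X Y V, multiplied by 1 - Yt because G' is known only in that form.\<close>
  have "?G * T * u = u * fps_const (d 0 0)"
  proof (rule ode_unique)
    let ?A = "?D * (?X * ?Y)"
    show "?D $ 0 = 1" by simp
    have u': "fps_deriv u = ?X * ?Y * u" by (simp add: u_def uexp_deriv)
    show "?D * fps_deriv (u * fps_const (d 0 0)) = ?A * (u * fps_const (d 0 0))"
      by (simp add: u' mult.assoc del: fps_const_mult)
    have "?D * fps_deriv (?G * T * u) = ?D * (?G * T) * (?X * ?Y * u) + ?D * fps_deriv (?G * T) * u"
      unfolding fps_deriv_mult[of "?G * T" u] u' by (simp only: distrib_left mult.assoc)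
    also have "\<dots> = ?A * (?G * T * u)"
      unfolding R' by (simp add: algebra_simps del: fps_const_mult)
    finally show "?D * fps_deriv (?G * T * u) = ?A * (?G * T * u)" .
    show "(?G * T * u) $ 0 = (u * fps_const (d 0 0)) $ 0"
      by (simp add: T_def u_nth)
  qed
  then have "?G * T * u * ui = u * fps_const (d 0 0) * ui" by simp
  then show ?thesis by (simp add: mult.assoc)
qed

end

section \<open>The cocycle identity of the twist\<close>

text \<open>Indices number three tensor factors, so this is F_12 (\<Delta>0 \<otimes> id)(F) = F_23
  (id \<otimes> \<Delta>0)(F) with the primitive coproduct \<Delta>0. As X1 and X2 commute, the
  factor with exponent X1 + X2 splits; then both sides solve one equation with leading coefficient
  (1 - Y2 t)(1 - Y3 t).\<close>

lemma (in calg) twist_cocycle: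
  assumes X1: "cm X1 X2" "cm X1 Y2" "cm X1 Y3" and Y3: "cm Y3 X2" "cm Y3 Y2"
    and XY: "X2 * Y2 - Y2 * X2 = Y2"
  shows "pwc sc Y2 X1 * pwc sc Y3 (X1 + X2) = pwc sc Y3 X2 * pwc sc (Y2 + Y3) X1"
proof -
  interpret XY: calg_XY sc X2 Y2 by unfold_locales (rule XY)
  let ?x = "fps_const X1" and ?X2 = "fps_const X2" and ?Y2 = "fps_const Y2" and ?Y3 = "fps_const Y3"
  let ?F = "pwc sc Y2 X1" and ?G = "pwc sc Y3 X2" and ?H = "pwc sc Y3 X1" and ?K = "pwc sc (Y2 + Y3) X1"
  let ?t = "fps_X :: 'b fps"
  let ?D2 = "1 - ?Y2 * ?t" and ?D3 = "1 - ?Y3 * ?t" and ?D23 = "1 - fps_const (Y2 + Y3) * ?t"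
  note sym = X1 Y3 X1[THEN cm_sym] Y3[THEN cm_sym]
  have cm: "cm ?D3 ?F" "cm ?D3 ?D2" "cm ?D3 ?G" "cm ?x ?G" "cm ?Y3 ?F" "cm ?Y3 ?G" "cm ?x ?F" "cm ?Y3 ?D2"
    "cm ?x ?D2" "cm ?x ?D3" "cm ?x ?Y3" "cm ?x ?Y2" "cm ?Y2 ?D2" "cm ?x ?X2" "cm ?X2 ?D3" "cm ?Y3 ?D3" "cm ?Y3 ?X2" "cm ?Y3 ?Y2" "cm ?t ?D2" "cm ?t ?F"
    "cm ?D3 ?x" "cm ?D3 ?Y2"
    using sym by (auto intro!: cm_intros)
  have dF: "?D2 * fps_deriv ?F = - (?x * ?Y2 * ?F)" using pwc_deriv[OF X1(2)] by simp
  have dG: "?D3 * fps_deriv ?G = - (?X2 * ?Y3 * ?G)" using pwc_deriv[OF cm_sym[OF Y3(1)]] by simp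
  have dH: "?D3 * fps_deriv ?H = - (?x * ?Y3 * ?H)" using pwc_deriv[OF X1(3)] by simp
  have dK: "?D23 * fps_deriv ?K = - (?x * (?Y2 + ?Y3) * ?K)"
    using pwc_deriv[of X1 "Y2 + Y3"] X1 by (simp add: cm_add)
  have XF: "?X2 * ?F = ?F * ?X2 + ?t * fps_deriv ?F"
    by (rule XY.X_pwc) (use X1 in auto)
  \<comment> \<open>Y2 is an eigenvector of ad X2 with eigenvalue 1, so \<open>conj_first\<close>
    applies with a chain that ends at v 0, and only (1 - Y3 t)^1 appears.\<close>
  have GY: "?G * ?Y2 = ?Y2 * ?D3 * ?G"
  proof -
    define v where "v r = (if r = 0 then Y2 else 0)" for r :: nat
    have "pwc sc Y3 X2 * fps_const (v 0) =
        Abs_fps (\<lambda>n. (\<Sum>r\<le>n. sc (((1 - of_nat r) gchoose (n - r)) * (-1) ^ (n - r)) * v r) * Y3 ^ n) * pwc sc Y3 X2"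
      by (rule conj_first) (use XY Y3 in \<open>auto simp: v_def intro: cm_sym\<close>)
    moreover have "Abs_fps (\<lambda>n. (\<Sum>r\<le>n. sc (((1 - of_nat r) gchoose (n - r)) * (-1) ^ (n - r)) * v r) * Y3 ^ n) = ?Y2 * ?D3"
    proof (rule fps_ext)
      fix n
      have "(\<Sum>r\<le>n. sc (((1 - of_nat r) gchoose (n - r)) * (-1) ^ (n - r)) * v r) =
          (\<Sum>r\<le>n. if r = 0 then sc ((1 gchoose n) * (-1) ^ n) * Y2 else 0)"
        by (rule sum.cong) (auto simp: v_def)
      also have "\<dots> = sc ((1 gchoose n) * (-1) ^ n) * Y2" by simp
      also have "1 gchoose n = (if n \<le> 1 then 1 else 0 :: 'a)"
      proof -
        have "1 choose n = (if n \<le> 1 then 1 else 0)"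
          by (cases "n = 0 \<or> n = 1") (auto simp: binomial_eq_0)
        then show ?thesis using binomial_gbinomial[of 1 n, where 'a = 'a] by (simp split: if_splits)
      qed
      finally show "Abs_fps (\<lambda>n. (\<Sum>r\<le>n. sc (((1 - of_nat r) gchoose (n - r)) * (-1) ^ (n - r)) * v r) * Y3 ^ n) $ n = (?Y2 * ?D3) $ n"
        by (cases n; cases "n - 1") (auto simp: right_diff_distrib sc_minus mult.assoc[symmetric] fps_mult_fps_X_commute[symmetric])
    qed
    ultimately show ?thesis by (simp add: v_def)
  qed
  \<comment> \<open>The denominator belonging to Y2 + Y3 turns into the product of the other two on
    passing G, which gives both sides the same leading coefficient.\<close>
  have key: "?D2 * ?D3 * ?G = ?G * ?D23"
  proof -
    have "?G * ?D23 = ?G - (?G * ?Y2) * ?t - ?Y3 * ?G * ?t"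
      by (simp only: fps_const_add[symmetric] right_diff_distrib distrib_right distrib_left
          mult.assoc[symmetric] cmD[OF cm(6)] mult_1_right diff_diff_eq)
    also have "\<dots> = ?G - ?Y2 * ?t * ?D3 * ?G - ?Y3 * ?t * ?G"
      unfolding GY using cmD[OF cm_fps_X(2)[of ?G]] cmD[OF cm_fps_X(2)[of "?D3 * ?G"]]
      by (simp only: mult.assoc)
    also have "\<dots> = ?D2 * ?D3 * ?G"
      by (simp only: left_diff_distrib mult_1_left mult.assoc) (simp only: right_diff_distrib diff_diff_eq add.commute)
    finally show ?thesis ..
  qed
  let ?A = "- (?x * ?Y2 + ?D2 * ?X2 * ?Y3 + ?D2 * ?x * ?Y3)"
  have "?F * ?G * ?H = ?G * ?K"
  proof (rule ode_unique)
    let ?B = "?D2 * ?D3"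
    show "?B $ 0 = 1" by simp
    show "(?F * ?G * ?H) $ 0 = (?G * ?K) $ 0" by simp
    have FX: "?D2 * ?F * ?X2 = (?D2 * ?X2 + ?t * ?x * ?Y2) * ?F"
    proof -
      have "?F * ?X2 = ?X2 * ?F - ?t * fps_deriv ?F" using XF by simp
      then have "?D2 * ?F * ?X2 = ?D2 * ?X2 * ?F - ?t * (?D2 * fps_deriv ?F)"
        by (simp only: mult.assoc right_diff_distrib cm_left_commute[OF cm(19)])
      then show ?thesis unfolding dF by (simp add: distrib_right mult.assoc del: fps_const_mult)
    qed
    have "?B * fps_deriv (?F * ?G * ?H) =
       ?D3 * (?D2 * fps_deriv ?F) * ?G * ?H + ?D2 * ?F * (?D3 * fps_deriv ?G) * ?H + ?D2 * ?F * ?G * (?D3 * fps_deriv ?H)"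
      unfolding fps_deriv_mult[of "?F * ?G" ?H] fps_deriv_mult[of ?F ?G]
      by (simp only: distrib_left distrib_right mult.assoc
          cm_left_commute[OF cm(1)] cm_left_commute[OF cm(2)] cm_left_commute[OF cm(3)])
        (simp only: ac_simps)
    also have "?D3 * (?D2 * fps_deriv ?F) * ?G * ?H = - (?x * ?Y2 * ?D3 * ?F * ?G * ?H)"
      unfolding dF by (simp only: mult.assoc mult_minus_right mult_minus_left cm_left_commute[OF cm(21)] cm_left_commute[OF cm(22)])
    also have "?D2 * ?F * (?D3 * fps_deriv ?G) * ?H = - ((?D2 * ?X2 + ?t * ?x * ?Y2) * ?Y3 * ?F * ?G * ?H)"
    proof -
      have "?D2 * ?F * (?X2 * ?Y3 * ?G) * ?H = (?D2 * ?F * ?X2) * ?Y3 * ?G * ?H" by (simp only: mult.assoc)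
      also have "\<dots> = (?D2 * ?X2 + ?t * ?x * ?Y2) * ?Y3 * ?F * ?G * ?H"
        unfolding FX using cmD[OF cm(5)] by (simp only: mult.assoc cm_left_commute[OF cm(5)])
      finally show ?thesis unfolding dG by simp
    qed
    also have "?D2 * ?F * ?G * (?D3 * fps_deriv ?H) = - (?D2 * ?x * ?Y3 * ?F * ?G * ?H)"
      unfolding dH
      by (simp only: mult.assoc mult_minus_right cm_left_commute[OF cm(7)] cm_left_commute[OF cm(4)]
          cm_left_commute[OF cm(5)] cm_left_commute[OF cm(6)])
    also have "- (?x * ?Y2 * ?D3 * ?F * ?G * ?H) + - ((?D2 * ?X2 + ?t * ?x * ?Y2) * ?Y3 * ?F * ?G * ?H) +
        - (?D2 * ?x * ?Y3 * ?F * ?G * ?H) = ?A * (?F * ?G * ?H)"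
    proof -
      have "?x * ?Y2 * ?D3 + ?t * ?x * ?Y2 * ?Y3 = ?x * ?Y2"
        using cmD[OF cm_fps_X(2)[of "?x * ?Y2 * ?Y3"]]
        by (simp only: right_diff_distrib mult_1_right mult.assoc diff_add_cancel)
      then have "(?x * ?Y2 * ?D3 + ?t * ?x * ?Y2 * ?Y3) * (?F * ?G * ?H) = ?x * ?Y2 * (?F * ?G * ?H)" by simp
      then show ?thesis by (simp add: algebra_simps del: fps_const_mult)
    qed
    finally show "?B * fps_deriv (?F * ?G * ?H) = ?A * (?F * ?G * ?H)" .
    have "?B * fps_deriv (?G * ?K) = ?B * ?G * fps_deriv ?K + ?D2 * (?D3 * fps_deriv ?G) * ?K"
      unfolding fps_deriv_mult by (simp only: distrib_left mult.assoc)
    also have "?B * ?G * fps_deriv ?K = - (?x * (?Y2 * ?D3 + ?Y3) * ?G * ?K)"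
    proof -
      have "?B * ?G * fps_deriv ?K = - (?G * (?x * (?Y2 + ?Y3) * ?K))"
        unfolding key using dK by (simp only: mult.assoc mult_minus_right)
      also have "?G * (?x * (?Y2 + ?Y3) * ?K) = ?x * (?G * ?Y2 + ?G * ?Y3) * ?K"
        by (simp only: mult.assoc cm_left_commute[OF cm(4)] distrib_left distrib_right)
      finally show ?thesis unfolding GY cmD[OF cm(6), symmetric] by (simp only: mult.assoc distrib_left distrib_right)
    qed
    also have "\<dots> + ?D2 * (?D3 * fps_deriv ?G) * ?K = ?A * (?G * ?K)"
    proof -
      have "?x * (?Y2 * ?D3 + ?Y3) = ?x * ?Y2 + ?D2 * ?x * ?Y3"
      proof -
        have "?Y2 * ?t * (?x * ?Y3) = ?x * ?Y2 * (?Y3 * ?t)"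
          using cmD[OF cm_fps_X(2)[of "?x * ?Y3"]] by (simp only: mult.assoc cm_left_commute[OF cm(12)])
        then show ?thesis
          by (simp only: distrib_left right_diff_distrib left_diff_distrib mult_1_left mult_1_right mult.assoc)
            (simp only: add_diff_eq diff_add_eq)
      qed
      then show ?thesis unfolding dG
        by (simp only: mult_minus_left mult_minus_right mult.assoc[symmetric] distrib_right minus_add_distrib)
          (simp only: add.assoc add.commute add.left_commute)
    qed
    finally show "?B * fps_deriv (?G * ?K) = ?A * (?G * ?K)" .
  qed
  then show ?thesis using pwc_add[of X2 Y3 X1] sym by (simp add: add.commute mult.assoc)
qed

context calg
begin

section \<open>The twist with one tensor leg replaced by its antipode\<close>

lemma bin_conj:
  assumes "V' * V = 1" "V * V' = 1" shows "bin sc (V * x * V') n = V * bin sc x n * V'"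
proof -
  have e: "V' * (V * z) = z" for z using assms(1) by (simp add: mult.assoc[symmetric])
  have "fall (V * x * V') n = V * fall x n * V'"
  proof (induction n)
    case (Suc n)
    have "V * of_nat n * V' = of_nat n"
      by (simp add: mult_of_nat_commute[of n V, symmetric] mult.assoc assms(2))
    then have "V * x * V' - of_nat n = V * (x - of_nat n) * V'"
      by (simp add: right_diff_distrib left_diff_distrib)
    then show ?case using Suc.IH e by (simp add: mult.assoc)
  qed (use assms in simp)
  then show ?thesis by (simp add: bin_def sc_left_commute[of V] mult.assoc)
qed

lemma power_conj:
  assumes "V' * V = 1" "V * V' = (1::'b)" shows "(V * x * V') ^ n = V * x ^ n * V'"
proof (induction n)
  case (Suc n)
  have "V' * (V * z) = z" for z using assms(1) by (simp add: mult.assoc[symmetric])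
  then show ?case using Suc by (simp add: mult.assoc)
qed (use assms in simp)

end

lemma (in calg) pw_conj:
  assumes V: "V' * V = 1" "V * V' = 1"
  shows "pw sc (V * Z * V') (V * x * V') = V * pw sc Z x * V'"
proof -
  interpret F: calg "fsc sc" by (rule calg_fps)
  have e: "V' * (V * z) = z" for z using V(1) by (simp add: mult.assoc[symmetric])
  have c: "cm V ((- 1) ^ n)" for n by (intro cm_intros)
  show ?thesis unfolding pw_def tsum_mult_left[symmetric] tsum_mult_right[symmetric]
      F.bin_conj[OF V] F.power_conj[OF V]
    by (simp add: mult.assoc e cm_left_commute[OF c])
qed

context calg_XY
begin

text \<open>With S(X) = - u X u^-1 this is (S \<otimes> id)(F) followed by multiplication. After u
  is pulled out on the left, the binomial coefficients of -X and of X, the latter from u^-1,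
  convolve to those of 0.\<close>

lemma pw_antipode_left: "pw sc (fps_const Y) (u * fps_const (- X) * ui) = u"
proof -
  interpret F: calg "fsc sc" by (rule calg_fps)
  have cu: "cm u ((- 1) ^ j)" for j by (intro cm_intros)
  have "tsum (\<lambda>j. fps_const ((-1) ^ j * bin sc (- X) j) * ui * fps_const (Y ^ j)) = 1"
  proof (rule fps_ext)
    fix n
    have "tsum (\<lambda>j. fps_const ((-1) ^ j * bin sc (- X) j) * ui * fps_const (Y ^ j)) $ n =
        (\<Sum>j\<le>n. (-1) ^ n * (bin sc (- X) j * bin sc X (n - j)) * Y ^ n)"
      unfolding tsum_def fps_nth_Abs_fps
    proof (intro sum.cong refl)
      fix j assume "j \<in> {..n}"
      then obtain k where n: "n = j + k" using le_Suc_ex by auto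
      have c: "cm (bin sc (- X) j) ((-1) ^ k)" by (auto intro!: cm_intros)
      show "(fps_const ((-1) ^ j * bin sc (- X) j) * ui * fps_const (Y ^ j)) $ (n - j) =
          (-1) ^ n * (bin sc (- X) j * bin sc X (n - j)) * Y ^ n"
        unfolding n
        by (simp add: ui_nth mult.assoc cm_left_commute[OF c] power_add)
          (simp only: power_add[symmetric] add.commute)
    qed
    also have "\<dots> = (-1) ^ n * bin sc (- X + X) n * Y ^ n"
      by (subst bin_vandermonde[symmetric]) (auto intro!: cm_intros simp: sum_distrib_left sum_distrib_right)
    also have "\<dots> = (1 :: 'b fps) $ n" by (cases n) (simp_all add: bin_def fall_Suc_left del: fall.simps(2))
    finally show "tsum (\<lambda>j. fps_const ((-1) ^ j * bin sc (- X) j) * ui * fps_const (Y ^ j)) $ n = (1 :: 'b fps) $ n" .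
  qed
  moreover have "pw sc (fps_const Y) (u * fps_const (- X) * ui) =
      u * tsum (\<lambda>j. fps_const ((-1) ^ j * bin sc (- X) j) * ui * fps_const (Y ^ j))"
    unfolding pw_def F.bin_conj[OF u_ui(2) u_ui(1)] tsum_mult_left[symmetric] bin_fps_const
    by (simp add: mult.assoc fps_const_power flip: fps_const_mult fps_neg1_power)
      (simp add: mult.assoc cm_left_commute[OF cu] flip: fps_const_mult)
  ultimately show ?thesis by simp
qed

text \<open>The counterpart for (id \<otimes> S)(F^-1): powers of S(Y) = - u Y u^-1 release u^-1 on
  the right, and the rest collapses by the same convolution.\<close>

lemma pw_antipode_right: "pw sc (u * fps_const (- Y) * ui) (fps_const (- X)) = ui"
proof -
  interpret F: calg "fsc sc" by (rule calg_fps)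
  have "tsum (\<lambda>j. fps_const (bin sc (- X) j) * u * fps_const (Y ^ j)) = 1"
  proof (rule fps_ext)
    fix n
    have "tsum (\<lambda>j. fps_const (bin sc (- X) j) * u * fps_const (Y ^ j)) $ n =
        (\<Sum>j\<le>n. bin sc (- X) j * bin sc X (n - j) * Y ^ n)"
      unfolding tsum_def fps_nth_Abs_fps
    proof (intro sum.cong refl)
      fix j assume "j \<in> {..n}"
      then obtain k where n: "n = j + k" using le_Suc_ex by auto
      show "(fps_const (bin sc (- X) j) * u * fps_const (Y ^ j)) $ (n - j) =
          bin sc (- X) j * bin sc X (n - j) * Y ^ n"
        unfolding n by (simp add: u_nth mult.assoc) (simp only: power_add[symmetric] add.commute)
    qed
    also have "\<dots> = bin sc (- X + X) n * Y ^ n"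
      by (subst bin_vandermonde[symmetric]) (auto intro!: cm_intros simp: sum_distrib_right)
    also have "\<dots> = (1 :: 'b fps) $ n" by (cases n) (simp_all add: bin_def fall_Suc_left del: fall.simps(2))
    finally show "tsum (\<lambda>j. fps_const (bin sc (- X) j) * u * fps_const (Y ^ j)) $ n = (1 :: 'b fps) $ n" .
  qed
  moreover have "pw sc (u * fps_const (- Y) * ui) (fps_const (- X)) =
      tsum (\<lambda>j. fps_const (bin sc (- X) j) * u * fps_const (Y ^ j)) * ui"
  proof -
    have "(-1) ^ j * fps_const (bin sc (- X) j) * (u * fps_const ((- Y) ^ j) * ui) =
        fps_const (bin sc (- X) j) * u * fps_const (Y ^ j) * ui" for j
    proof -
      define s :: "'b fps" where "s = (-1) ^ j"
      have ss: "s * (s * z) = z" for z by (simp add: s_def mult.assoc[symmetric] flip: power_add)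
      have cs: "cm z s" for z unfolding s_def by (intro cm_intros)
      have "fps_const ((- Y) ^ j) = s * fps_const (Y ^ j)"
        by (simp add: s_def fps_neg1_power power_minus[of Y])
      then show ?thesis unfolding s_def[symmetric]
        by (simp only: mult.assoc cm_left_commute[OF cs, of u] cm_left_commute[OF cs, of "fps_const z" for z] ss)
    qed
    then show ?thesis
      unfolding pw_def F.power_conj[OF u_ui(2) u_ui(1)] tsum_mult_right[symmetric] bin_fps_const
        fps_const_power by simp
  qed
  ultimately show ?thesis by simp
qed

end

section \<open>Density modules\<close>

lemma qbin_0 [simp]: "qbin a c 0 = 1" by (simp add: qbin_def)

lemma qbin_Suc: "of_nat (Suc r) * qbin a c (Suc r) = qbin a c r * (a - of_nat r * c)"
  for a c :: "'a::field_char_0"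
  using of_nat_neq_0[of r, where 'a = 'a] by (simp add: qbin_def divide_simps del: of_nat_Suc)

lemma qbin_Suc_left: "of_nat (Suc r) * qbin a c (Suc r) = a * qbin (a - c) c r"
  for a c :: "'a::field_char_0"
  using of_nat_neq_0[of r, where 'a = 'a] unfolding qbin_def prod.lessThan_Suc_shift
  by (simp add: divide_simps diff_diff_eq distrib_right del: of_nat_Suc) (simp add: algebra_simps)

lemma qbin_mult: "qbin a c p * qbin (a - of_nat p * c) c q = of_nat ((p + q) choose p) * qbin a c (p + q)"
  for a c :: "'a::field_char_0"
proof -
  have "(\<Prod>j<p + q. a - of_nat j * c) = (\<Prod>j<p. a - of_nat j * c) * (\<Prod>j<q. a - of_nat p * c - of_nat j * c)"
    by (induction q) (simp_all add: algebra_simps)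
  moreover have "of_nat ((p + q) choose p) = (fact (p + q) / (fact p * fact q) :: 'a)"
    using binomial_fact[of p "p + q", where 'a = 'a] by simp
  ultimately show ?thesis by (simp add: qbin_def)
qed

text \<open>The weight \<mu> unites the two families of coefficients, so even and odd generators
  share every later argument.\<close>

definition gco :: "'a::field_char_0 \<Rightarrow> 'a \<Rightarrow> nat \<Rightarrow> nat \<Rightarrow> 'a \<Rightarrow> 'a" where
  "gco \<mu> M s r k = (\<Sum>p\<le>s. (-1) ^ p * qbin (k + \<mu> * M) M p
      * qbin (k + (of_nat r - of_nat p - 1 - \<mu>) * M) M r
      * qbin (k + (of_nat r - of_nat p + \<mu>) * M) M (s - p))"

lemma coef_a_eq_gco: "coef_a m s r i = gco 1 (of_int m) s r (of_int i)"
  by (simp add: coef_a_def gco_def)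

lemma coef_b_eq_gco: "coef_b m s r k = gco (1 / 2) (of_int m) s r k"
  unfolding coef_b_def gco_def by (intro sum.cong refl) (simp add: algebra_simps)

text \<open>The three terms on the right correspond to L_m, L_0 and L_(-m) in Y. Their coefficients
  depend on x and q only through x - q M, which is what allows summation in
  \<open>gco_recursion\<close>.\<close>

lemma qbin_recursion:
  fixes x M \<mu> :: "'a::field_char_0"
  defines "C \<equiv> \<lambda>x q. qbin (x + \<mu> * M) M q"
  shows "(x - \<mu> * M) * C (x + M) q = (x - of_nat q * M - \<mu> * M) * C x q
    + 2 * M * (x - of_nat q * M + M) * (if q = 0 then 0 else C x (q - 1))
    + M\<^sup>2 * (x - of_nat q * M + 2 * M + \<mu> * M) * (if q < 2 then 0 else C x (q - 2))"
proof -
  consider "q = 0" | "q = 1" | n where "q = Suc (Suc n)" by (metis One_nat_def not0_implies_Suc)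
  then show ?thesis
  proof cases
    case 1
    then show ?thesis by (simp add: C_def)
  next
    case 2
    have "C y 1 = y + \<mu> * M" for y using qbin_Suc[of 0 "y + \<mu> * M" M] by (simp add: C_def)
    then show ?thesis using 2 by (simp add: C_def) (simp add: algebra_simps power2_eq_square)
  next
    case 3
    \<comment> \<open>All values are compared through C x (n + 1), to which \<open>a\<close>,
      \<open>b\<close> and \<open>c\<close> tie the other three; the factor n1 + 1 = n + 2 is
      cancelled at the end.\<close>
    define P1 where "P1 = C x (Suc n)"
    define n1 where "n1 = (of_nat (Suc n) :: 'a)"
    have n2: "of_nat (Suc (Suc n)) = n1 + 1" and nn: "of_nat n = n1 - 1" by (simp_all add: n1_def)
    have n0: "n1 + 1 \<noteq> 0" unfolding n2[symmetric] by (rule of_nat_neq_0)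
    have a: "n1 * P1 = C x n * (x + \<mu> * M - (n1 - 1) * M)"
      using qbin_Suc[of n "x + \<mu> * M" M] unfolding nn n1_def[symmetric] by (simp add: C_def P1_def)
    have b: "(n1 + 1) * C x (Suc (Suc n)) = P1 * (x + \<mu> * M - n1 * M)"
      using qbin_Suc[of "Suc n" "x + \<mu> * M" M] unfolding n2 n1_def[symmetric] by (simp add: C_def P1_def)
    have c: "(n1 + 1) * C (x + M) (Suc (Suc n)) = (x + M + \<mu> * M) * P1"
      using qbin_Suc_left[of "Suc n" "x + M + \<mu> * M" M] unfolding n2 by (simp add: C_def P1_def)
    have "(n1 + 1) * ((x - \<mu> * M) * C (x + M) q) = (x - \<mu> * M) * ((x + M + \<mu> * M) * P1)"
      unfolding c[symmetric] 3 by (simp add: algebra_simps)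
    also have "\<dots> = (x - (n1 + 1) * M - \<mu> * M) * (P1 * (x + \<mu> * M - n1 * M))
        + 2 * M * (n1 + 1) * (x - (n1 + 1) * M + M) * P1 + M\<^sup>2 * (n1 + 1) * (n1 * P1)"
      by (simp add: algebra_simps power2_eq_square)
    also have "\<dots> = (x - (n1 + 1) * M - \<mu> * M) * ((n1 + 1) * C x (Suc (Suc n)))
        + 2 * M * (n1 + 1) * (x - (n1 + 1) * M + M) * P1 + M\<^sup>2 * (n1 + 1) * (C x n * (x + \<mu> * M - (n1 - 1) * M))"
      unfolding a b ..
    also have "\<dots> = (n1 + 1) * ((x - (n1 + 1) * M - \<mu> * M) * C x (Suc (Suc n))
        + 2 * M * (x - (n1 + 1) * M + M) * P1 + M\<^sup>2 * (x - (n1 + 1) * M + 2 * M + \<mu> * M) * C x n)"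
      by (simp add: algebra_simps)
    finally show ?thesis using n0 3 unfolding n2[symmetric] by (simp add: P1_def del: of_nat_Suc)
  qed
qed

text \<open>Holds term by term: for q = s - p the quantity x_p - q M is the same for all p, so the
  coefficients leave the sum. It says how ad Y changes the coordinates of a divided power of ad
  Y.\<close>

lemma gco_recursion:
  fixes k M \<mu> :: "'a::field_char_0"
  shows "of_nat (Suc r) * gco \<mu> M s (Suc r) k =
      (k + (of_nat r - of_nat s) * M - \<mu> * M) * gco \<mu> M s r k
    + 2 * M * (k + (of_nat r - of_nat s) * M + M) * (if s = 0 then 0 else gco \<mu> M (s - 1) r k)
    + M\<^sup>2 * (k + (of_nat r - of_nat s) * M + 2 * M + \<mu> * M) * (if s < 2 then 0 else gco \<mu> M (s - 2) r k)"
proof -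
  define x where "x p = k + (of_nat r - of_nat p) * M" for p
  define t where "t p = (-1) ^ p * qbin (k + \<mu> * M) M p * qbin (x p - M - \<mu> * M) M r" for p
  define C where "C y q = qbin (y + \<mu> * M) M q" for y q
  have g: "gco \<mu> M s r k = (\<Sum>p\<le>s. t p * C (x p) (s - p))" for s
    unfolding gco_def t_def C_def x_def
    by (intro sum.cong refl arg_cong2[of _ _ _ _ times] arg_cong[of _ _ "\<lambda>y. qbin y M _"]) (simp_all add: algebra_simps)
  have t: "of_nat (Suc r) * qbin (k + (of_nat (Suc r) - of_nat p - 1 - \<mu>) * M) M (Suc r) =
      (x p - \<mu> * M) * qbin (x p - M - \<mu> * M) M r" for p
  proof -
    have "k + (of_nat (Suc r) - of_nat p - 1 - \<mu>) * M = x p - \<mu> * M" by (simp add: x_def algebra_simps)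
    then show ?thesis by (simp only: qbin_Suc_left) (simp add: diff_diff_eq add.commute)
  qed
  have c: "qbin (k + (of_nat (Suc r) - of_nat p + \<mu>) * M) M q = C (x p + M) q" for p q
    unfolding C_def x_def by (rule arg_cong[of _ _ "\<lambda>y. qbin y M q"]) (simp add: algebra_simps)
  have "of_nat (Suc r) * gco \<mu> M s (Suc r) k =
      (\<Sum>p\<le>s. (-1) ^ p * qbin (k + \<mu> * M) M p *
        (of_nat (Suc r) * qbin (k + (of_nat (Suc r) - of_nat p - 1 - \<mu>) * M) M (Suc r)) * C (x p + M) (s - p))"
    unfolding gco_def c sum_distrib_left by (intro sum.cong refl) (simp only: mult_ac)
  also have "\<dots> = (\<Sum>p\<le>s. t p * ((x p - \<mu> * M) * C (x p + M) (s - p)))"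
    unfolding t t_def by (intro sum.cong refl) (simp only: mult_ac)
  also have "\<dots> = (\<Sum>p\<le>s. (k + (of_nat r - of_nat s) * M - \<mu> * M) * (t p * C (x p) (s - p))
      + 2 * M * (k + (of_nat r - of_nat s) * M + M) * (t p * (if s - p = 0 then 0 else C (x p) (s - p - 1)))
      + M\<^sup>2 * (k + (of_nat r - of_nat s) * M + 2 * M + \<mu> * M) * (t p * (if s - p < 2 then 0 else C (x p) (s - p - 2))))"
  proof (intro sum.cong refl)
    fix p assume "p \<in> {..s}"
    then have x: "x p - of_nat (s - p) * M = k + (of_nat r - of_nat s) * M"
      by (simp add: x_def of_nat_diff algebra_simps)
    show "t p * ((x p - \<mu> * M) * C (x p + M) (s - p)) =
      (k + (of_nat r - of_nat s) * M - \<mu> * M) * (t p * C (x p) (s - p))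
      + 2 * M * (k + (of_nat r - of_nat s) * M + M) * (t p * (if s - p = 0 then 0 else C (x p) (s - p - 1)))
      + M\<^sup>2 * (k + (of_nat r - of_nat s) * M + 2 * M + \<mu> * M) * (t p * (if s - p < 2 then 0 else C (x p) (s - p - 2)))"
      using qbin_recursion[of "x p" \<mu> M "s - p"] unfolding x C_def[symmetric]
      by (simp only: distrib_left mult_ac)
  qed
  also have "\<dots> = (k + (of_nat r - of_nat s) * M - \<mu> * M) * gco \<mu> M s r k
    + 2 * M * (k + (of_nat r - of_nat s) * M + M) * (\<Sum>p\<le>s. t p * (if s - p = 0 then 0 else C (x p) (s - p - 1)))
    + M\<^sup>2 * (k + (of_nat r - of_nat s) * M + 2 * M + \<mu> * M) * (\<Sum>p\<le>s. t p * (if s - p < 2 then 0 else C (x p) (s - p - 2)))"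
    unfolding g sum.distrib sum_distrib_left ..
  also have "(\<Sum>p\<le>s. t p * (if s - p = 0 then 0 else C (x p) (s - p - 1))) = (if s = 0 then 0 else gco \<mu> M (s - 1) r k)"
  proof (cases s)
    case (Suc n)
    then show ?thesis by (simp add: g Suc_diff_le)
  qed simp
  also have "(\<Sum>p\<le>s. t p * (if s - p < 2 then 0 else C (x p) (s - p - 2))) = (if s < 2 then 0 else gco \<mu> M (s - 2) r k)"
  proof (cases "s < 2")
    case False
    then obtain n where "s = Suc (Suc n)" by (metis add_2_eq_Suc le_Suc_ex not_less)
    then show ?thesis by (simp add: g Suc_diff_le)
  qed (auto intro!: sum.neutral)
  finally show ?thesis .
qed

text \<open>The outer factors multiply to s choose p times a value free of p, and an alternating sum
  of binomial coefficients remains.\<close>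

lemma gco_0: "gco \<mu> M s 0 k = (if s = 0 then 1 else 0)"
proof -
  have "gco \<mu> M s 0 k = (\<Sum>p\<le>s. (-1) ^ p * of_nat (s choose p) * qbin (k + \<mu> * M) M s)"
    unfolding gco_def
  proof (intro sum.cong refl)
    fix p assume p: "p \<in> {..s}"
    have e: "k + (of_nat 0 - of_nat p + \<mu>) * M = k + \<mu> * M - of_nat p * M" by (simp add: algebra_simps)
    have "qbin (k + \<mu> * M) M p * qbin (k + \<mu> * M - of_nat p * M) M (s - p) =
        of_nat (s choose p) * qbin (k + \<mu> * M) M s"
      unfolding qbin_mult using p by simp
    then show "(-1) ^ p * qbin (k + \<mu> * M) M p * qbin (k + (of_nat 0 - of_nat p - 1 - \<mu>) * M) M 0
        * qbin (k + (of_nat 0 - of_nat p + \<mu>) * M) M (s - p) = (-1) ^ p * of_nat (s choose p) * qbin (k + \<mu> * M) M s"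
      unfolding e by (simp only: mult.assoc qbin_0 mult_1_left)
  qed
  also have "\<dots> = (if s = 0 then 1 else 0)"
    using choose_alternating_sum[of s, where 'a = 'a] by (auto simp flip: sum_distrib_right)
  finally show ?thesis .
qed

text \<open>Each increase of r reaches two more values of s. Hence the range up to 2r in the
  formulas omits nothing, and sums may be extended without boundary terms.\<close>

lemma gco_eq_0: "s > 2 * r \<Longrightarrow> gco \<mu> M s r k = 0"
proof (induction r arbitrary: s)
  case (Suc r)
  have "of_nat (Suc r) * gco \<mu> M s (Suc r) k = 0"
    unfolding gco_recursion using Suc by simp
  then show ?case using of_nat_neq_0[of r, where 'a = 'a] by (simp del: of_nat_Suc)
qed (simp add: gco_0)

section \<open>X and Y acting on a density module\<close>

definition Xel :: "('a::field_char_0 \<Rightarrow> 'b::ring_1) \<Rightarrow> int \<Rightarrow> 'a \<Rightarrow> (int \<Rightarrow> 'b) \<Rightarrow> 'b" where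
  "Xel sc m \<alpha> L = sc (1 / of_int m) * (L 0 + sc (\<alpha> * of_int m) * L (- m))"

definition Yel :: "('a::field_char_0 \<Rightarrow> 'b::ring_1) \<Rightarrow> int \<Rightarrow> 'a \<Rightarrow> (int \<Rightarrow> 'b) \<Rightarrow> 'b" where
  "Yel sc m \<alpha> L = L m + (sc (2 * \<alpha> * of_int m) * L 0 + sc (\<alpha>\<^sup>2 * (of_int m)\<^sup>2) * L (- m))"

text \<open>A density module of weight \<open>\<mu>\<close>: the even part of the superalgebra has \<open>\<mu> = 1\<close>,
the odd part has \<open>\<mu> = 1/2\<close>, and index \<open>j\<close> stands for the degree \<open>\<kappa> + j\<close>.\<close>
locale weights = calg sc for sc :: "'a::field_char_0 \<Rightarrow> 'b::ring_1" +
  fixes L v :: "int \<Rightarrow> 'b" and \<kappa> \<mu> \<alpha> :: 'a and m :: int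
  assumes wt: "L i * v j - v j * L i = sc (\<kappa> + of_int j - \<mu> * of_int i) * v (i + j)"
    and m: "m \<noteq> 0"
begin

abbreviation "M \<equiv> of_int m :: 'a"
abbreviation "X \<equiv> Xel sc m \<alpha> L"
abbreviation "Y \<equiv> Yel sc m \<alpha> L"

lemma M_neq_0: "M \<noteq> 0" using m by simp

lemma bracket_sc: "a * (sc c * b) - (sc c * b) * a = sc c * (a * b - b * a)"
  by (simp add: right_diff_distrib mult.assoc sc_left_commute[of a])

lemma sc_bracket: "(sc c * a) * b - b * (sc c * a) = sc c * (a * b - b * a)"
  by (simp add: right_diff_distrib mult.assoc sc_left_commute[of b])

lemma bracket_add: "(a + b) * c - c * (a + b) = (a * c - c * a) + (b * c - c * b)" for a b c :: 'b
  by (simp add: algebra_simps)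

lemma X_v: "X * v j - v j * X = sc ((\<kappa> + of_int j) / M) * v j + sc (\<alpha> * (\<kappa> + of_int j + \<mu> * M)) * v (j - m)"
proof -
  have "X * v j - v j * X = sc (1 / M) * (sc (\<kappa> + of_int j) * v j + sc (\<alpha> * M) * (sc (\<kappa> + of_int j + \<mu> * M) * v (j - m)))"
    unfolding Xel_def sc_bracket bracket_add wt by simp
  also have "\<dots> = sc (1 / M * (\<kappa> + of_int j)) * v j + sc (1 / M * (\<alpha> * M) * (\<kappa> + of_int j + \<mu> * M)) * v (j - m)"
    by (simp only: distrib_left[of "sc x" for x] sc_mult mult.assoc)
  also have "1 / M * (\<alpha> * M) = \<alpha>" using M_neq_0 by simp
  finally show ?thesis by simp
qed

lemma Y_v: "Y * v j - v j * Y = sc (\<kappa> + of_int j - \<mu> * M) * v (j + m)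
    + sc (2 * \<alpha> * M * (\<kappa> + of_int j)) * v j + sc (\<alpha>\<^sup>2 * M\<^sup>2 * (\<kappa> + of_int j + \<mu> * M)) * v (j - m)"
  unfolding Yel_def bracket_add sc_bracket wt
  by (simp add: sc_mult mult.assoc add.assoc add.commute[of m j])

text \<open>\<open>lower j r\<close> is the \<open>r\<close>-th term of \<open>exp (-\<alpha> ad L\<^sub>-\<^sub>m) v\<^sub>j\<close>, and \<open>adY j r\<close> is \<open>(ad Y)\<^sup>r v\<^sub>j / r!\<close>.\<close>
definition lower :: "int \<Rightarrow> nat \<Rightarrow> 'b" where
  "lower j r = sc (\<alpha> ^ r * qbin ((of_nat r - 1 - \<mu>) * M - (\<kappa> + of_int j)) M r) * v (j - int r * m)"

lemma lower_0 [simp]: "lower j 0 = v j" by (simp add: lower_def)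

text \<open>The L_0 part of X multiplies by the degree divided by m; the L_(-m) part goes one step
  down, with the factor - (r + 1) due to the divided normalisation. This is the hypothesis of
  \<open>conj_first\<close>.\<close>

lemma X_lower: "X * lower j r - lower j r * X =
  sc ((\<kappa> + of_int j) / M - of_nat r) * lower j r - of_nat (Suc r) * lower j (Suc r)"
proof -
  define k where "k = \<kappa> + of_int j"
  define q where "q r = qbin ((of_nat r - 1 - \<mu>) * M - k) M r" for r
  have k: "\<kappa> + of_int (j - int r * m) = k - of_nat r * M" by (simp add: k_def)
  have j: "j - int r * m - m = j - int (Suc r) * m" by (simp add: algebra_simps)
  have s1: "of_nat (Suc r) * q (Suc r) = - (k - of_nat r * M + \<mu> * M) * q r"
  proof -
    have "(of_nat (Suc r) - 1 - \<mu>) * M - k = - (k - of_nat r * M + \<mu> * M)"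
      "- (k - of_nat r * M + \<mu> * M) - M = (of_nat r - 1 - \<mu>) * M - k" by (simp_all add: algebra_simps)
    then show ?thesis unfolding q_def by (simp only: qbin_Suc_left)
  qed
  have "X * lower j r - lower j r * X = sc (\<alpha> ^ r * q r) *
      (sc ((k - of_nat r * M) / M) * v (j - int r * m) + sc (\<alpha> * (k - of_nat r * M + \<mu> * M)) * v (j - int (Suc r) * m))"
    unfolding lower_def bracket_sc X_v k j q_def k_def ..
  also have "\<dots> = sc ((k - of_nat r * M) / M) * lower j r
      - sc (\<alpha> * \<alpha> ^ r * (- (k - of_nat r * M + \<mu> * M) * q r)) * v (j - int (Suc r) * m)"
  proof -
    have e: "\<alpha> * \<alpha> ^ r * (- (k - of_nat r * M + \<mu> * M) * q r) = - (\<alpha> ^ r * q r * (\<alpha> * (k - of_nat r * M + \<mu> * M)))"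
      by (simp only: mult_ac mult_minus_left mult_minus_right)
    show ?thesis unfolding e sc_minus lower_def k_def[symmetric] q_def[symmetric]
      by (simp only: distrib_left[of "sc x" for x] mult.assoc[symmetric] sc_mult[symmetric] mult_minus_left diff_minus_eq_add)
        (simp only: mult_ac)
  qed
  also have "sc (\<alpha> * \<alpha> ^ r * (- (k - of_nat r * M + \<mu> * M) * q r)) * v (j - int (Suc r) * m) = of_nat (Suc r) * lower j (Suc r)"
    unfolding s1[symmetric] lower_def k_def[symmetric] q_def[symmetric] sc_of_nat[symmetric] mult.assoc[symmetric] sc_mult[symmetric]
    by (simp add: mult_ac)
  also have "(k - of_nat r * M) / M = k / M - of_nat r" using M_neq_0 by (simp add: diff_divide_distrib)
  finally show ?thesis by (simp only: k_def)
qed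

definition adY :: "int \<Rightarrow> nat \<Rightarrow> 'b" where
  "adY j r = (\<Sum>s\<le>2*r. sc (\<alpha> ^ s * gco \<mu> M s r (\<kappa> + of_int j)) * v (j + (int r - int s) * m))"

lemma adY_0 [simp]: "adY j 0 = v j" by (simp add: adY_def gco_0)

text \<open>Relative to the degree j + (r + 1 - s) m, the summands of Y shift s by 0, 1 and 2;
  \<open>gco_recursion\<close> collects the three contributions.\<close>

lemma adY_Suc: "of_nat (Suc r) * adY j (Suc r) = Y * adY j r - adY j r * Y"
proof -
  define k where "k = \<kappa> + of_int j"
  define g where "g s = gco \<mu> M s r k" for s
  define w where "w s = v (j + (int (Suc r) - int s) * m)" for s
  define z where "z s = k + (of_nat r - of_nat s) * M" for s
  define N where "N = 2 * r"
  have kz: "\<kappa> + of_int (j + (int r - int s) * m) = z s" for s by (simp add: z_def k_def)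
  have Yv: "Y * v (j + (int r - int s) * m) - v (j + (int r - int s) * m) * Y =
      sc (z s - \<mu> * M) * w s + sc (2 * \<alpha> * M * z s) * w (Suc s) + sc (\<alpha>\<^sup>2 * M\<^sup>2 * (z s + \<mu> * M)) * w (Suc (Suc s))" for s
  proof -
    have e: "j + (int r - int s) * m + m = j + (int (Suc r) - int s) * m"
      "j + (int (Suc r) - int (Suc s)) * m = j + (int r - int s) * m"
      "j + (int r - int s) * m - m = j + (int (Suc r) - int (Suc (Suc s))) * m" by (simp_all add: algebra_simps)
    show ?thesis by (simp only: Y_v kz w_def e)
  qed
  have z1: "z s = z (Suc s) + M" and z2: "z s = z (Suc (Suc s)) + 2 * M" for s
    by (simp_all add: z_def algebra_simps)
  have "Y * adY j r - adY j r * Y = (\<Sum>s\<le>N. sc (\<alpha> ^ s * g s) * (Y * v (j + (int r - int s) * m) - v (j + (int r - int s) * m) * Y))"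
    unfolding adY_def N_def g_def k_def sum_distrib_left sum_distrib_right sum_subtractf[symmetric] bracket_sc ..
  also have "\<dots> = (\<Sum>s\<le>N. sc (\<alpha> ^ s * (g s * (z s - \<mu> * M))) * w s)
      + (\<Sum>s\<le>N. sc (\<alpha> ^ Suc s * (2 * M * (z (Suc s) + M) * g s)) * w (Suc s))
      + (\<Sum>s\<le>N. sc (\<alpha> ^ Suc (Suc s) * (M\<^sup>2 * (z (Suc (Suc s)) + 2 * M + \<mu> * M) * g s)) * w (Suc (Suc s)))"
    unfolding Yv sum.distrib[symmetric] z1[symmetric] z2[symmetric]
  proof (intro sum.cong refl)
    fix s
    have "\<alpha> ^ s * g s * (z s - \<mu> * M) = \<alpha> ^ s * (g s * (z s - \<mu> * M))"
      "\<alpha> ^ s * g s * (2 * \<alpha> * M * z s) = \<alpha> ^ Suc s * (2 * M * z s * g s)"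
      "\<alpha> ^ s * g s * (\<alpha>\<^sup>2 * M\<^sup>2 * (z s + \<mu> * M)) = \<alpha> ^ Suc (Suc s) * (M\<^sup>2 * (z s + \<mu> * M) * g s)"
      by (simp_all add: power2_eq_square mult_ac)
    then show "sc (\<alpha> ^ s * g s) * (sc (z s - \<mu> * M) * w s + sc (2 * \<alpha> * M * z s) * w (Suc s)
          + sc (\<alpha>\<^sup>2 * M\<^sup>2 * (z s + \<mu> * M)) * w (Suc (Suc s))) =
        sc (\<alpha> ^ s * (g s * (z s - \<mu> * M))) * w s + sc (\<alpha> ^ Suc s * (2 * M * z s * g s)) * w (Suc s)
          + sc (\<alpha> ^ Suc (Suc s) * (M\<^sup>2 * (z s + \<mu> * M) * g s)) * w (Suc (Suc s))"
      by (simp only: distrib_left[of "sc x" for x] mult.assoc[symmetric, of "sc x" "sc y" for x y] sc_mult[symmetric])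
  qed
  \<comment> \<open>The terms added at N + 1 and N + 2 vanish by \<open>gco_eq_0\<close>; they bring
    the three sums to a common range.\<close>
  also have "(\<Sum>s\<le>N. sc (\<alpha> ^ s * (g s * (z s - \<mu> * M))) * w s) =
      (\<Sum>s\<le>Suc (Suc N). sc (\<alpha> ^ s * ((z s - \<mu> * M) * g s)) * w s)"
    by (simp add: g_def gco_eq_0 N_def mult.commute)
  also have "(\<Sum>s\<le>N. sc (\<alpha> ^ Suc s * (2 * M * (z (Suc s) + M) * g s)) * w (Suc s)) =
      (\<Sum>s\<le>Suc (Suc N). sc (\<alpha> ^ s * (2 * M * (z s + M) * (if s = 0 then 0 else g (s - 1)))) * w s)"
    by (subst sum.atMost_Suc_shift) (simp add: g_def gco_eq_0 N_def)
  also have "(\<Sum>s\<le>N. sc (\<alpha> ^ Suc (Suc s) * (M\<^sup>2 * (z (Suc (Suc s)) + 2 * M + \<mu> * M) * g s)) * w (Suc (Suc s))) =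
      (\<Sum>s\<le>Suc (Suc N). sc (\<alpha> ^ s * (M\<^sup>2 * (z s + 2 * M + \<mu> * M) * (if s < 2 then 0 else g (s - 2)))) * w s)"
    by (subst sum.atMost_Suc_shift, subst sum.atMost_Suc_shift) simp
  also have "(\<Sum>s\<le>Suc (Suc N). sc (\<alpha> ^ s * ((z s - \<mu> * M) * g s)) * w s) +
      (\<Sum>s\<le>Suc (Suc N). sc (\<alpha> ^ s * (2 * M * (z s + M) * (if s = 0 then 0 else g (s - 1)))) * w s) + \<dots> =
      (\<Sum>s\<le>Suc (Suc N). sc (\<alpha> ^ s * (of_nat (Suc r) * gco \<mu> M s (Suc r) k)) * w s)"
    unfolding gco_recursion g_def z_def by (simp only: sum.distrib[symmetric] distrib_right[symmetric] sc_add[symmetric] distrib_left[symmetric])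
  also have "\<dots> = of_nat (Suc r) * adY j (Suc r)"
    unfolding adY_def sum_distrib_left sc_of_nat[symmetric] mult.assoc[symmetric] sc_mult[symmetric] w_def k_def N_def
    by (simp add: mult_ac)
  finally show ?thesis ..
qed

text \<open>Divided powers of ad Y on the chain \<open>lower\<close>; the sign (-1)^r turns the
  recursion of that chain into the one required by \<open>u_conj_formula\<close>.\<close>

definition adY_lower :: "int \<Rightarrow> nat \<Rightarrow> nat \<Rightarrow> 'b" where
  "adY_lower j p r = sc ((-1) ^ r * (\<alpha> ^ r * qbin ((of_nat r - 1 - \<mu>) * M - (\<kappa> + of_int j)) M r)) * adY (j - int r * m) p"

lemma adY_lower_0: "adY_lower j 0 r = (-1) ^ r * lower j r"
  by (simp add: adY_lower_def lower_def sc_mult sc_power sc_minus mult.assoc)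

lemma X_adY_lower: "X * adY_lower j 0 r - adY_lower j 0 r * X =
  sc ((\<kappa> + of_int j) / M - of_nat r) * adY_lower j 0 r + of_nat (Suc r) * adY_lower j 0 (Suc r)"
proof -
  have c: "(-1) ^ r = sc ((-1) ^ r)" by (simp add: sc_power)
  have "X * adY_lower j 0 r - adY_lower j 0 r * X = (-1) ^ r * (X * lower j r - lower j r * X)"
    unfolding adY_lower_0 c by (rule bracket_sc)
  also have "\<dots> = (-1) ^ r * (sc ((\<kappa> + of_int j) / M - of_nat r) * lower j r) - (-1) ^ r * (of_nat (Suc r) * lower j (Suc r))"
    unfolding X_lower by (rule right_diff_distrib)
  also have "\<dots> = sc ((\<kappa> + of_int j) / M - of_nat r) * adY_lower j 0 r + of_nat (Suc r) * adY_lower j 0 (Suc r)"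
    unfolding adY_lower_0 sc_left_commute[of "(-1) ^ r"] cm_left_commute[OF cm_simps(5), of "(-1) ^ r"] by simp
  finally show ?thesis .
qed

lemma adY_lower_Suc: "of_nat (Suc p) * adY_lower j (Suc p) r = Y * adY_lower j p r - adY_lower j p r * Y"
  unfolding adY_lower_def bracket_sc adY_Suc[symmetric]
  by (simp only: sc_left_commute[of "of_nat (Suc p)"])

end

section \<open>Representations of the defining relations\<close>

definition sv_rep :: "('a::field_char_0 \<Rightarrow> 'b::ring_1) \<Rightarrow> bool \<Rightarrow> (sv_gen \<Rightarrow> 'b) \<Rightarrow> bool" where
  "sv_rep sc h A \<longleftrightarrow>
    (\<forall>i j. A (Lg i) * A (Lg j) - A (Lg j) * A (Lg i) = sc (of_int (j - i)) * A (Lg (i + j))) \<and>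
    (\<forall>i j. A (Lg i) * A (Gg j) - A (Gg j) * A (Lg i) =
      sc (of_int j + eps_val h - of_int i / 2) * A (Gg (i + j))) \<and>
    (\<forall>j l. A (Gg j) * A (Gg l) + A (Gg l) * A (Gg j) = sc 2 * A (Lg (j + l + (if h then 1 else 0))))"

definition kills :: "('a::field_char_0 \<Rightarrow> 'b::ring_1) \<Rightarrow> ('g \<Rightarrow> 'b) \<Rightarrow> ('g,'a) fa set \<Rightarrow> bool" where
  "kills sc A R \<longleftrightarrow> (\<forall>r\<in>R. hv sc A r = 0)"

text \<open>The condition on the empty word is the one under which \<open>ev_eq_0_iff\<close>
  recognises the ideal.\<close>

definition good_rel :: "('g,'a::field_char_0) fa set \<Rightarrow> bool" where
  "good_rel R \<longleftrightarrow> (\<forall>r\<in>R. fa_fin r \<and> r [] = 0)"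

definition scomm :: "('g \<Rightarrow> bool) \<Rightarrow> ('h \<Rightarrow> bool) \<Rightarrow> ('g \<Rightarrow> 'b::ring_1) \<Rightarrow> ('h \<Rightarrow> 'b) \<Rightarrow> bool" where
  "scomm p1 p2 A B \<longleftrightarrow> (\<forall>a b. A a * B b = (if p1 a \<and> p2 b then -1 else 1) * (B b * A a))"

lemma fa_Nil_simps:
  "fa_diff f g [] = f [] - g []" "fa_smul c f [] = c * f []" "fa_gen x [] = (0::'a)" "fa_mult f g [] = f [] * g []"
  for f g :: "('g,'a::field) fa"
  by (simp_all add: fa_diff_def fa_smul_def fa_gen_def fa_word_def fa_mult_Nil)

lemma sv_br_fin: "fa_fin (sv_br h x y :: (sv_gen,'a::field_char_0) fa)"
  and sv_br_Nil: "sv_br h x y [] = (0::'a)"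
  by (induction h x y rule: sv_br.induct) (simp_all add: fa_Nil_simps)

lemma good_sv_rel: "good_rel (sv_rel h :: (sv_gen,'a::field_char_0) fa set)"
  by (auto simp: good_rel_def sv_rel_def sv_br_fin sv_br_Nil fa_Nil_simps)

lemma fa_rename_Nil: "fa_rename h f [] = f []"
  by (simp add: fa_rename_def)

lemma good_tens_rel:
  fixes R1 :: "('g,'a::field_char_0) fa set" and R2 :: "('h,'a) fa set"
  assumes "good_rel R1" "good_rel R2" shows "good_rel (tens_rel p1 R1 p2 R2)"
  using assms by (auto simp: good_rel_def tens_rel_def supcomm_def fa_Nil_simps fa_rename_Nil)

lemma good_sv_rel2: "good_rel (sv_rel2 h :: (_,'a::field_char_0) fa set)"
  and good_sv_rel3: "good_rel (sv_rel3 h :: (_,'a::field_char_0) fa set)"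
  by (simp_all add: sv_rel2_def sv_rel3_def good_tens_rel good_sv_rel)

context calg
begin

lemma kills_sv_rel: "kills sc A (sv_rel h) \<longleftrightarrow> sv_rep sc h A"
proof -
  define e where "e x y = (if sv_par x \<and> sv_par y then -1 else 1 :: 'a)" for x y
  have "kills sc A (sv_rel h) \<longleftrightarrow> (\<forall>x y. A x * A y - sc (e x y) * (A y * A x) = hv sc A (sv_br h x y))"
  proof -
    define rel :: "sv_gen \<Rightarrow> sv_gen \<Rightarrow> (sv_gen,'a) fa" where "rel x y =
      fa_diff (fa_diff (fa_mult (fa_gen x) (fa_gen y)) (fa_smul (e x y) (fa_mult (fa_gen y) (fa_gen x))))
        (sv_br h x y)" for x y
    have "sv_rel h = {rel x y | x y. True}" by (simp add: sv_rel_def rel_def e_def)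
    then have "kills sc A (sv_rel h) \<longleftrightarrow> (\<forall>x y. hv sc A (rel x y) = 0)" by (auto simp: kills_def)
    moreover have "hv sc A (rel x y) = A x * A y - sc (e x y) * (A y * A x) - hv sc A (sv_br h x y)" for x y
      by (simp add: rel_def lin_diff lin_smul hv_mult sv_br_fin)
    ultimately show ?thesis by simp
  qed
  also have "\<dots> \<longleftrightarrow> sv_rep sc h A"
  proof
    assume *: "\<forall>x y. A x * A y - sc (e x y) * (A y * A x) = hv sc A (sv_br h x y)"
    show "sv_rep sc h A"
      unfolding sv_rep_def
    proof (intro conjI allI)
      fix i j
      show "A (Lg i) * A (Lg j) - A (Lg j) * A (Lg i) = sc (of_int (j - i)) * A (Lg (i + j))"
        using *[rule_format, of "Lg i" "Lg j"] by (simp add: e_def lin_smul)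
      show "A (Lg i) * A (Gg j) - A (Gg j) * A (Lg i) = sc (of_int j + eps_val h - of_int i / 2) * A (Gg (i + j))"
        using *[rule_format, of "Lg i" "Gg j"] by (simp add: e_def lin_smul)
      show "A (Gg i) * A (Gg j) + A (Gg j) * A (Gg i) = sc 2 * A (Lg (i + j + (if h then 1 else 0)))"
        using *[rule_format, of "Gg i" "Gg j"] by (simp add: e_def lin_smul)
    qed
  next
    assume A: "sv_rep sc h A"
    show "\<forall>x y. A x * A y - sc (e x y) * (A y * A x) = hv sc A (sv_br h x y)"
    proof (intro allI)
      fix x y
      show "A x * A y - sc (e x y) * (A y * A x) = hv sc A (sv_br h x y)"
      proof (cases x; cases y)
        \<comment> \<open>\<open>sv_rep\<close> records the mixed bracket with L on the left only;
          the relation for G on the left is its negative.\<close>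
        fix i j assume xy: "x = Gg i" "y = Lg j"
        have "A y * A x - A x * A y = sc (of_int i + eps_val h - of_int j / 2) * A (Gg (j + i))"
          using A xy by (simp add: sv_rep_def)
        then have "A x * A y - A y * A x = - sc (of_int i + eps_val h - of_int j / 2) * A (Gg (j + i))"
          by (simp add: algebra_simps)
        moreover have "hv sc A (sv_br h x y) = sc (- (of_int i + eps_val h - of_int j / 2)) * A (Gg (j + i))"
          using xy by (simp add: lin_smul)
        ultimately show ?thesis using xy unfolding sc_minus by (simp add: e_def)
      qed (use A in \<open>auto simp: e_def lin_smul sv_rep_def\<close>)
    qed
  qed
  finally show ?thesis .
qed

lemma kills_tens_rel:
  assumes "good_rel R1" "good_rel R2"
  shows "kills sc A (tens_rel p1 R1 p2 R2) \<longleftrightarrow>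
    kills sc (A \<circ> Inl) R1 \<and> kills sc (A \<circ> Inr) R2 \<and> scomm p1 p2 (A \<circ> Inl) (A \<circ> Inr)"
proof -
  have 1: "hv sc A (fa_rename Inl r) = hv sc (A \<circ> Inl) r" if "r \<in> R1" for r
    using assms that by (simp add: hv_rename good_rel_def del: map_map)
  have 2: "hv sc A (fa_rename Inr r) = hv sc (A \<circ> Inr) r" if "r \<in> R2" for r
    using assms that by (simp add: hv_rename good_rel_def del: map_map)
  have 3: "hv sc A (supcomm p1 p2 a b) = A (Inl a) * A (Inr b) - (if p1 a \<and> p2 b then -1 else 1) * (A (Inr b) * A (Inl a))" for a b
    by (simp add: supcomm_def lin_diff lin_smul hv_mult)
  have "kills sc A (tens_rel p1 R1 p2 R2) \<longleftrightarrow> (\<forall>r\<in>R1. hv sc A (fa_rename Inl r) = 0) \<and>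
      (\<forall>r\<in>R2. hv sc A (fa_rename Inr r) = 0) \<and> (\<forall>a b. hv sc A (supcomm p1 p2 a b) = 0)"
    unfolding kills_def tens_rel_def by blast
  then show ?thesis unfolding kills_def scomm_def 3 using 1 2 by auto
qed

lemma kills_sv_rel2:
  "kills sc A (sv_rel2 h) \<longleftrightarrow> sv_rep sc h (A \<circ> Inl) \<and> sv_rep sc h (A \<circ> Inr) \<and> scomm sv_par sv_par (A \<circ> Inl) (A \<circ> Inr)"
  unfolding sv_rel2_def by (simp add: kills_tens_rel good_sv_rel kills_sv_rel)

end

lemma kills_qgen: "good_rel R \<Longrightarrow> kills qsc (qgen R) R"
  by (simp add: kills_def good_rel_def ev_eq_0_iff fa_ideal.rel)

lemma (in calg) hs_cong:
  assumes "good_rel R" "kills (fsc sc) A R" "ps_fin x" "ps_fin y" "evs R x = evs R y"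
  shows "hs sc A x = hs sc A y"
  using assms by (intro hs_cong_evs[of x y R]) (auto simp: good_rel_def kills_def)

lemma (in calg) weights_L:
  assumes "sv_rep sc h A" "m \<noteq> 0" shows "weights sc (A \<circ> Lg) (A \<circ> Lg) 0 1 m"
  using assms by unfold_locales (auto simp: sv_rep_def)

lemma (in calg) weights_G:
  assumes "sv_rep sc h A" "m \<noteq> 0" shows "weights sc (A \<circ> Lg) (A \<circ> Gg) (eps_val h) (1 / 2) m"
  using assms by unfold_locales (auto simp: sv_rep_def add.commute)

text \<open>L is itself a density module, of weight 1, so \<open>X_v\<close> gives the commutator of
  X with each of the three summands of Y.\<close>

lemma (in calg) Xel_Yel:
  assumes "weights sc L L 0 1 m"
  shows "Xel sc m \<alpha> L * Yel sc m \<alpha> L - Yel sc m \<alpha> L * Xel sc m \<alpha> L = Yel sc m \<alpha> L"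
proof -
  interpret weights sc L L 0 1 \<alpha> m by (rule assms)
  have br: "a * (b + c) - (b + c) * a = (a * b - b * a) + (a * c - c * a)" for a b c :: 'b
    by (simp add: algebra_simps)
  have "X * Y - Y * X = (X * L m - L m * X) + (sc (2 * \<alpha> * M) * (X * L 0 - L 0 * X)
      + sc (\<alpha>\<^sup>2 * M\<^sup>2) * (X * L (- m) - L (- m) * X))"
    by (simp only: Yel_def br bracket_sc)
  also have "\<dots> = L m + (sc (\<alpha> * (M + M)) * L 0 + (sc (2 * \<alpha> * M * (\<alpha> * M)) * L (- m) - sc (\<alpha>\<^sup>2 * M\<^sup>2) * L (- m)))"
    unfolding X_v using M_neq_0 by (simp add: sc_mult mult.assoc sc_minus)
  also have "\<dots> = Y"
    unfolding Yel_def left_diff_distrib[symmetric] sc_diff[symmetric]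
    by (simp add: algebra_simps power2_eq_square flip: sc_add)
  finally show ?thesis .
qed

section \<open>The explicit coproduct and antipode\<close>

definition sv_Delta_wt :: "(int \<Rightarrow> sv_gen) \<Rightarrow> 'a \<Rightarrow> 'a \<Rightarrow> int \<Rightarrow> 'a::field_char_0 \<Rightarrow> int \<Rightarrow> (sv_gen + sv_gen,'a) ps" where
  "sv_Delta_wt c \<mu> k m \<alpha> j = (let M = (of_int m :: 'a); X = sv_X m \<alpha>; Y = sv_Y m \<alpha> in
     ps_add
      (ps_tsum (\<lambda>r. ps_smul (\<alpha>^r * qbin ((of_nat r - 1 - \<mu>) * M - k) M r)
         (ps_tens (ps_const (fa_gen (c (j - int r * m))))
            (ps_tpow r (ps_mult (ps_binom Y (k / M - of_nat r)) (ps_const (fa_pow Y r)))))))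
      (ps_tsum (\<lambda>r. ps_smul ((-1)^r)
         (ps_sumset (\<lambda>s. ps_smul (\<alpha>^s * gco \<mu> M s r k)
            (ps_tens (ps_const (fa_rise X 0 r))
               (ps_tpow r (ps_mult (ps_binom Y (- of_nat r))
                                   (ps_const (fa_gen (c (j + (int r - int s) * m))))))))
          {0..2*r}))))"

lemma sv_DeltaL_eq: "sv_DeltaL m \<alpha> i = sv_Delta_wt Lg 1 (of_int i) m \<alpha> i"
proof -
  have "of_nat r - 2 = (of_nat r - 1 - 1 :: 'a)" for r by simp
  then show ?thesis unfolding sv_DeltaL_def sv_Delta_wt_def sv_L_def coef_a_eq_gco by simp
qed

lemma sv_DeltaG_eq: "sv_DeltaG h m \<alpha> j = sv_Delta_wt Gg (1 / 2) (of_int j + eps_val h) m \<alpha> j"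
proof -
  have "of_nat r - 3 / 2 = (of_nat r - 1 - 1 / 2 :: 'a)" for r by simp
  then show ?thesis unfolding sv_DeltaG_def sv_Delta_wt_def sv_G_def coef_b_eq_gco Let_def by (simp only:)
qed

definition sv_S_wt :: "(int \<Rightarrow> sv_gen) \<Rightarrow> 'a \<Rightarrow> 'a \<Rightarrow> int \<Rightarrow> 'a::field_char_0 \<Rightarrow> int \<Rightarrow> (sv_gen,'a) ps" where
  "sv_S_wt c \<mu> k m \<alpha> j = (let M = (of_int m :: 'a); X = sv_X m \<alpha>; Y = sv_Y m \<alpha> in
     ps_smul (-1) (ps_mult (ps_binom Y (- (k / M)))
      (ps_tsum (\<lambda>r. ps_tsum (\<lambda>p. ps_sumset (\<lambda>q.
          ps_smul ((-1)^r * \<alpha>^(r + q) * qbin ((of_nat r - 1 - \<mu>) * M - k) M r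
                   * gco \<mu> M q p (k - of_nat r * M))
            (ps_tpow (r + p) (ps_const
               (fa_mult (fa_fall X (- (k / M)) p)
                  (fa_mult (fa_gen (c (j + (int p - int r - int q) * m))) (fa_pow Y r))))))
        {0..2*p})))))"

lemma sv_SL_eq: "sv_SL m \<alpha> i = sv_S_wt Lg 1 (of_int i) m \<alpha> i"
proof -
  have "of_nat r - 2 = (of_nat r - 1 - 1 :: 'a)" for r by simp
  then show ?thesis unfolding sv_SL_def sv_S_wt_def sv_L_def coef_a_eq_gco by simp
qed

lemma sv_SG_eq: "sv_SG h m \<alpha> j = sv_S_wt Gg (1 / 2) (of_int j + eps_val h) m \<alpha> j"
proof -
  have "of_nat r - 3 / 2 = (of_nat r - 1 - 1 / 2 :: 'a)" for r by simp
  then show ?thesis unfolding sv_SG_def sv_S_wt_def sv_G_def coef_b_eq_gco Let_def by (simp only:)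
qed

lemma fa_fin_sv_X [simp]: "fa_fin (sv_X m \<alpha> :: (sv_gen,'a::field_char_0) fa)"
  and fa_fin_sv_Y [simp]: "fa_fin (sv_Y m \<alpha> :: (sv_gen,'a::field_char_0) fa)"
  by (simp_all add: sv_X_def sv_Y_def sv_L_def)

lemma ps_fin_Delta_wt: "ps_fin (sv_Delta_wt c \<mu> k m \<alpha> j)"
  unfolding sv_Delta_wt_def Let_def by simp

lemma ps_fin_S_wt: "ps_fin (sv_S_wt c \<mu> k m \<alpha> j)"
  unfolding sv_S_wt_def Let_def by simp

lemma ps_fin_Delta_gen [simp]: "ps_fin (sv_Delta_gen h m \<alpha> g)"
  by (cases g) (simp_all add: sv_Delta_gen_def sv_DeltaL_eq sv_DeltaG_eq ps_fin_Delta_wt)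

lemma ps_fin_S_gen [simp]: "ps_fin (sv_S_gen h m \<alpha> g)"
  by (cases g) (simp_all add: sv_S_gen_def sv_SL_eq sv_SG_eq ps_fin_S_wt)

lemma Abs_fps_shift: "Abs_fps (\<lambda>n. if r \<le> n then f (n - r) else 0) = fps_X ^ r * Abs_fps f"
  for f :: "nat \<Rightarrow> 'b::ring_1"
  by (rule fps_ext) (simp add: fps_X_power_mult_nth)

context calg
begin

abbreviation ce :: "('g \<Rightarrow> 'b) \<Rightarrow> ('g,'a) ps \<Rightarrow> 'b fps" where
  "ce A \<equiv> hs sc (\<lambda>g. fps_const (A g))"

lemma ce_nth: "ce A x $ n = hv sc A (x n)" by (simp add: hs_fps_const)

lemma ce_const: "ce A (ps_const f) = fps_const (hv sc A f)"
  by (simp add: ser_const wd_fps_const lin_fps_const)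

lemma ce_tpow: "ce A (ps_tpow r x) = fps_X ^ r * ce A x"
proof -
  have "(\<lambda>n. hv sc A (ps_tpow r x n)) = (\<lambda>n. if r \<le> n then hv sc A (x (n - r)) else 0)"
    by (auto simp: ps_tpow_def)
  then show ?thesis using Abs_fps_shift[of r "\<lambda>n. hv sc A (x n)"] by (simp only: hs_fps_const)
qed

lemma ce_tsum: "(\<And>r. ps_fin (F r)) \<Longrightarrow> ce A (ps_tsum F) $ n = (\<Sum>r\<le>n. ce A (F r) $ n)"
  unfolding ce_nth ps_tsum_def by (subst lin_fun_sum) (auto simp: ps_fin_iff)

lemma ce_binom: "fa_fin Y \<Longrightarrow> ce A (ps_binom Y c) = pwc sc (hv sc A Y) (sc c)"
proof (rule fps_ext)
  fix n assume "fa_fin Y"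
  then have "ce A (ps_binom Y c) $ n = sc ((c gchoose n) * (-1) ^ n) * hv sc A Y ^ n"
    by (simp add: ce_nth ps_binom_def lin_smul hv_pow)
  also have "(c gchoose n) * (-1) ^ n = (-1) ^ n * (c gchoose n)" by simp
  finally show "ce A (ps_binom Y c) $ n = pwc sc (hv sc A Y) (sc c) $ n"
    by (simp add: pwc_nth bin_sc sc_mult sc_power)
qed

lemma ce_tens: "ps_fin x \<Longrightarrow> ps_fin y \<Longrightarrow>
    ce A (ps_tens x y) = ce (\<lambda>g. A (Inl g)) x * ce (\<lambda>g. A (Inr g)) y"
  by (simp add: hs_tens comp_def)

lemma hv_sv_X: "hv sc A (sv_X m \<alpha>) = Xel sc m \<alpha> (\<lambda>i. A (Lg i))"
  and hv_sv_Y: "hv sc A (sv_Y m \<alpha>) = Yel sc m \<alpha> (\<lambda>i. A (Lg i))"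
  by (simp_all add: sv_X_def sv_Y_def sv_L_def lin_smul lin_add Xel_def Yel_def)

lemma cm_Xel [cm_intros]: "(\<And>i. cm a (L i)) \<Longrightarrow> cm a (Xel sc m \<alpha> L)" "(\<And>i. cm (L i) a) \<Longrightarrow> cm (Xel sc m \<alpha> L) a"
  unfolding Xel_def by (auto intro!: cm_intros)

lemma cm_Yel [cm_intros]: "(\<And>i. cm a (L i)) \<Longrightarrow> cm a (Yel sc m \<alpha> L)" "(\<And>i. cm (L i) a) \<Longrightarrow> cm (Yel sc m \<alpha> L) a"
  unfolding Yel_def by (auto intro!: cm_intros)

text \<open>F contains even elements only, so commutation is assumed just for pairs with a member
  among the L's. The elements \<open>v1 i\<close> and \<open>v2 j\<close> may therefore be odd and
  anticommute.\<close>

lemma ce_Delta_wt: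
  fixes A :: "sv_gen + sv_gen \<Rightarrow> 'b" and c :: "int \<Rightarrow> sv_gen" and m :: int and \<alpha> :: 'a
  defines "L1 \<equiv> \<lambda>i. A (Inl (Lg i))" and "L2 \<equiv> \<lambda>i. A (Inr (Lg i))"
    and "v1 \<equiv> \<lambda>i. A (Inl (c i))" and "v2 \<equiv> \<lambda>i. A (Inr (c i))"
  defines "X1 \<equiv> Xel sc m \<alpha> L1" and "Y2 \<equiv> Yel sc m \<alpha> L2"
  assumes 1: "weights sc L1 v1 \<kappa> \<mu> m" and 2: "weights sc L2 v2 \<kappa> \<mu> m"
    and cm: "\<And>i j. cm (L1 i) (L2 j)" "\<And>i j. cm (L1 i) (v2 j)" "\<And>i j. cm (v1 i) (L2 j)"
  shows "ce A (sv_Delta_wt c \<mu> (\<kappa> + of_int j) m \<alpha> j) =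
    pwc sc Y2 X1 * fps_const (v1 j + v2 j) * pwc sc Y2 (- X1)"
proof -
  interpret W1: weights sc L1 v1 \<kappa> \<mu> \<alpha> m by (rule 1)
  interpret W2: weights sc L2 v2 \<kappa> \<mu> \<alpha> m by (rule 2)
  define k where "k = \<kappa> + of_int j"
  let ?M = "of_int m :: 'a" and ?X = "sv_X m \<alpha> :: (sv_gen,'a) fa" and ?Y = "sv_Y m \<alpha> :: (sv_gen,'a) fa"
  have X1: "hv sc (\<lambda>g. A (Inl g)) ?X = X1" and Y2: "hv sc (\<lambda>g. A (Inr g)) ?Y = Y2"
    by (simp_all add: hv_sv_X hv_sv_Y X1_def Y2_def L1_def L2_def)
  have X1Y2: "cm X1 Y2" unfolding X1_def Y2_def using cm(1) by (intro cm_intros)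
  let ?R1 = "Abs_fps (\<lambda>n. (\<Sum>r\<le>n. sc (((k / ?M - of_nat r) gchoose (n - r)) * (-1) ^ (n - r)) * W1.lower j r) * Y2 ^ n)"
  let ?R2 = "Abs_fps (\<lambda>n. \<Sum>r\<le>n. (-1) ^ r * rise X1 r * pwc sc Y2 (- of_nat r) $ (n - r) * W2.adY j r)"
  let ?D1 = "ps_tsum (\<lambda>r. ps_smul (\<alpha>^r * qbin ((of_nat r - 1 - \<mu>) * ?M - k) ?M r)
         (ps_tens (ps_const (fa_gen (c (j - int r * m))))
            (ps_tpow r (ps_mult (ps_binom ?Y (k / ?M - of_nat r)) (ps_const (fa_pow ?Y r))))))"
  let ?D2 = "ps_tsum (\<lambda>r. ps_smul ((-1)^r)
         (ps_sumset (\<lambda>s. ps_smul (\<alpha>^s * gco \<mu> ?M s r k)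
            (ps_tens (ps_const (fa_rise ?X 0 r))
               (ps_tpow r (ps_mult (ps_binom ?Y (- of_nat r))
                                   (ps_const (fa_gen (c (j + (int r - int s) * m))))))))
          {0..2*r}))"
  have D1: "ce A ?D1 = ?R1"
  proof (rule fps_ext)
    fix n
    have "ce A (ps_smul (\<alpha>^r * qbin ((of_nat r - 1 - \<mu>) * ?M - k) ?M r)
         (ps_tens (ps_const (fa_gen (c (j - int r * m))))
            (ps_tpow r (ps_mult (ps_binom ?Y (k / ?M - of_nat r)) (ps_const (fa_pow ?Y r)))))) $ n =
        sc (((k / ?M - of_nat r) gchoose (n - r)) * (-1) ^ (n - r)) * W1.lower j r * Y2 ^ n" if r: "r \<le> n" for r
    proof -
      define a where "a = \<alpha>^r * qbin ((of_nat r - 1 - \<mu>) * ?M - k) ?M r"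
      define b where "b = ((k / ?M - of_nat r) gchoose (n - r)) * (-1) ^ (n - r)"
      have "pwc sc Y2 (sc (k / ?M - of_nat r)) $ (n - r) * Y2 ^ r = sc b * Y2 ^ n"
        unfolding pwc_nth bin_sc b_def using r
        by (simp add: sc_mult sc_power mult.assoc flip: power_add) (simp add: sc_left_commute[of "(-1) ^ (n - r)"])
      moreover have "ce A (ps_smul a (ps_tens (ps_const (fa_gen (c (j - int r * m))))
            (ps_tpow r (ps_mult (ps_binom ?Y (k / ?M - of_nat r)) (ps_const (fa_pow ?Y r)))))) $ n =
          sc a * (v1 (j - int r * m) * (pwc sc Y2 (sc (k / ?M - of_nat r)) $ (n - r) * Y2 ^ r))"
        using r by (simp add: ser_smul ce_tens ce_tpow hs_mult ce_binom ce_const hv_pow Y2 v1_def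
            fps_X_power_mult_nth)
      ultimately show ?thesis
        by (simp add: W1.lower_def a_def[symmetric] b_def[symmetric] k_def[symmetric] mult.assoc
            sc_left_commute[of "sc a" b] sc_left_commute[of "v1 z" for z])
    qed
    then show "ce A ?D1 $ n = ?R1 $ n"
      by (subst ce_tsum) (simp_all add: sum_distrib_right)
  qed
  have D2: "ce A ?D2 = ?R2"
  proof (rule fps_ext)
    fix n
    have "ce A (ps_smul ((-1)^r)
         (ps_sumset (\<lambda>s. ps_smul (\<alpha>^s * gco \<mu> ?M s r k)
            (ps_tens (ps_const (fa_rise ?X 0 r))
               (ps_tpow r (ps_mult (ps_binom ?Y (- of_nat r))
                                   (ps_const (fa_gen (c (j + (int r - int s) * m))))))))
          {0..2*r})) $ n =
        (-1) ^ r * rise X1 r * pwc sc Y2 (- of_nat r) $ (n - r) * W2.adY j r" if r: "r \<le> n" for r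
    proof -
      define P where "P = pwc sc Y2 (- of_nat r) $ (n - r)"
      have "ce A (ps_smul (\<alpha>^s * gco \<mu> ?M s r k)
            (ps_tens (ps_const (fa_rise ?X 0 r))
               (ps_tpow r (ps_mult (ps_binom ?Y (- of_nat r))
                                   (ps_const (fa_gen (c (j + (int r - int s) * m)))))))) $ n =
          rise X1 r * P * (sc (\<alpha>^s * gco \<mu> ?M s r k) * v2 (j + (int r - int s) * m))" for s
        using r by (simp add: ser_smul ce_tens ce_tpow hs_mult ce_binom ce_const hv_rise X1 Y2 v2_def P_def
            fps_X_power_mult_nth sc_minus mult.assoc sc_left_commute[of "rise X1 r"] sc_left_commute[of "pw sc a b $ i" for a b i])
      then have "ce A (ps_sumset (\<lambda>s. ps_smul (\<alpha>^s * gco \<mu> ?M s r k)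
            (ps_tens (ps_const (fa_rise ?X 0 r))
               (ps_tpow r (ps_mult (ps_binom ?Y (- of_nat r))
                                   (ps_const (fa_gen (c (j + (int r - int s) * m)))))))) {0..2*r}) $ n =
          rise X1 r * P * W2.adY j r"
        by (subst ser_sumset) (simp_all add: fps_sum_nth W2.adY_def k_def sum_distrib_left atMost_atLeast0)
      then show ?thesis by (subst ser_smul) (simp_all add: P_def sc_power mult.assoc)
    qed
    then show "ce A ?D2 $ n = ?R2 $ n"
      by (subst ce_tsum) simp_all
  qed
  have R1: "?R1 = pwc sc Y2 X1 * fps_const (v1 j) * pwc sc Y2 (- X1)"
  proof -
    have "pwc sc Y2 X1 * fps_const (W1.lower j 0) = ?R1 * pwc sc Y2 X1"
    proof (rule conj_first)
      show "X1 * W1.lower j r - W1.lower j r * X1 = sc (k / ?M - of_nat r) * W1.lower j r - of_nat (Suc r) * W1.lower j (Suc r)" for r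
        using W1.X_lower[of j r] by (simp only: X1_def k_def)
      show "cm (W1.lower j r) Y2" for r
        unfolding W1.lower_def Y2_def using cm(3) by (intro cm_intros)
    qed (rule X1Y2)
    then have "pwc sc Y2 X1 * fps_const (v1 j) * pwc sc Y2 (- X1) = ?R1 * (pwc sc Y2 X1 * pwc sc Y2 (- X1))"
      by (simp add: mult.assoc)
    then show ?thesis using pwc_inverse[OF X1Y2] by simp
  qed
  have R2: "pwc sc Y2 X1 * fps_const (v2 j) * pwc sc Y2 (- X1) = ?R2"
  proof -
    have "pwc sc Y2 X1 * fps_const (W2.adY j 0) * pwc sc Y2 (- X1) = ?R2"
    proof (rule conj_second)
      show "of_nat (Suc r) * W2.adY j (Suc r) = Y2 * W2.adY j r - W2.adY j r * Y2" for r
        using W2.adY_Suc[of r j] by (simp only: Y2_def)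
      show "cm X1 (W2.adY j r)" for r
        unfolding W2.adY_def X1_def using cm(2) by (intro cm_intros)
    qed (rule X1Y2)
    then show ?thesis by simp
  qed
  have "ce A (sv_Delta_wt c \<mu> k m \<alpha> j) = ce A ?D1 + ce A ?D2"
    unfolding sv_Delta_wt_def Let_def by (rule ser_add) simp_all
  then show ?thesis unfolding k_def[symmetric] D1 D2 R1 R2[symmetric]
    by (simp add: distrib_left distrib_right flip: fps_const_add)
qed

lemma ce_S_wt:
  fixes A :: "sv_gen \<Rightarrow> 'b" and c :: "int \<Rightarrow> sv_gen" and m :: int and \<alpha> :: 'a
  defines "L \<equiv> \<lambda>i. A (Lg i)" and "v \<equiv> \<lambda>i. A (c i)"
  defines "X \<equiv> Xel sc m \<alpha> L" and "Y \<equiv> Yel sc m \<alpha> L"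
  assumes L: "weights sc L L 0 1 m" and v: "weights sc L v \<kappa> \<mu> m"
  shows "ce A (sv_S_wt c \<mu> (\<kappa> + of_int j) m \<alpha> j) =
    - (uexp sc (X * Y) * fps_const (v j) * uexp sc (- (X * Y)))"
proof -
  interpret W: weights sc L v \<kappa> \<mu> \<alpha> m by (rule v)
  interpret U: calg_XY sc X Y by unfold_locales (use Xel_Yel[OF L] in \<open>simp add: X_def Y_def\<close>)
  define k where "k = \<kappa> + of_int j"
  let ?M = "of_int m :: 'a" and ?X = "sv_X m \<alpha> :: (sv_gen,'a) fa" and ?Y = "sv_Y m \<alpha> :: (sv_gen,'a) fa"
  have X: "hv sc A ?X = X" and Y: "hv sc A ?Y = Y"
    by (simp_all add: hv_sv_X hv_sv_Y X_def Y_def L_def)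
  let ?T = "Abs_fps (\<lambda>n. \<Sum>r\<le>n. fall (X - sc (k / ?M)) (n - r) * W.adY_lower j (n - r) r * Y ^ r)"
  define f where "f r p q = ps_smul ((-1)^r * \<alpha>^(r + q) * qbin ((of_nat r - 1 - \<mu>) * ?M - k) ?M r
                   * gco \<mu> ?M q p (k - of_nat r * ?M))
            (ps_tpow (r + p) (ps_const
               (fa_mult (fa_fall ?X (- (k / ?M)) p)
                  (fa_mult (fa_gen (c (j + (int p - int r - int q) * m))) (fa_pow ?Y r)))))" for r p q
  have fin: "ps_fin (f r p q)" for r p q by (simp add: f_def)
  \<comment> \<open>Every summand is a single monomial in t. In degree n the double sum over r and p
    collapses to p = n - r, which yields the series T of \<open>u_conj_formula\<close>.\<close>
  have cf: "ce A (f r p q) $ n = (if n = r + p then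
      sc ((-1)^r * \<alpha>^(r + q) * qbin ((of_nat r - 1 - \<mu>) * ?M - k) ?M r * gco \<mu> ?M q p (k - of_nat r * ?M)) *
      (fall (X - sc (k / ?M)) p * v (j + (int p - int r - int q) * m) * Y ^ r) else 0)" for r p q n
    unfolding f_def
    by (simp add: ser_smul ce_tpow ce_const hv_mult hv_fall hv_pow X Y fps_X_power_mult_nth v_def sc_minus mult.assoc)
  have s: "(\<Sum>q\<in>{0..2*p}. ce A (f r p q) $ n) = (if n = r + p then
      fall (X - sc (k / ?M)) p * W.adY_lower j p r * Y ^ r else 0)" for r p n
  proof (cases "n = r + p")
    case True
    define Q where "Q = (-1)^r * (\<alpha>^r * qbin ((of_nat r - 1 - \<mu>) * ?M - k) ?M r)"
    have kr: "\<kappa> + of_int (j - int r * m) = k - of_nat r * ?M" by (simp add: k_def)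
    have ad: "W.adY_lower j p r = (\<Sum>q\<in>{0..2*p}. sc (Q * (\<alpha> ^ q * gco \<mu> ?M q p (k - of_nat r * ?M))) *
        v (j + (int p - int r - int q) * m))"
      unfolding W.adY_lower_def W.adY_def kr k_def[symmetric] Q_def[symmetric] sum_distrib_left atMost_atLeast0
    proof (intro sum.cong refl)
      fix q
      have "j - int r * m + (int p - int q) * m = j + (int p - int r - int q) * m" by (simp add: algebra_simps)
      then show "sc Q * (sc (\<alpha> ^ q * gco \<mu> ?M q p (k - of_nat r * ?M)) * v (j - int r * m + (int p - int q) * m)) =
          sc (Q * (\<alpha> ^ q * gco \<mu> ?M q p (k - of_nat r * ?M))) * v (j + (int p - int r - int q) * m)"
        by (simp only: sc_mult mult.assoc)
    qed
    have co: "(-1)^r * \<alpha>^(r + q) * qbin ((of_nat r - 1 - \<mu>) * ?M - k) ?M r * gco \<mu> ?M q p (k - of_nat r * ?M) =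
        Q * (\<alpha> ^ q * gco \<mu> ?M q p (k - of_nat r * ?M))" for q
      unfolding Q_def power_add by (simp only: mult_ac)
    show ?thesis using True unfolding cf co ad
      by (simp add: sum_distrib_left sum_distrib_right mult.assoc sc_left_commute[of "fall a b" for a b])
  qed (simp add: cf)
  have T: "ce A (ps_tsum (\<lambda>r. ps_tsum (\<lambda>p. ps_sumset (f r p) {0..2*p}))) = ?T"
  proof (rule fps_ext)
    fix n
    have "ce A (ps_tsum (\<lambda>r. ps_tsum (\<lambda>p. ps_sumset (f r p) {0..2*p}))) $ n =
        (\<Sum>r\<le>n. \<Sum>p\<le>n. \<Sum>q\<in>{0..2*p}. ce A (f r p q) $ n)"
      by (simp add: ce_tsum fin ser_sumset fps_sum_nth)
    also have "\<dots> = (\<Sum>r\<le>n. \<Sum>p\<le>n. if p = n - r then fall (X - sc (k / ?M)) p * W.adY_lower j p r * Y ^ r else 0)"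
      unfolding s by (intro sum.cong refl if_cong) auto
    also have "\<dots> = ?T $ n" by simp
    finally show "ce A (ps_tsum (\<lambda>r. ps_tsum (\<lambda>p. ps_sumset (f r p) {0..2*p}))) $ n = ?T $ n" .
  qed
  have "ce A (sv_S_wt c \<mu> k m \<alpha> j) =
      - (pwc sc Y (- sc (k / ?M)) * ce A (ps_tsum (\<lambda>r. ps_tsum (\<lambda>p. ps_sumset (f r p) {0..2*p}))))"
    unfolding sv_S_wt_def Let_def f_def[symmetric]
    by (simp add: ser_smul hs_mult fin ce_binom Y sc_minus flip: fps_const_neg)
  also have "\<dots> = - (U.u * fps_const (W.adY_lower j 0 0) * U.ui)"
    unfolding T
  proof (subst U.u_conj_formula[where d = "\<lambda>p r. W.adY_lower j p r"])
    show "X * W.adY_lower j 0 r - W.adY_lower j 0 r * X =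
        sc (k / ?M - of_nat r) * W.adY_lower j 0 r + of_nat (Suc r) * W.adY_lower j 0 (Suc r)" for r
      using W.X_adY_lower[of j r] by (simp only: X_def k_def)
    show "of_nat (Suc p) * W.adY_lower j (Suc p) r = Y * W.adY_lower j p r - W.adY_lower j p r * Y" for p r
      using W.adY_lower_Suc[of p j r] by (simp only: Y_def)
  qed (rule refl)
  finally show ?thesis by (simp add: k_def U.u_def U.ui_def W.adY_lower_0)
qed

end

lemma Xel_conj:
  assumes "calg sc" "V * V' = 1"
  shows "Xel sc m \<alpha> (\<lambda>i. V * L i * V') = V * Xel sc m \<alpha> L * V'"
    "Yel sc m \<alpha> (\<lambda>i. V * L i * V') = V * Yel sc m \<alpha> L * V'"
proof -
  interpret calg sc by (rule assms(1))
  show "Xel sc m \<alpha> (\<lambda>i. V * L i * V') = V * Xel sc m \<alpha> L * V'"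
    "Yel sc m \<alpha> (\<lambda>i. V * L i * V') = V * Yel sc m \<alpha> L * V'"
    by (simp_all add: Xel_def Yel_def distrib_left distrib_right mult.assoc sc_left_commute[of V])
qed

lemma Xel_add: "Xel sc m \<alpha> (\<lambda>i. L i + L' i) = Xel sc m \<alpha> L + Xel sc m \<alpha> L'"
  "Yel sc m \<alpha> (\<lambda>i. L i + L' i) = Yel sc m \<alpha> L + Yel sc m \<alpha> L'"
  by (simp_all add: Xel_def Yel_def algebra_simps)

lemma Xel_const: "Xel (fsc sc) m \<alpha> (\<lambda>i. fps_const (L i)) = fps_const (Xel sc m \<alpha> L)"
  "Yel (fsc sc) m \<alpha> (\<lambda>i. fps_const (L i)) = fps_const (Yel sc m \<alpha> L)"
  by (simp_all add: Xel_def Yel_def)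

lemma Xel_0: "Xel sc m \<alpha> (\<lambda>i. 0) = 0" "Yel sc m \<alpha> (\<lambda>i. 0) = 0"
  by (simp_all add: Xel_def Yel_def)

lemma scommD: "scomm p1 p2 A B \<Longrightarrow> A a * B b = (if p1 a \<and> p2 b then -1 else 1) * (B b * A a)"
  by (simp add: scomm_def)

lemma scomm_cm: "scomm p1 p2 A B \<Longrightarrow> \<not> p1 a \<or> \<not> p2 b \<Longrightarrow> cm (A a) (B b)"
  by (auto simp: scomm_def cm_def)

section \<open>The twist over the free algebra, and what it does to representations\<close>

definition twist_raw :: "(sv_gen,'a::field_char_0) fa \<Rightarrow> (sv_gen,'a) fa \<Rightarrow> (sv_gen + sv_gen,'a) ps" where
  "twist_raw x y = (\<lambda>n. fa_smul ((-1) ^ n * (1 / fact n)) (fa_tens (fa_fall x 0 n) (fa_pow y n)))"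

text \<open>Without relations the conjugate by F cannot be brought into explicit form, but this
  series evaluates to it under any assignment. F^-1 is the twist built from -X.\<close>

definition Delta_raw :: "int \<Rightarrow> 'a::field_char_0 \<Rightarrow> sv_gen \<Rightarrow> (sv_gen + sv_gen,'a) ps" where
  "Delta_raw m \<alpha> g = ps_mult (ps_mult (twist_raw (sv_X m \<alpha>) (sv_Y m \<alpha>))
      (ps_const (fa_add (fa_gen (Inl g)) (fa_gen (Inr g)))))
    (twist_raw (fa_smul (-1) (sv_X m \<alpha>)) (sv_Y m \<alpha>))"

lemma ps_fin_twist_raw [simp]: "fa_fin x \<Longrightarrow> fa_fin y \<Longrightarrow> ps_fin (twist_raw x y)"
  by (simp add: twist_raw_def ps_fin_iff)

lemma ps_fin_Delta_raw [simp]: "ps_fin (Delta_raw m \<alpha> g)"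
  by (simp add: Delta_raw_def)

context calg
begin

lemma pw_0 [simp]: "pw sc Z 0 = 1"
proof -
  interpret F: calg "fsc sc" by (rule calg_fps)
  have "(\<lambda>n. (-1) ^ n * bin (fsc sc) 0 n * Z ^ n) = (\<lambda>n. if n = 0 then 1 else 0)"
  proof
    fix n show "(-1) ^ n * bin (fsc sc) 0 n * Z ^ n = (if n = 0 then 1 else 0)"
      by (cases n) (simp_all add: bin_def fall_Suc_left del: fall.simps(2))
  qed
  then show ?thesis by (simp add: pw_def tsum_0)
qed

lemma pw_zero_left [simp]: "pw sc 0 x = 1"
proof -
  have "(\<lambda>n. (-1) ^ n * bin (fsc sc) x n * 0 ^ n) = (\<lambda>n. if n = 0 then 1 else 0)"
  proof
    fix n show "(-1) ^ n * bin (fsc sc) x n * 0 ^ n = (if n = 0 then 1 else 0)"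
      by (cases n) (simp_all add: bin_def)
  qed
  then show ?thesis by (simp add: pw_def tsum_0)
qed

lemma sv_rep_conj:
  assumes A: "sv_rep sc h A" and V: "V' * V = 1" "V * V' = 1"
  shows "sv_rep sc h (\<lambda>g. V * A g * V')"
proof -
  have e: "V' * (V * z) = z" for z using V(1) by (simp add: mult.assoc[symmetric])
  have 1: "V * a * V' * (V * b * V') - V * b * V' * (V * a * V') = V * (a * b - b * a) * V'"
    "V * a * V' * (V * b * V') + V * b * V' * (V * a * V') = V * (a * b + b * a) * V'"
    "sc c * (V * a * V') = V * (sc c * a) * V'" for a b c
    by (simp_all add: mult.assoc e distrib_left distrib_right left_diff_distrib right_diff_distrib sc_left_commute[of V])
  show ?thesis using A unfolding sv_rep_def 1 by simp
qed

text \<open>Mixed terms cancel because the two copies supercommute; this is the coproduct before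
  twisting.\<close>

lemma sv_rep_add:
  assumes A: "sv_rep sc h A" and B: "sv_rep sc h B" and AB: "scomm sv_par sv_par A B"
  shows "sv_rep sc h (\<lambda>g. A g + B g)"
proof -
  have e: "A (Lg i) * B g = B g * A (Lg i)" "A g * B (Lg i) = B (Lg i) * A g" "A (Gg j) * B (Gg l) = - (B (Gg l) * A (Gg j))" for i j l g
    using AB by (simp_all add: scomm_def)
  have 1: "(a + b) * (c + d) - (c + d) * (a + b) = (a * c - c * a) + (b * d - d * b)"
    if "a * d = d * a" "b * c = c * b" for a b c d :: 'b
    using that by (simp add: algebra_simps)
  have 2: "(a + b) * (c + d) + (c + d) * (a + b) = (a * c + c * a) + (b * d + d * b)"
    if "a * d = - (d * a)" "c * b = - (b * c)" for a b c d :: 'b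
    using that by (simp add: algebra_simps)
  show ?thesis
    unfolding sv_rep_def
  proof (intro conjI allI)
    fix i j
    show "(A (Lg i) + B (Lg i)) * (A (Lg j) + B (Lg j)) - (A (Lg j) + B (Lg j)) * (A (Lg i) + B (Lg i)) =
        sc (of_int (j - i)) * (A (Lg (i + j)) + B (Lg (i + j)))"
      using A B by (subst 1) (simp_all add: e sv_rep_def distrib_left)
    show "(A (Lg i) + B (Lg i)) * (A (Gg j) + B (Gg j)) - (A (Gg j) + B (Gg j)) * (A (Lg i) + B (Lg i)) =
        sc (of_int j + eps_val h - of_int i / 2) * (A (Gg (i + j)) + B (Gg (i + j)))"
      using A B by (subst 1) (simp_all add: e sv_rep_def distrib_left)
    show "(A (Gg i) + B (Gg i)) * (A (Gg j) + B (Gg j)) + (A (Gg j) + B (Gg j)) * (A (Gg i) + B (Gg i)) =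
        sc 2 * (A (Lg (i + j + (if h then 1 else 0))) + B (Lg (i + j + (if h then 1 else 0))))"
      using A B by (subst 2) (simp_all add: e sv_rep_def distrib_left)
  qed
qed

lemma sv_rep_const: "sv_rep sc h A \<Longrightarrow> sv_rep (fsc sc) h (\<lambda>g. fps_const (A g))"
  by (simp add: sv_rep_def)

lemma scomm_const: "scomm p1 p2 A B \<Longrightarrow> scomm p1 p2 (\<lambda>g. fps_const (A g)) (\<lambda>g. fps_const (B g))"
  by (auto simp: scomm_def fps_const_neg)

lemma ce_Delta_gen:
  assumes m: "m \<noteq> 0" and A: "sv_rep sc h (\<lambda>g. A (Inl g))" "sv_rep sc h (\<lambda>g. A (Inr g))"
    and AB: "scomm sv_par sv_par (\<lambda>g. A (Inl g)) (\<lambda>g. A (Inr g))"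
  shows "ce A (sv_Delta_gen h m \<alpha> g) =
    pwc sc (Yel sc m \<alpha> (\<lambda>i. A (Inr (Lg i)))) (Xel sc m \<alpha> (\<lambda>i. A (Inl (Lg i)))) *
    fps_const (A (Inl g) + A (Inr g)) *
    pwc sc (Yel sc m \<alpha> (\<lambda>i. A (Inr (Lg i)))) (- Xel sc m \<alpha> (\<lambda>i. A (Inl (Lg i))))"
proof -
  note W = weights_L[OF A(1) m] weights_L[OF A(2) m] weights_G[OF A(1) m] weights_G[OF A(2) m]
  have cm: "cm (A (Inl (Lg i))) (A (Inr g))" "cm (A (Inl g)) (A (Inr (Lg i)))" for i g
    using scomm_cm[OF AB, of "Lg i" g] scomm_cm[OF AB, of g "Lg i"] by simp_all
  show ?thesis
  proof (cases g)
    case (Lg i)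
    then show ?thesis
      using ce_Delta_wt[of A Lg 0 1 m i \<alpha>] W cm
      by (simp add: sv_Delta_gen_def sv_DeltaL_eq comp_def)
  next
    case (Gg j)
    then show ?thesis
      using ce_Delta_wt[of A Gg "eps_val h" "1 / 2" m j \<alpha>] W cm
      by (simp add: sv_Delta_gen_def sv_DeltaG_eq comp_def add.commute)
  qed
qed

lemma ce_S_gen:
  fixes \<alpha> :: 'a
  assumes m: "m \<noteq> 0" and A: "sv_rep sc h A"
  defines "XY \<equiv> Xel sc m \<alpha> (\<lambda>i. A (Lg i)) * Yel sc m \<alpha> (\<lambda>i. A (Lg i))"
  shows "ce A (sv_S_gen h m \<alpha> g) = - (uexp sc XY * fps_const (A g) * uexp sc (- XY))"
proof -
  note W = weights_L[OF A m] weights_G[OF A m]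
  show ?thesis
  proof (cases g)
    case (Lg i)
    then show ?thesis
      using ce_S_wt[of A m Lg 0 1 i \<alpha>] W
      by (simp add: sv_S_gen_def sv_SL_eq comp_def XY_def)
  next
    case (Gg j)
    then show ?thesis
      using ce_S_wt[of A m Gg "eps_val h" "1 / 2" j \<alpha>] W
      by (simp add: sv_S_gen_def sv_SG_eq comp_def add.commute XY_def)
  qed
qed

lemma hs_twist_raw:
  assumes "fa_fin x" "fa_fin y"
  shows "hs sc A (twist_raw x y) = pw sc (hv (fsc sc) (\<lambda>g. A (Inr g)) y) (hv (fsc sc) (\<lambda>g. A (Inl g)) x)"
proof -
  interpret F: calg "fsc sc" by (rule calg_fps)
  have "hv (fsc sc) A (twist_raw x y n) =
      (-1) ^ n * bin (fsc sc) (hv (fsc sc) (\<lambda>g. A (Inl g)) x) n * hv (fsc sc) (\<lambda>g. A (Inr g)) y ^ n" for n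
  proof -
    have "fsc sc ((-1) ^ n * (1 / fact n)) = (-1) ^ n * fsc sc (1 / fact n)"
      unfolding F.sc_mult F.sc_power F.sc_neg1 ..
    then show ?thesis using assms unfolding twist_raw_def fa_tens_def bin_def
      by (simp only: F.lin_smul F.hv_mult F.hv_rename F.hv_fall F.hv_pow fa_fin_mult fa_fin_rename fa_fin_fall fa_fin_pow
          inj_Inl inj_Inr comp_def F.sc_0 add_0_right mult.assoc)
  qed
  then show ?thesis by (simp add: ser_def pw_def)
qed

lemma hs_Delta_raw:
  fixes A :: "sv_gen + sv_gen \<Rightarrow> 'b fps" and \<alpha> :: 'a and m :: int
  defines "X \<equiv> Xel (fsc sc) m \<alpha> (\<lambda>i. A (Inl (Lg i)))" and "Y \<equiv> Yel (fsc sc) m \<alpha> (\<lambda>i. A (Inr (Lg i)))"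
  shows "hs sc A (Delta_raw m \<alpha> g) = pw sc Y X * (A (Inl g) + A (Inr g)) * pw sc Y (- X)"
proof -
  interpret F: calg "fsc sc" by (rule calg_fps)
  show ?thesis
    by (simp add: Delta_raw_def hs_mult ser_const F.lin_add hs_twist_raw F.hv_sv_X F.hv_sv_Y F.lin_smul X_def Y_def
        flip: fps_const_neg)
qed

end

lemma sv_rep_qgen: "sv_rep qsc h (qgen (sv_rel h))"
  using kills_qgen[OF good_sv_rel] by (simp add: qalg.kills_sv_rel)

lemma sv_rep_qgen2:
  "sv_rep qsc h (\<lambda>g. qgen (sv_rel2 h) (Inl g) :: (_,'a::field_char_0) qalg)"
  "sv_rep qsc h (\<lambda>g. qgen (sv_rel2 h) (Inr g) :: (_,'a) qalg)"
  "scomm sv_par sv_par (\<lambda>g. qgen (sv_rel2 h) (Inl g) :: (_,'a) qalg) (\<lambda>g. qgen (sv_rel2 h) (Inr g))"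
  using kills_qgen[OF good_sv_rel2[of h, where 'a = 'a]] by (simp_all add: qalg.kills_sv_rel2 comp_def)

lemma evs_Delta_gen:
  assumes "m \<noteq> 0"
  shows "evs (sv_rel2 h) (sv_Delta_gen h m \<alpha> g) = evs (sv_rel2 h) (Delta_raw m \<alpha> g)"
  unfolding qalg.hs_Delta_raw using qalg.ce_Delta_gen[OF assms sv_rep_qgen2]
  by (simp add: Xel_const fps_const_neg)

text \<open>Any homomorphism defined on the tensor square sees the explicit formula for the
coproduct only through its twisted form.\<close>
lemma (in calg) hs_Delta_gen:
  assumes "m \<noteq> 0" "kills (fsc sc) A (sv_rel2 h)"
  shows "hs sc A (sv_Delta_gen h m \<alpha> g) = hs sc A (Delta_raw m \<alpha> g)"
  by (rule hs_cong[OF good_sv_rel2 assms(2)]) (simp_all add: evs_Delta_gen[OF assms(1)])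

lemma good_Nil: "good_rel R \<Longrightarrow> r \<in> R \<Longrightarrow> r [] = 0" by (simp add: good_rel_def)

lemma evs_zero [simp]: "evs R ps_zero = 0"
  by (rule fps_ext) (simp add: qalg.ce_nth ps_zero_def)

section \<open>The coproduct modulo the relations, and the counit\<close>

lemma Delta_well_defined:
  assumes m: "m \<noteq> 0" and f: "f \<in> fa_ideal (sv_rel h)"
  shows "ps_eqv (sv_rel2 h) (sv_Delta h m \<alpha> (ps_const f)) (ps_zero :: (_,'a::field_char_0) ps)"
proof -
  interpret F: calg "fsc qsc :: 'a \<Rightarrow> (sv_gen + sv_gen,'a) qalg fps" by (rule qalg.calg_fps)
  have fin: "fa_fin f"
    using qalg.hv_ideal[OF f, of "qgen (sv_rel h)"] good_sv_rel[of h, where 'a = 'a] kills_qgen[OF good_sv_rel]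
    by (auto simp: good_rel_def kills_def)
  let ?E = "\<lambda>g. evs (sv_rel2 h) (sv_Delta_gen h m \<alpha> g)"
  let ?X = "Xel qsc m \<alpha> (\<lambda>i. qgen (sv_rel2 h) (Inl (Lg i)))" and ?Y = "Yel qsc m \<alpha> (\<lambda>i. qgen (sv_rel2 h) (Inr (Lg i)))"
  have cm: "cm ?X ?Y"
    using scomm_cm[OF sv_rep_qgen2(3)[where 'a = 'a]] by (intro cm_intros qalg.cm_Xel qalg.cm_Yel) auto
  have "sv_rep (fsc qsc) h (\<lambda>g. fps_const (qgen (sv_rel2 h) (Inl g) + qgen (sv_rel2 h) (Inr g)) :: (_,'a) qalg fps)"
    by (intro qalg.sv_rep_const qalg.sv_rep_add sv_rep_qgen2)
  then have "sv_rep (fsc qsc) h ?E"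
    unfolding qalg.ce_Delta_gen[OF m sv_rep_qgen2]
    by (rule F.sv_rep_conj) (rule qalg.pwc_inverse[OF cm])+
  then have "kills (fsc qsc) ?E (sv_rel h)" by (simp add: F.kills_sv_rel)
  then have "hv (fsc qsc) ?E f = 0"
    using F.hv_ideal[OF f] good_sv_rel[of h, where 'a = 'a] by (simp add: kills_def good_rel_def)
  then have "evs (sv_rel2 h) (sv_Delta h m \<alpha> (ps_const f)) = 0"
    by (simp add: sv_Delta_def qalg.hs_hom_ext fin qalg.ser_const)
  then show ?thesis
    by (subst ps_eqv_iff) (auto simp: sv_Delta_def ps_fin_hom_ext fin intro: good_Nil[OF good_sv_rel2])
qed

lemma ps_fin_Delta [simp]: "ps_fin x \<Longrightarrow> ps_fin (sv_Delta h m \<alpha> x)"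
  by (simp add: sv_Delta_def ps_fin_hom_ext)

lemma ps_eqv_hom_ext:
  fixes x :: "('g,'a::field_char_0) ps" and R :: "('k,'a) fa set"
  assumes "ps_fin x" "good_rel R" "\<And>g. ps_fin (\<phi> g)" "\<And>g. ps_fin (\<psi> g)" "\<And>c. ps_fin (f c)" "\<And>c. ps_fin (f' c)"
    and eq: "\<And>g. hs qsc (\<lambda>c. evs R (f c)) (\<phi> g) = hs qsc (\<lambda>c. evs R (f' c)) (\<psi> g)"
  shows "ps_eqv R (hom_ext f (hom_ext \<phi> x)) (hom_ext f' (hom_ext \<psi> x))"
  using assms(1-6)
  by (subst ps_eqv_iff) (auto simp: ps_fin_hom_ext qalg.hs_hom_ext eq intro: good_Nil)

lemma sv_rep_0: "sv_rep sc h (\<lambda>g. 0)"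
  by (simp add: sv_rep_def)

text \<open>Killing the first tensor factor sends X1 to 0 and hence F to 1, so only 1 \<otimes> g is
  left.\<close>

lemma counit_left:
  assumes m: "m \<noteq> 0" and x: "ps_fin x"
  shows "ps_eqv (sv_rel h) (sv_eps_id (sv_Delta h m \<alpha> x)) (x :: (sv_gen,'a::field_char_0) ps)"
proof -
  let ?f = "case_sum (\<lambda>g. ps_zero) (\<lambda>g. ps_const (fa_gen g)) :: sv_gen + sv_gen \<Rightarrow> (sv_gen,'a) ps"
  interpret F: calg "fsc qsc :: 'a \<Rightarrow> (sv_gen,'a) qalg fps" by (rule qalg.calg_fps)
  have f: "ps_fin (?f c)" for c by (cases c) simp_all
  let ?E = "\<lambda>c. evs (sv_rel h) (?f c)"
  have "kills (fsc qsc) ?E (sv_rel2 h)"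
    unfolding F.kills_sv_rel2 using qalg.sv_rep_const[OF sv_rep_qgen[of h, where 'a = 'a]] sv_rep_0
    by (simp add: comp_def scomm_def)
  then have "hs qsc ?E (sv_Delta_gen h m \<alpha> g) = fps_const (qgen (sv_rel h) g)" for g
    by (subst qalg.hs_Delta_gen[OF m]) (simp_all add: qalg.hs_Delta_raw Xel_0)
  then have "evs (sv_rel h) (sv_eps_id (sv_Delta h m \<alpha> x)) = evs (sv_rel h) x"
    unfolding sv_eps_id_def sv_Delta_def using x f by (simp add: qalg.hs_hom_ext ps_fin_hom_ext)
  then show ?thesis
    using x f by (subst ps_eqv_iff) (auto simp: sv_eps_id_def ps_fin_hom_ext intro: good_Nil[OF good_sv_rel])
qed

text \<open>Killing the second tensor factor sends Y2 to 0, and again F becomes 1.\<close>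

lemma counit_right:
  assumes m: "m \<noteq> 0" and x: "ps_fin x"
  shows "ps_eqv (sv_rel h) (sv_id_eps (sv_Delta h m \<alpha> x)) (x :: (sv_gen,'a::field_char_0) ps)"
proof -
  let ?f = "case_sum (\<lambda>g. ps_const (fa_gen g)) (\<lambda>g. ps_zero) :: sv_gen + sv_gen \<Rightarrow> (sv_gen,'a) ps"
  interpret F: calg "fsc qsc :: 'a \<Rightarrow> (sv_gen,'a) qalg fps" by (rule qalg.calg_fps)
  have f: "ps_fin (?f c)" for c by (cases c) simp_all
  let ?E = "\<lambda>c. evs (sv_rel h) (?f c)"
  have "kills (fsc qsc) ?E (sv_rel2 h)"
    unfolding F.kills_sv_rel2 using qalg.sv_rep_const[OF sv_rep_qgen[of h, where 'a = 'a]] sv_rep_0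
    by (simp add: comp_def scomm_def)
  then have "hs qsc ?E (sv_Delta_gen h m \<alpha> g) = fps_const (qgen (sv_rel h) g)" for g
    by (subst qalg.hs_Delta_gen[OF m]) (simp_all add: qalg.hs_Delta_raw Xel_0)
  then have "evs (sv_rel h) (sv_id_eps (sv_Delta h m \<alpha> x)) = evs (sv_rel h) x"
    unfolding sv_id_eps_def sv_Delta_def using x f by (simp add: qalg.hs_hom_ext ps_fin_hom_ext)
  then show ?thesis
    using x f by (subst ps_eqv_iff) (auto simp: sv_id_eps_def ps_fin_hom_ext intro: good_Nil[OF good_sv_rel])
qed

section \<open>Coassociativity\<close>

lemma scomm_add: "scomm p1 p2 A C \<Longrightarrow> scomm p1 p2 B C \<Longrightarrow> scomm p1 p2 (\<lambda>g. A g + B g) C"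
  "scomm p1 p2 C A \<Longrightarrow> scomm p1 p2 C B \<Longrightarrow> scomm p1 p2 C (\<lambda>g. A g + B g)"
  by (auto simp: scomm_def distrib_left distrib_right)

lemma scomm_conj_left:
  assumes "scomm p1 p2 A B" "V' * V = 1" "\<And>b. cm V (B b)" "\<And>b. cm V' (B b)"
  shows "scomm p1 p2 (\<lambda>g. V * A g * V') B"
proof -
  have "V * A a * V' * B b = V * (A a * B b) * V'" "B b * (V * A a * V') = V * (B b * A a) * V'" for a b
    using cmD[OF assms(4), of b] cm_left_commute[OF assms(3), of b] by (simp_all add: mult.assoc)
  then show ?thesis using assms(1) by (auto simp: scomm_def)
qed

lemma scomm_conj_right:
  assumes "scomm p1 p2 A B" "V' * V = 1" "\<And>a. cm V (A a)" "\<And>a. cm V' (A a)"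
  shows "scomm p1 p2 A (\<lambda>g. V * B g * V')"
proof -
  have "V * B b * V' * A a = V * (B b * A a) * V'" "A a * (V * B b * V') = V * (A a * B b) * V'" for a b
    using cmD[OF assms(4), of a] cm_left_commute[OF assms(3), of a] by (simp_all add: mult.assoc)
  then show ?thesis using assms(1) by (auto simp: scomm_def)
qed

context calg
begin

lemma kills_sv_rel3:
  "kills sc A (sv_rel3 h) \<longleftrightarrow> sv_rep sc h (\<lambda>g. A (Inl g)) \<and> sv_rep sc h (\<lambda>g. A (Inr (Inl g))) \<and>
    sv_rep sc h (\<lambda>g. A (Inr (Inr g))) \<and> scomm sv_par sv_par (\<lambda>g. A (Inr (Inl g))) (\<lambda>g. A (Inr (Inr g))) \<and>
    scomm sv_par (sum_par sv_par sv_par) (\<lambda>g. A (Inl g)) (\<lambda>g. A (Inr g))"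
  unfolding sv_rel3_def
  by (simp add: kills_tens_rel good_sv_rel good_sv_rel2 kills_sv_rel kills_sv_rel2 comp_def)

text \<open>All b g commute with V and so equal their own conjugates. Then every ingredient is
  conjugated by V, and \<open>pw_conj\<close> pulls V out of the whole expression.\<close>

lemma hs_Delta_raw_conj_left:
  fixes a b :: "sv_gen \<Rightarrow> 'b" and V V' :: "'b fps" and m :: int and \<alpha> :: 'a
  defines "X \<equiv> Xel sc m \<alpha> (\<lambda>i. a (Lg i))" and "Y \<equiv> Yel sc m \<alpha> (\<lambda>i. b (Lg i))"
  assumes V: "V' * V = 1" "V * V' = 1" and c: "\<And>g. cm V (fps_const (b g))"
  shows "hs sc (case_sum (\<lambda>g. V * fps_const (a g) * V') (\<lambda>g. fps_const (b g))) (Delta_raw m \<alpha> g) =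
    V * pwc sc Y X * fps_const (a g + b g) * (pwc sc Y (- X) * V')"
proof -
  interpret F: calg "fsc sc" by (rule calg_fps)
  have conj: "z = V * z * V'" if "cm V z" for z
    using that V(2) by (simp add: cm_def mult.assoc)
  have e: "V' * (V * z) = z" for z using V(1) by (simp add: mult.assoc[symmetric])
  have X: "Xel (fsc sc) m \<alpha> (\<lambda>i. V * fps_const (a (Lg i)) * V') = V * fps_const X * V'"
    by (simp add: Xel_conj[OF F.calg_axioms V(2)] Xel_const X_def)
  have nX: "- (V * fps_const X * V') = V * fps_const (- X) * V'" by (simp flip: fps_const_neg)
  have Y: "Yel (fsc sc) m \<alpha> (\<lambda>i. fps_const (b (Lg i))) = V * fps_const Y * V'"
    unfolding Xel_const Y_def[symmetric]
    by (rule conj) (unfold Y_def Xel_const(2)[symmetric], intro F.cm_Yel c)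
  have "hs sc (case_sum (\<lambda>g. V * fps_const (a g) * V') (\<lambda>g. fps_const (b g))) (Delta_raw m \<alpha> g) =
      V * pwc sc Y X * V' * (V * fps_const (a g) * V' + V * fps_const (b g) * V') * (V * pwc sc Y (- X) * V')"
    unfolding hs_Delta_raw sum.case X Y nX pw_conj[OF V] conj[OF c, symmetric] ..
  then show ?thesis
    by (simp add: mult.assoc e distrib_left distrib_right flip: fps_const_add)
qed

lemma hs_Delta_raw_conj_right:
  fixes a b :: "sv_gen \<Rightarrow> 'b" and V V' :: "'b fps" and m :: int and \<alpha> :: 'a
  defines "X \<equiv> Xel sc m \<alpha> (\<lambda>i. a (Lg i))" and "Y \<equiv> Yel sc m \<alpha> (\<lambda>i. b (Lg i))"
  assumes V: "V' * V = 1" "V * V' = 1" and c: "\<And>g. cm V (fps_const (a g))"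
  shows "hs sc (case_sum (\<lambda>g. fps_const (a g)) (\<lambda>g. V * fps_const (b g) * V')) (Delta_raw m \<alpha> g) =
    V * pwc sc Y X * fps_const (a g + b g) * (pwc sc Y (- X) * V')"
proof -
  interpret F: calg "fsc sc" by (rule calg_fps)
  have conj: "z = V * z * V'" if "cm V z" for z
    using that V(2) by (simp add: cm_def mult.assoc)
  have e: "V' * (V * z) = z" for z using V(1) by (simp add: mult.assoc[symmetric])
  have Y: "Yel (fsc sc) m \<alpha> (\<lambda>i. V * fps_const (b (Lg i)) * V') = V * fps_const Y * V'"
    by (simp add: Xel_conj[OF F.calg_axioms V(2)] Xel_const Y_def)
  have nX: "- (V * fps_const X * V') = V * fps_const (- X) * V'" by (simp flip: fps_const_neg)
  have X: "Xel (fsc sc) m \<alpha> (\<lambda>i. fps_const (a (Lg i))) = V * fps_const X * V'"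
    unfolding Xel_const X_def[symmetric]
    by (rule conj) (unfold X_def Xel_const(1)[symmetric], intro F.cm_Xel c)
  have "hs sc (case_sum (\<lambda>g. fps_const (a g)) (\<lambda>g. V * fps_const (b g) * V')) (Delta_raw m \<alpha> g) =
      V * pwc sc Y X * V' * (V * fps_const (a g) * V' + V * fps_const (b g) * V') * (V * pwc sc Y (- X) * V')"
    unfolding hs_Delta_raw sum.case X Y nX pw_conj[OF V] conj[OF c, symmetric] ..
  then show ?thesis
    by (simp add: mult.assoc e distrib_left distrib_right flip: fps_const_add)
qed

lemma twist_coassociative:
  fixes a1 a2 a3 :: "sv_gen \<Rightarrow> 'b" and m :: int and \<alpha> :: 'a
  assumes m: "m \<noteq> 0"
    and a: "sv_rep sc h a1" "sv_rep sc h a2" "sv_rep sc h a3"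
    and s: "scomm sv_par sv_par a1 a2" "scomm sv_par sv_par a1 a3" "scomm sv_par sv_par a2 a3"
  defines "X \<equiv> \<lambda>a. Xel sc m \<alpha> (\<lambda>i. a (Lg i))" and "Y \<equiv> \<lambda>a. Yel sc m \<alpha> (\<lambda>i. a (Lg i))"
  defines "E12 \<equiv> case_sum (\<lambda>g. pwc sc (Y a2) (X a1) * fps_const (a1 g + a2 g) * pwc sc (Y a2) (- X a1)) (\<lambda>g. fps_const (a3 g))"
    and "E23 \<equiv> case_sum (\<lambda>g. fps_const (a1 g)) (\<lambda>g. pwc sc (Y a3) (X a2) * fps_const (a2 g + a3 g) * pwc sc (Y a3) (- X a2))"
  shows "hs sc E12 (sv_Delta_gen h m \<alpha> g) = hs sc E23 (sv_Delta_gen h m \<alpha> g)"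
proof -
  interpret F: calg "fsc sc" by (rule calg_fps)
  define V V' W W' where "V = pwc sc (Y a2) (X a1)" and "V' = pwc sc (Y a2) (- X a1)"
    and "W = pwc sc (Y a3) (X a2)" and "W' = pwc sc (Y a3) (- X a2)"
  have cmX: "cm (X a1) (Y a2)" "cm (X a2) (Y a3)" "cm (X a1) (X a2)" "cm (X a1) (Y a3)" "cm (Y a3) (Y a2)" "cm (Y a3) (X a2)"
    unfolding X_def Y_def using scomm_cm[OF s(1)] scomm_cm[OF s(2)] scomm_cm[OF s(3)]
    by (auto intro!: cm_intros intro: cm_sym)
  have cm3: "cm (a3 g) (X a1)" "cm (a3 g) (Y a2)" for g
    unfolding X_def Y_def
    by (rule cm_Xel cm_Yel, rule cm_sym, rule scomm_cm[OF s(2)] scomm_cm[OF s(3)], simp)+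
  have cm1: "cm (a1 g) (X a2)" "cm (a1 g) (Y a3)" for g
    unfolding X_def Y_def using scomm_cm[OF s(1)] scomm_cm[OF s(2)] by (auto intro!: cm_intros)
  have V: "V' * V = 1" "V * V' = 1" and W: "W' * W = 1" "W * W' = 1"
    unfolding V_def V'_def W_def W'_def using pwc_inverse[OF cmX(1)] pwc_inverse[OF cmX(2)] by simp_all
  have cV: "cm V (fps_const (a3 g))" "cm V' (fps_const (a3 g))" "cm W (fps_const (a1 g))" "cm W' (fps_const (a1 g))" for g
    unfolding V_def V'_def W_def W'_def using cm3 cm1 by (auto intro!: cm_intros)
  have k12: "kills (fsc sc) E12 (sv_rel2 h)"
    unfolding F.kills_sv_rel2 E12_def V_def[symmetric] V'_def[symmetric] comp_def sum.case
    by (intro conjI F.sv_rep_conj V sv_rep_const sv_rep_add a s scomm_conj_left scomm_const scomm_add cV)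
  have k23: "kills (fsc sc) E23 (sv_rel2 h)"
    unfolding F.kills_sv_rel2 E23_def W_def[symmetric] W'_def[symmetric] comp_def sum.case
    by (intro conjI F.sv_rep_conj W sv_rep_const sv_rep_add a s scomm_conj_right scomm_const scomm_add cV)
  let ?P = "pwc sc (Y a3) (X a1 + X a2)" and ?P' = "pwc sc (Y a3) (- (X a1 + X a2))"
  let ?Q = "pwc sc (Y a2 + Y a3) (X a1)" and ?Q' = "pwc sc (Y a2 + Y a3) (- X a1)"
  \<comment> \<open>Here and in \<open>r\<close> the middle factor is the sum of the three copies of
    g, so only the conjugating elements, the two sides of the cocycle identity, remain to be
    compared.\<close>
  have l: "hs sc E12 (sv_Delta_gen h m \<alpha> g) = V * ?P * fps_const (a1 g + a2 g + a3 g) * (?P' * V')"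
    unfolding hs_Delta_gen[OF m k12] unfolding E12_def V_def[symmetric] V'_def[symmetric]
    using hs_Delta_raw_conj_left[of V' V a3 "\<lambda>g. a1 g + a2 g" m \<alpha> g] V cV
    by (simp only: Xel_add X_def Y_def)
  have r: "hs sc E23 (sv_Delta_gen h m \<alpha> g) = W * ?Q * fps_const (a1 g + a2 g + a3 g) * (?Q' * W')"
    unfolding hs_Delta_gen[OF m k23] unfolding E23_def W_def[symmetric] W'_def[symmetric]
    using hs_Delta_raw_conj_right[of W' W a1 "\<lambda>g. a2 g + a3 g" m \<alpha> g] W cV
    by (simp only: Xel_add X_def Y_def add.assoc)
  have cocycle: "V * ?P = W * ?Q"
    unfolding V_def W_def
    by (rule twist_cocycle)
      (use cmX Xel_Yel[OF weights_L[OF a(2) m, unfolded comp_def], of \<alpha>] in \<open>simp_all add: X_def Y_def\<close>)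
  have P: "?P * ?P' = 1"
    by (rule pwc_inverse) (use cmX in \<open>auto intro!: cm_intros\<close>)
  have Q: "?Q' * ?Q = 1"
    by (rule pwc_inverse) (use cmX in \<open>auto intro!: cm_intros\<close>)
  \<comment> \<open>The right-hand conjugators are inverses of the two sides of the cocycle
    identity, hence they agree as well.\<close>
  have "?P' * V' = (?Q' * W') * (W * ?Q) * (?P' * V')"
    using Q W(1) by (simp add: mult.assoc) (simp add: mult.assoc[symmetric])
  also have "\<dots> = ?Q' * W' * (V * (?P * ?P') * V')" unfolding cocycle[symmetric] by (simp only: mult.assoc)
  also have "\<dots> = ?Q' * W'" unfolding P using V(2) by simp
  finally show ?thesis unfolding l r cocycle by simp
qed

end

lemma coassociativity:
  fixes x :: "(sv_gen,'a::field_char_0) ps"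
  assumes m: "m \<noteq> 0" and x: "ps_fin x"
  shows "ps_eqv (sv_rel3 h) (sv_Delta_id h m \<alpha> (sv_Delta h m \<alpha> x)) (sv_id_Delta h m \<alpha> (sv_Delta h m \<alpha> x))"
proof -
  let ?q = "qgen (sv_rel3 h) :: _ \<Rightarrow> (_,'a) qalg"
  define a1 a2 a3 where "a1 g = ?q (Inl g)" and "a2 g = ?q (Inr (Inl g))" and "a3 g = ?q (Inr (Inr g))" for g
  have k: "kills qsc ?q (sv_rel3 h)" by (rule kills_qgen[OF good_sv_rel3])
  have a: "sv_rep qsc h a1" "sv_rep qsc h a2" "sv_rep qsc h a3" "scomm sv_par sv_par a2 a3"
    and s: "scomm sv_par (sum_par sv_par sv_par) (\<lambda>g. ?q (Inl g)) (\<lambda>g. ?q (Inr g))"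
    using k unfolding qalg.kills_sv_rel3 by (simp_all add: a1_def[abs_def] a2_def[abs_def] a3_def[abs_def])
  have s12: "scomm sv_par sv_par a1 a2" and s13: "scomm sv_par sv_par a1 a3"
    unfolding scomm_def a1_def a2_def a3_def using scommD[OF s] by (simp_all add: sum_par_def)
  let ?l = "case_sum Inl (\<lambda>b. Inr (Inl b)) :: sv_gen + sv_gen \<Rightarrow> sv_gen + (sv_gen + sv_gen)"
  have inj: "inj ?l" by (rule injI) (auto split: sum.splits)
  let ?f = "\<lambda>c. case c of Inl g \<Rightarrow> ps_rename ?l (sv_Delta_gen h m \<alpha> g) | Inr g \<Rightarrow> ps_const (fa_gen (Inr (Inr g)))"
  let ?f' = "\<lambda>c. case c of Inl g \<Rightarrow> ps_const (fa_gen (Inl g)) | Inr g \<Rightarrow> ps_rename Inr (sv_Delta_gen h m \<alpha> g)"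
  let ?X = "\<lambda>a. Xel qsc m \<alpha> (\<lambda>i. a (Lg i))" and ?Y = "\<lambda>a. Yel qsc m \<alpha> (\<lambda>i. a (Lg i))"
  have f: "(\<lambda>c. evs (sv_rel3 h) (?f c)) = case_sum
      (\<lambda>g. pwc qsc (?Y a2) (?X a1) * fps_const (a1 g + a2 g) * pwc qsc (?Y a2) (- ?X a1)) (\<lambda>g. fps_const (a3 g))"
  proof
    fix c
    show "evs (sv_rel3 h) (?f c) = case_sum
      (\<lambda>g. pwc qsc (?Y a2) (?X a1) * fps_const (a1 g + a2 g) * pwc qsc (?Y a2) (- ?X a1)) (\<lambda>g. fps_const (a3 g)) c"
    proof (cases c)
      case (Inl g)
      then show ?thesis
        using qalg.ce_Delta_gen[of m h "\<lambda>c. ?q (?l c)" \<alpha> g] m a s12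
        by (simp add: qalg.hs_rename inj comp_def a1_def[abs_def] a2_def[abs_def])
    qed (simp add: a3_def)
  qed
  have f': "(\<lambda>c. evs (sv_rel3 h) (?f' c)) = case_sum (\<lambda>g. fps_const (a1 g))
      (\<lambda>g. pwc qsc (?Y a3) (?X a2) * fps_const (a2 g + a3 g) * pwc qsc (?Y a3) (- ?X a2))"
  proof
    fix c
    show "evs (sv_rel3 h) (?f' c) = case_sum (\<lambda>g. fps_const (a1 g))
      (\<lambda>g. pwc qsc (?Y a3) (?X a2) * fps_const (a2 g + a3 g) * pwc qsc (?Y a3) (- ?X a2)) c"
    proof (cases c)
      case (Inr g)
      then show ?thesis
        using qalg.ce_Delta_gen[of m h "\<lambda>c. ?q (Inr c)" \<alpha> g] m a
        by (simp add: qalg.hs_rename comp_def a2_def[abs_def] a3_def[abs_def])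
    qed (simp add: a1_def)
  qed
  have fin: "ps_fin (?f c)" "ps_fin (?f' c)" for c
    by (auto simp: inj split: sum.splits)
  show ?thesis unfolding sv_Delta_id_def sv_id_Delta_def sv_Delta_def
  proof (rule ps_eqv_hom_ext[OF x good_sv_rel3 _ _ fin])
    fix g
    show "hs qsc (\<lambda>c. evs (sv_rel3 h) (?f c)) (sv_Delta_gen h m \<alpha> g) =
        hs qsc (\<lambda>c. evs (sv_rel3 h) (?f' c)) (sv_Delta_gen h m \<alpha> g)"
      unfolding f f' by (rule qalg.twist_coassociative) (use m a s12 s13 in auto)
  qed simp_all
qed

section \<open>Two-sided actions\<close>

definition central :: "'q::ring_1 \<Rightarrow> bool" where
  "central z \<longleftrightarrow> (\<forall>q. z * q = q * z)"

definition scale2 :: "'q::ring_1 \<Rightarrow> 'q \<times> 'q \<Rightarrow> 'q \<times> 'q" where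
  "scale2 z x = (z * fst x, z * snd x)"

text \<open>Linearity over central elements makes the scalars central among the endomorphisms.\<close>
definition is_endo :: "('q::ring_1 \<times> 'q \<Rightarrow> 'q \<times> 'q) \<Rightarrow> bool" where
  "is_endo f \<longleftrightarrow> (\<forall>x y. f (x + y) = f x + f y) \<and> (\<forall>z x. central z \<longrightarrow> f (scale2 z x) = scale2 z (f x))"

typedef (overloaded) 'q endo = "{f :: 'q::ring_1 \<times> 'q \<Rightarrow> 'q \<times> 'q. is_endo f}"
  by (rule exI[of _ "\<lambda>x. x"]) (simp add: is_endo_def)

setup_lifting type_definition_endo

lemma prod_plus_simps: "- (a, b) = (- a, - b)" "(0, 0) = 0"
  "(a, b) - (c, d) = (a - c, b - d)"
  by (simp_all add: uminus_prod_def zero_prod_def minus_prod_def)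

lemma scale2_zero: "scale2 z 0 = 0"
  and scale2_add: "scale2 z (x + y) = scale2 z x + scale2 z y"
  and scale2_minus: "scale2 z (- x) = - scale2 z x"
  and scale2_diff: "scale2 z (x - y) = scale2 z x - scale2 z y"
  by (simp_all add: scale2_def prod_eq_iff distrib_left right_diff_distrib)

lemma is_endo_closed:
  "is_endo (\<lambda>x. 0)" "is_endo (\<lambda>x. x)"
  "is_endo f \<Longrightarrow> is_endo g \<Longrightarrow> is_endo (\<lambda>x. f x + g x)"
  "is_endo f \<Longrightarrow> is_endo (\<lambda>x. - f x)"
  "is_endo f \<Longrightarrow> is_endo g \<Longrightarrow> is_endo (\<lambda>x. f x - g x)"
  "is_endo f \<Longrightarrow> is_endo g \<Longrightarrow> is_endo (\<lambda>x. f (g x))"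
proof -
  show "is_endo (\<lambda>x. 0)" "is_endo (\<lambda>x. x)" by (simp_all add: is_endo_def scale2_zero)
  assume f: "is_endo f"
  then show "is_endo (\<lambda>x. - f x)"
    unfolding is_endo_def by (metis minus_add_distrib scale2_minus)
  assume g: "is_endo g"
  have e: "f (x + y) = f x + f y" "g (x + y) = g x + g y" for x y
    using f g unfolding is_endo_def by blast+
  have s: "f (scale2 z x) = scale2 z (f x)" "g (scale2 z x) = scale2 z (g x)" if "central z" for z x
    using f g that unfolding is_endo_def by blast+
  have "f (x + y) + g (x + y) = f x + g x + (f y + g y)" for x y
    unfolding e by (simp only: add_ac)
  then show "is_endo (\<lambda>x. f x + g x)" unfolding is_endo_def using s scale2_add by metis
  have "f (x + y) - g (x + y) = f x - g x + (f y - g y)" for x y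
    unfolding e by (rule add_diff_add)
  then show "is_endo (\<lambda>x. f x - g x)" unfolding is_endo_def using s scale2_diff by metis
  show "is_endo (\<lambda>x. f (g x))" unfolding is_endo_def using e s by metis
qed

instantiation endo :: (ring_1) ring_1
begin

lift_definition zero_endo :: "'a endo" is "\<lambda>x. 0" by (rule is_endo_closed)
lift_definition one_endo :: "'a endo" is "\<lambda>x. x" by (rule is_endo_closed)
lift_definition plus_endo :: "'a endo \<Rightarrow> 'a endo \<Rightarrow> 'a endo" is "\<lambda>f g x. f x + g x"
  by (rule is_endo_closed)
lift_definition uminus_endo :: "'a endo \<Rightarrow> 'a endo" is "\<lambda>f x. - f x"
  by (rule is_endo_closed)
lift_definition minus_endo :: "'a endo \<Rightarrow> 'a endo \<Rightarrow> 'a endo" is "\<lambda>f g x. f x - g x"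
  by (rule is_endo_closed)
lift_definition times_endo :: "'a endo \<Rightarrow> 'a endo \<Rightarrow> 'a endo" is "\<lambda>f g x. f (g x)"
  by (rule is_endo_closed)

instance
proof
  fix a b c :: "'a endo"
  show "a * b * c = a * (b * c)" "1 * a = a" "a * 1 = a" "(a + b) * c = a * c + b * c"
    by (transfer, rule refl)+
  show "a * (b + c) = a * b + a * c"
    by transfer (rule ext, unfold is_endo_def, blast)
  show "a + b + c = a + (b + c)" by transfer (simp only: add.assoc)
  show "a + b = b + a" by transfer (simp only: add.commute)
  show "0 + a = a" "- a + a = 0" "a - b = a + - b" by (transfer, simp)+
  show "(0::'a endo) \<noteq> 1"
  proof transfer
    have "0 \<noteq> (1 :: 'a, 0 :: 'a)" by (simp add: zero_prod_def)
    then show "(\<lambda>x. 0) \<noteq> (\<lambda>x :: 'a \<times> 'a. x)" by metis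
  qed
qed

end

lift_definition Lm :: "'q::ring_1 \<Rightarrow> 'q endo" is "\<lambda>p x. (p * fst x, p * snd x)"
proof -
  fix p :: 'q
  have "p * (z * x) = z * (p * x)" if "central z" for z x
    using that by (metis central_def mult.assoc)
  then show "is_endo (\<lambda>x. (p * fst x, p * snd x))"
    by (simp add: is_endo_def scale2_def plus_prod_def distrib_left)
qed
lift_definition Rm :: "'q::ring_1 \<Rightarrow> 'q endo" is "\<lambda>p x. (fst x * p, snd x * p)"
  by (simp add: is_endo_def scale2_def plus_prod_def distrib_right mult.assoc)
text \<open>\<open>Jm\<close> and \<open>Km\<close> act as anticommuting 2 x 2 matrices with squares
  -1 and 1. Both send (1, 0) to (0, 1), so the unit cannot tell them apart.\<close>

lift_definition Jm :: "'q::ring_1 endo" is "\<lambda>x. (- snd x, fst x)"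
  by (simp add: is_endo_def scale2_def plus_prod_def)
lift_definition Km :: "'q::ring_1 endo" is "\<lambda>x. (snd x, fst x)"
  by (simp add: is_endo_def scale2_def plus_prod_def)
lift_definition at_one :: "'q::ring_1 endo \<Rightarrow> 'q \<times> 'q" is "\<lambda>f. f (1, 0)" .

lemma endo_simps:
  "Lm (p + q) = Lm p + Lm q" "Lm (p * q) = Lm p * Lm q" "Lm 1 = 1"
  "Rm (p + q) = Rm p + Rm q" "Rm (p * q) = Rm q * Rm p" "Rm 1 = 1"
  "Lm p * Rm q = Rm q * Lm p" "Jm * Lm p = Lm p * Jm" "Jm * Rm p = Rm p * Jm"
  "Km * Lm p = Lm p * Km" "Km * Rm p = Rm p * Km" "Jm * Jm = (-1 :: 'q endo)" "Km * Km = (1 :: 'q endo)"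
  "Jm * Km = (- (Km * Jm) :: 'q endo)"
  for p q :: "'q::ring_1"
  by (transfer; simp add: fun_eq_iff prod_plus_simps distrib_left distrib_right mult.assoc)+

lemma central_Lm:
  assumes "central z"
  shows "e * Lm z = Lm z * e" "Lm z = Rm z"
proof -
  show "e * Lm z = Lm z * e"
    using assms by transfer (auto simp: is_endo_def fun_eq_iff scale2_def)
  show "Lm z = Rm z"
    using assms by transfer (simp add: fun_eq_iff central_def)
qed

lemma at_one_simps:
  "at_one (e + f) = at_one e + at_one f" "at_one 0 = 0" "at_one (- e) = - at_one e" "at_one (e - f) = at_one e - at_one f"
  "at_one f = 0 \<Longrightarrow> at_one (e * f) = 0"
proof -
  show "at_one f = 0 \<Longrightarrow> at_one (e * f) = 0"
  proof transfer
    fix f e :: "'a \<times> 'a \<Rightarrow> 'a \<times> 'a"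
    assume "is_endo e"
    then have "e (0 + 0) = e 0 + e 0" unfolding is_endo_def by blast
    then have "e 0 = 0" by simp
    then show "f (1, 0) = 0 \<Longrightarrow> e (f (1, 0)) = 0" by simp
  qed
qed (transfer; simp)+

text \<open>Reversing products makes right multiplication a homomorphism and left multiplication an
  antihomomorphism, the arrangement needed for S on the left leg.\<close>

datatype 'a opp = Opp (unopp: 'a)

instantiation opp :: (ring_1) ring_1
begin

definition "0 = Opp 0"
definition "1 = Opp 1"
definition "x + y = Opp (unopp x + unopp y)"
definition "x - y = Opp (unopp x - unopp y)"
definition "- x = Opp (- unopp x)"
definition "x * y = Opp (unopp y * unopp x)"

instance
  by standard (simp_all add: zero_opp_def one_opp_def plus_opp_def minus_opp_def uminus_opp_def times_opp_def
      algebra_simps)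

end

lemmas opp_defs = zero_opp_def one_opp_def plus_opp_def minus_opp_def uminus_opp_def times_opp_def

section \<open>Coefficientwise maps of power series\<close>

definition fmap :: "('q \<Rightarrow> 'e) \<Rightarrow> 'q fps \<Rightarrow> 'e fps" where
  "fmap k f = Abs_fps (\<lambda>n. k (f $ n))"

lemma fmap_nth [simp]: "fmap k f $ n = k (f $ n)" by (simp add: fmap_def)

locale addmap =
  fixes k :: "'q::ring_1 \<Rightarrow> 'e::ring_1"
  assumes add: "k (x + y) = k x + k y"
begin

lemma zero [simp]: "k 0 = 0" using add[of 0 0] by simp
lemma minus: "k (- x) = - k x" using add[of x "- x"] by (simp add: eq_neg_iff_add_eq_0 add.commute)
lemma diff: "k (x - y) = k x - k y" using add[of x "- y"] by (simp add: minus)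
lemma sum: "k (sum f I) = (\<Sum>i\<in>I. k (f i))"
  by (induction I rule: infinite_finite_induct) (simp_all add: add)

lemma fmap_add: "fmap k (x + y) = fmap k x + fmap k y"
  and fmap_minus: "fmap k (- x) = - fmap k x"
  and fmap_diff: "fmap k (x - y) = fmap k x - fmap k y"
  and fmap_zero: "fmap k 0 = 0"
  and fmap_const: "fmap k (fps_const a) = fps_const (k a)"
  by (rule fps_ext; simp add: add minus diff)+

lemma fmap_sum: "fmap k (sum f I) = (\<Sum>i\<in>I. fmap k (f i))"
  by (rule fps_ext) (simp add: sum fps_sum_nth)

lemma fmap_tsum: "fmap k (tsum f) = tsum (\<lambda>j. fmap k (f j))"
  by (rule fps_ext) (simp add: tsum_def sum)

lemma fmap_hom: "(\<And>x y. k (x * y) = k x * k y) \<Longrightarrow> fmap k (f * g) = fmap k f * fmap k g"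
  by (rule fps_ext) (simp add: fps_mult_nth sum)

lemma fmap_anti: "(\<And>x y. k (x * y) = k y * k x) \<Longrightarrow> fmap k (f * g) = fmap k g * fmap k f"
proof (rule fps_ext)
  fix n assume k: "\<And>x y. k (x * y) = k y * k x"
  have "fmap k (f * g) $ n = (\<Sum>i=0..n. k (g $ (n - i)) * k (f $ i))"
    by (simp add: fps_mult_nth sum k)
  also have "\<dots> = (\<Sum>i=0..n. k (g $ i) * k (f $ (n - i)))"
    by (subst sum.atLeastAtMost_rev) simp
  finally show "fmap k (f * g) $ n = (fmap k g * fmap k f) $ n"
    by (simp add: fps_mult_nth)
qed

end

text \<open>Sorting the left letters in front of the right ones costs exactly
  \<open>tens_sign\<close>. Multiplication after S on one leg, which is defined on words with this
  sign, can so be compared with an honest homomorphism.\<close>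

lemma (in calg) wd_normal_order:
  assumes "scomm p1 p2 (\<lambda>g. A (Inl g)) (\<lambda>g. A (Inr g))"
  shows "wd A u = sc (tens_sign p1 p2 u) * (wd (\<lambda>g. A (Inl g)) (lefts u) * wd (\<lambda>g. A (Inr g)) (rights u))"
proof (induction u)
  case (Cons c u)
  have swap: "A (Inr b) * wd (\<lambda>g. A (Inl g)) w = sc (if p2 b \<and> odd (length (filter p1 w)) then -1 else 1) * (wd (\<lambda>g. A (Inl g)) w * A (Inr b))" for b w
  proof (induction w)
    case (Cons a w)
    have "A (Inr b) * A (Inl a) = sc (if p1 a \<and> p2 b then -1 else 1) * (A (Inl a) * A (Inr b))"
      using scommD[OF assms, of a b] by auto
    then have "A (Inr b) * (A (Inl a) * wd (\<lambda>g. A (Inl g)) w) =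
        sc (if p1 a \<and> p2 b then -1 else 1) * (A (Inl a) * (A (Inr b) * wd (\<lambda>g. A (Inl g)) w))"
      by (simp only: mult.assoc[symmetric])
    then show ?case unfolding Cons.IH
      by (simp only: list.map prod_list.Cons) (auto simp: mult.assoc)
  qed simp
  show ?case
  proof (cases c)
    case (Inl a)
    then show ?thesis using Cons.IH by (simp add: sc_left_commute[of "A (Inl a)"] mult.assoc)
  next
    case (Inr b)
    have "wd A (c # u) = sc (tens_sign p1 p2 u) * ((A (Inr b) * wd (\<lambda>g. A (Inl g)) (lefts u)) * wd (\<lambda>g. A (Inr g)) (rights u))"
      using Cons.IH Inr by (simp add: sc_left_commute[of "A (Inr b)"] mult.assoc)
    also have "\<dots> = sc (tens_sign p1 p2 (c # u)) * (wd (\<lambda>g. A (Inl g)) (lefts (c # u)) * wd (\<lambda>g. A (Inr g)) (rights (c # u)))"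
      unfolding swap using Inr
      by (auto simp: sc_mult sc_minus mult.assoc)
    finally show ?thesis .
  qed
qed simp

section \<open>Signed words and actions from two sides\<close>

fun aword :: "(sv_gen \<Rightarrow> 'q::ring_1) \<Rightarrow> sv_gen list \<Rightarrow> 'q" where
  "aword T [] = 1"
| "aword T (g # w) = (if sv_par g \<and> odd (length (filter sv_par w)) then -1 else 1) * (aword T w * T g)"

lemma (in calg) hs_aword:
  "(\<And>g. ps_fin (\<phi> g)) \<Longrightarrow> hs sc A (ps_aword sv_par \<phi> w) = aword (\<lambda>g. hs sc A (\<phi> g)) w"
  by (induction w) (simp_all add: ser_smul hs_mult ps_fin_aword sc_minus flip: fps_const_neg)

text \<open>The superalgebra acts on \<open>U \<oplus> U\<close>, the two summands recording the parity of an element,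
from one side through \<open>\<theta>\<close> and from the other one through the antipode and \<open>\<eta>\<close>; \<open>J\<close> and \<open>K\<close>
carry the signs.\<close>
locale biact = Q: calg scq + E: calg sce
  for scq :: "'a::field_char_0 \<Rightarrow> 'q::ring_1" and sce :: "'a \<Rightarrow> 'e::ring_1" +
  fixes \<theta> \<eta> :: "'q \<Rightarrow> 'e" and J K :: 'e
  assumes \<theta>_add: "\<theta> (x + y) = \<theta> x + \<theta> y" and \<theta>_mult: "\<theta> (x * y) = \<theta> x * \<theta> y"
    and \<theta>_sc: "\<theta> (scq c) = sce c"
    and \<eta>_add: "\<eta> (x + y) = \<eta> x + \<eta> y" and \<eta>_mult: "\<eta> (x * y) = \<eta> y * \<eta> x"
    and \<eta>_sc: "\<eta> (scq c) = sce c"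
    and \<theta>\<eta>: "\<theta> x * \<eta> y = \<eta> y * \<theta> x"
    and JK: "J * J = - 1" "K * K = 1" "J * K = - (K * J)"
    and J_comm: "J * \<theta> x = \<theta> x * J" "J * \<eta> x = \<eta> x * J"
    and K_comm: "K * \<theta> x = \<theta> x * K" "K * \<eta> x = \<eta> x * K"
begin

sublocale \<theta>: addmap \<theta> by unfold_locales (rule \<theta>_add)
sublocale \<eta>: addmap \<eta> by unfold_locales (rule \<eta>_add)

lemma \<theta>_1: "\<theta> 1 = 1" using \<theta>_sc[of 1] by simp
lemma \<eta>_1: "\<eta> 1 = 1" using \<eta>_sc[of 1] by simp

abbreviation "\<Theta> \<equiv> fmap \<theta>"
abbreviation "H \<equiv> fmap \<eta>"
abbreviation "J' \<equiv> fps_const J"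
abbreviation "K' \<equiv> fps_const K"

lemma \<Theta>_mult: "\<Theta> (x * y) = \<Theta> x * \<Theta> y" by (rule \<theta>.fmap_hom) (rule \<theta>_mult)
lemma H_mult: "H (x * y) = H y * H x" by (rule \<eta>.fmap_anti) (rule \<eta>_mult)
lemma \<Theta>_sc: "\<Theta> (fsc scq c) = fsc sce c" by (simp add: \<theta>.fmap_const \<theta>_sc)
lemma H_sc: "H (fsc scq c) = fsc sce c" by (simp add: \<eta>.fmap_const \<eta>_sc)
lemma \<Theta>_1 [simp]: "\<Theta> 1 = 1" and H_1 [simp]: "H 1 = 1"
  using \<Theta>_sc[of 1] H_sc[of 1] by simp_all

lemma comms: "cm (\<Theta> x) (H y)" "cm J' (\<Theta> x)" "cm J' (H x)" "cm K' (\<Theta> x)" "cm K' (H x)"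
proof -
  have c: "cm (\<theta> a) (\<eta> b)" "cm J (\<theta> a)" "cm J (\<eta> a)" "cm K (\<theta> a)" "cm K (\<eta> a)" for a b
    using \<theta>\<eta> J_comm K_comm by (simp_all add: cm_def)
  show "cm (\<Theta> x) (H y)" "cm J' (\<Theta> x)" "cm J' (H x)" "cm K' (\<Theta> x)" "cm K' (H x)"
    by (rule cm_fps; simp add: c)+
qed

lemma H_comm: "H x * J' = J' * H x" "H x * K' = K' * H x" "\<Theta> x * J' = J' * \<Theta> x" "\<Theta> x * K' = K' * \<Theta> x"
    "H x * \<Theta> y = \<Theta> y * H x"
  using comms[THEN cmD] by simp_all

lemma JK': "J' * J' = - 1" "K' * K' = 1" "J' * K' = - (K' * J')"
  using JK by (simp_all flip: fps_const_neg)

definition hgen :: "(sv_gen \<Rightarrow> 'q fps) \<Rightarrow> sv_gen \<Rightarrow> 'e fps" where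
  "hgen N g = \<Theta> (N g) * (if sv_par g then K' else 1)"

text \<open>J^2 = -1 supplies the sign of a super-antihomomorphism on two odd letters, K^2 = 1 in
  \<open>hgen\<close> supplies none, and J K = - K J makes the two families supercommute.\<close>

definition agen :: "(sv_gen \<Rightarrow> 'q fps) \<Rightarrow> sv_gen \<Rightarrow> 'e fps" where
  "agen T g = H (T g) * (if sv_par g then J' else 1)"

lemma sv_rep_hgen:
  assumes "sv_rep (fsc scq) h N" shows "sv_rep (fsc sce) h (hgen N)"
proof -
  note N = assms[unfolded sv_rep_def]
  have 1: "\<Theta> x * \<Theta> y - \<Theta> y * \<Theta> x = fsc sce c * \<Theta> z" if "x * y - y * x = fsc scq c * z" for x y z c
    using arg_cong[OF that, of \<Theta>] by (simp add: \<theta>.fmap_diff \<Theta>_mult \<Theta>_sc)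
  have 2: "\<Theta> x * \<Theta> y + \<Theta> y * \<Theta> x = fsc sce c * \<Theta> z" if "x * y + y * x = fsc scq c * z" for x y z c
    using arg_cong[OF that, of \<Theta>] by (simp add: \<theta>.fmap_add \<Theta>_mult \<Theta>_sc)
  show ?thesis unfolding sv_rep_def
  proof (intro conjI allI)
    fix i j
    show "hgen N (Lg i) * hgen N (Lg j) - hgen N (Lg j) * hgen N (Lg i) = fsc sce (of_int (j - i)) * hgen N (Lg (i + j))"
      using N by (simp only: hgen_def sv_par.simps if_False mult_1_right) (rule 1, simp)
    have "hgen N (Lg i) * hgen N (Gg j) - hgen N (Gg j) * hgen N (Lg i) =
        (\<Theta> (N (Lg i)) * \<Theta> (N (Gg j)) - \<Theta> (N (Gg j)) * \<Theta> (N (Lg i))) * K'"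
      by (simp add: hgen_def mult.assoc left_diff_distrib cmD[OF comms(4)])
    also have "\<Theta> (N (Lg i)) * \<Theta> (N (Gg j)) - \<Theta> (N (Gg j)) * \<Theta> (N (Lg i)) =
        fsc sce (of_int j + eps_val h - of_int i / 2) * \<Theta> (N (Gg (i + j)))"
      using N by (intro 1) simp
    finally show "hgen N (Lg i) * hgen N (Gg j) - hgen N (Gg j) * hgen N (Lg i) =
        fsc sce (of_int j + eps_val h - of_int i / 2) * hgen N (Gg (i + j))"
      by (simp add: hgen_def mult.assoc)
    have "hgen N (Gg i) * hgen N (Gg j) + hgen N (Gg j) * hgen N (Gg i) =
        (\<Theta> (N (Gg i)) * \<Theta> (N (Gg j)) + \<Theta> (N (Gg j)) * \<Theta> (N (Gg i))) * (K' * K')"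
      by (simp only: hgen_def sv_par.simps if_True mult.assoc distrib_right cm_left_commute[OF comms(4)])
    also have "\<dots> = fsc sce 2 * \<Theta> (N (Lg (i + j + (if h then 1 else 0))))"
      using N unfolding JK' mult_1_right by (intro 2) simp
    finally show "hgen N (Gg i) * hgen N (Gg j) + hgen N (Gg j) * hgen N (Gg i) =
        fsc sce 2 * hgen N (Lg (i + j + (if h then 1 else 0)))"
      by (simp add: hgen_def)
  qed
qed

text \<open>H reverses products and so changes the sign of commutators, which the minus sign
  repairs. For the anticommutator of two odd elements J^2 = -1 provides the missing sign.\<close>

lemma sv_rep_agen:
  assumes "sv_rep (fsc scq) h N" shows "sv_rep (fsc sce) h (agen (\<lambda>g. - N g))"
proof -
  note N = assms[unfolded sv_rep_def]
  have 1: "H x * H y - H y * H x = - (fsc sce c * H z)" if "x * y - y * x = fsc scq c * z" for x y z c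
  proof -
    have "H y * H x - H x * H y = H z * fsc sce c"
      using arg_cong[OF that, of H] by (simp only: \<eta>.fmap_diff H_mult H_sc)
    also have "\<dots> = fsc sce c * H z" by (rule calg.sc_comm[OF E.calg_fps])
    finally show ?thesis by (simp add: algebra_simps)
  qed
  have 2: "H x * H y + H y * H x = fsc sce c * H z" if "x * y + y * x = fsc scq c * z" for x y z c
  proof -
    have "H y * H x + H x * H y = H z * fsc sce c"
      using arg_cong[OF that, of H] by (simp only: \<eta>.fmap_add H_mult H_sc)
    also have "\<dots> = fsc sce c * H z" by (rule calg.sc_comm[OF E.calg_fps])
    finally show ?thesis by (simp add: algebra_simps)
  qed
  have a: "agen (\<lambda>g. - N g) (Lg i) = - H (N (Lg i))" "agen (\<lambda>g. - N g) (Gg i) = - (H (N (Gg i)) * J')" for i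
    by (simp_all add: agen_def \<eta>.fmap_minus)
  show ?thesis unfolding sv_rep_def a
  proof (intro conjI allI)
    fix i j
    have "H (N (Lg i)) * H (N (Lg j)) - H (N (Lg j)) * H (N (Lg i)) = - (fsc sce (of_int (j - i)) * H (N (Lg (i + j))))"
      using N by (intro 1) simp
    then show "- H (N (Lg i)) * - H (N (Lg j)) - - H (N (Lg j)) * - H (N (Lg i)) = fsc sce (of_int (j - i)) * - H (N (Lg (i + j)))"
      by simp
    have "- H (N (Lg i)) * - (H (N (Gg j)) * J') - - (H (N (Gg j)) * J') * - H (N (Lg i)) =
        (H (N (Lg i)) * H (N (Gg j)) - H (N (Gg j)) * H (N (Lg i))) * J'"
      by (simp add: mult.assoc left_diff_distrib cmD[OF comms(3)])
    also have "H (N (Lg i)) * H (N (Gg j)) - H (N (Gg j)) * H (N (Lg i)) =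
        - (fsc sce (of_int j + eps_val h - of_int i / 2) * H (N (Gg (i + j))))"
      using N by (intro 1) simp
    finally show "- H (N (Lg i)) * - (H (N (Gg j)) * J') - - (H (N (Gg j)) * J') * - H (N (Lg i)) =
        fsc sce (of_int j + eps_val h - of_int i / 2) * - (H (N (Gg (i + j))) * J')"
      by (simp add: mult.assoc)
    have "- (H (N (Gg i)) * J') * - (H (N (Gg j)) * J') + - (H (N (Gg j)) * J') * - (H (N (Gg i)) * J') =
        (H (N (Gg i)) * H (N (Gg j)) + H (N (Gg j)) * H (N (Gg i))) * (J' * J')"
      by (simp only: mult_minus_left mult_minus_right minus_minus mult.assoc distrib_right cm_left_commute[OF comms(3)])
    also have "H (N (Gg i)) * H (N (Gg j)) + H (N (Gg j)) * H (N (Gg i)) = fsc sce 2 * H (N (Lg (i + j + (if h then 1 else 0))))"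
      using N by (intro 2) simp
    finally show "- (H (N (Gg i)) * J') * - (H (N (Gg j)) * J') + - (H (N (Gg j)) * J') * - (H (N (Gg i)) * J') =
        fsc sce 2 * - H (N (Lg (i + j + (if h then 1 else 0))))"
      unfolding JK' by simp
  qed
qed

lemma agen_hgen:
  "agen T a * hgen N b = (if sv_par a \<and> sv_par b then -1 else 1) * (hgen N b * agen T a)"
proof -
  have *: "(H x * p) * (\<Theta> y * q) = \<Theta> y * (H x * (p * q))" "(\<Theta> y * q) * (H x * p) = \<Theta> y * (H x * (q * p))"
    if "cm p (\<Theta> y)" "cm q (H x)" for p q x y
    by (simp_all add: mult.assoc cm_left_commute[OF that(1)] cm_left_commute[OF that(2)] cm_left_commute[OF comms(1)])
  define p where "p = (if sv_par a then J' else 1)"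
  define q where "q = (if sv_par b then K' else 1)"
  have c: "cm p (\<Theta> (N b))" "cm q (H (T a))" by (auto simp: p_def q_def comms)
  have pq: "p * q = (if sv_par a \<and> sv_par b then -1 else 1) * (q * p)"
    using JK'(3) by (auto simp: p_def q_def simp del: fps_const_mult)
  show ?thesis unfolding agen_def hgen_def p_def[symmetric] q_def[symmetric] *[OF c] pq
    by (cases "sv_par a \<and> sv_par b") auto
qed

lemma scomm_agen_hgen: "scomm sv_par sv_par (agen T) (hgen N)"
  and scomm_hgen_agen: "scomm sv_par sv_par (hgen N) (agen T)"
  using agen_hgen[of T _ N] by (auto simp: scomm_def)

lemma wd_hgen: "wd (hgen N) w = \<Theta> (wd N w) * (if odd (length (filter sv_par w)) then K' else 1)"
proof (induction w)
  case (Cons g w)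
  have "\<Theta> x * K' * (\<Theta> y * K') = \<Theta> (x * y)" "\<Theta> x * K' * \<Theta> y = \<Theta> (x * y) * K'" for x y
    using JK' by (simp_all add: \<Theta>_mult mult.assoc cm_left_commute[OF comms(4)] cmD[OF comms(4)] del: fps_const_mult)
  then show ?case using Cons by (auto simp: hgen_def \<Theta>_mult mult.assoc)
qed simp

lemma wd_agen: "wd (agen T) w = H (aword T w) * (if odd (length (filter sv_par w)) then J' else 1)"
proof (induction w)
  case (Cons g w)
  have "H x * J' * (H y * J') = - H (y * x)" "H x * J' * H y = H (y * x) * J'" for x y
    using JK' by (simp_all add: H_mult mult.assoc cm_left_commute[OF comms(3)] cmD[OF comms(3)] del: fps_const_mult)
  then show ?case using Cons by (auto simp: agen_def H_mult \<eta>.fmap_minus mult.assoc)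
qed simp

lemma H_fall: "fall (H x) n = H (fall x n)"
proof (induction n)
  case (Suc n)
  have "cm (fall x n) (x - of_nat n)" by (intro cm_intros)
  then have "H (fall x n * (x - of_nat n)) = H ((x - of_nat n) * fall x n)"
    by (simp only: cm_def)
  moreover have "H (of_nat n) = of_nat n"
    using H_sc[of "of_nat n"] by (simp add: fps_of_nat)
  ultimately show ?case using Suc by (simp add: H_mult \<eta>.fmap_diff)
qed simp

lemma \<Theta>_fall: "fall (\<Theta> x) n = \<Theta> (fall x n)"
proof (induction n)
  case (Suc n)
  have "\<Theta> (of_nat n) = of_nat n"
    using \<Theta>_sc[of "of_nat n"] by (simp add: fps_of_nat)
  then show ?case using Suc by (simp add: \<Theta>_mult \<theta>.fmap_diff)
qed simp

lemma H_bin: "bin (fsc sce) (H x) n = H (bin (fsc scq) x n)"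
  unfolding bin_def H_mult H_fall H_sc by (rule calg.sc_comm[OF E.calg_fps, symmetric])

lemma \<Theta>_bin: "bin (fsc sce) (\<Theta> x) n = \<Theta> (bin (fsc scq) x n)"
  unfolding bin_def \<Theta>_mult \<Theta>_fall \<Theta>_sc ..

lemma H_power: "H x ^ n = H (x ^ n)"
proof (induction n)
  case (Suc n)
  then show ?case by (simp only: power_Suc2[of "H x"] power_Suc[of x] H_mult)
qed simp

lemma \<Theta>_power: "\<Theta> x ^ n = \<Theta> (x ^ n)"
  by (induction n) (simp_all add: \<Theta>_mult)

lemma neg1_power: "(-1) ^ n = H ((-1) ^ n)" "(-1) ^ n = \<Theta> ((-1) ^ n)"
proof -
  have "H (-1) = -1" "\<Theta> (-1) = -1" by (simp_all add: \<eta>.fmap_minus \<theta>.fmap_minus)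
  then show "(-1) ^ n = H ((-1) ^ n)" "(-1) ^ n = \<Theta> ((-1) ^ n)"
    unfolding H_power[symmetric] \<Theta>_power[symmetric] by simp_all
qed

lemma Xel_hgen: "Xel (fsc sce) m \<alpha> (\<lambda>i. hgen N (Lg i)) = \<Theta> (Xel (fsc scq) m \<alpha> (\<lambda>i. N (Lg i)))"
  "Yel (fsc sce) m \<alpha> (\<lambda>i. hgen N (Lg i)) = \<Theta> (Yel (fsc scq) m \<alpha> (\<lambda>i. N (Lg i)))"
  by (simp_all add: Xel_def Yel_def hgen_def \<Theta>_mult \<theta>.fmap_add \<theta>.fmap_const \<theta>_sc)

lemma Xel_agen: "Xel (fsc sce) m \<alpha> (\<lambda>i. agen N (Lg i)) = H (Xel (fsc scq) m \<alpha> (\<lambda>i. N (Lg i)))"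
  "Yel (fsc sce) m \<alpha> (\<lambda>i. agen N (Lg i)) = H (Yel (fsc scq) m \<alpha> (\<lambda>i. N (Lg i)))"
  by (simp_all add: Xel_def Yel_def agen_def H_mult \<eta>.fmap_add \<eta>.fmap_const \<eta>_sc
      calg.sc_comm[OF E.calg_fps] distrib_left)

end

lemma Xel_minus: "Xel sc m \<alpha> (\<lambda>i. - L i) = - Xel sc m \<alpha> L" "Yel sc m \<alpha> (\<lambda>i. - L i) = - Yel sc m \<alpha> L"
  by (simp_all add: Xel_def Yel_def algebra_simps)

text \<open>\<open>\<epsilon>\<close> is evaluation at the unit and Z consists of elements
  annihilating it. Multiplications by one element from the two sides agree on the unit, and so do J
  and K.\<close>

locale biact_eval = biact scq sce \<theta> \<eta> J K
  for scq :: "'a::field_char_0 \<Rightarrow> 'q::ring_1" and sce :: "'a \<Rightarrow> 'e::ring_1" and \<theta> \<eta> J K +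
  fixes \<epsilon> :: "'e \<Rightarrow> 'q" and Z :: "'e \<Rightarrow> bool"
  assumes \<epsilon>_add: "\<epsilon> (x + y) = \<epsilon> x + \<epsilon> y" and \<epsilon>_sc: "\<epsilon> (sce c * x) = scq c * \<epsilon> x"
    and \<epsilon>_\<eta>: "\<epsilon> (\<eta> p * (if b then J else 1)) = p"
    and Z_\<epsilon>: "Z x \<Longrightarrow> \<epsilon> x = 0" and Z_0: "Z 0" and Z_diff: "Z x \<Longrightarrow> Z y \<Longrightarrow> Z (x - y)"
    and Z_\<theta>\<eta>: "Z (\<theta> p - \<eta> p)" and Z_KJ: "Z (K - J)"
begin

sublocale \<epsilon>: addmap \<epsilon> by unfold_locales (rule \<epsilon>_add)

lemma \<epsilon>_1: "\<epsilon> 1 = 1" using \<epsilon>_\<eta>[of 1 False] by (simp add: \<eta>_1)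

lemma Z_minus: "Z x \<Longrightarrow> Z (- x)" using Z_diff[OF Z_0, of x] by simp
lemma Z_add: "Z x \<Longrightarrow> Z y \<Longrightarrow> Z (x + y)" using Z_diff[OF _ Z_minus, of x y] by simp
lemma Z_sum: "(\<And>i. i \<in> I \<Longrightarrow> Z (f i)) \<Longrightarrow> Z (sum f I)"
  by (induction I rule: infinite_finite_induct) (auto simp: Z_0 Z_add)

definition ZF :: "'e fps \<Rightarrow> bool" where "ZF x \<longleftrightarrow> (\<forall>n. Z (x $ n))"

lemma ZF_add: "ZF x \<Longrightarrow> ZF y \<Longrightarrow> ZF (x + y)" and ZF_diff: "ZF x \<Longrightarrow> ZF y \<Longrightarrow> ZF (x - y)"
  and ZF_minus: "ZF x \<Longrightarrow> ZF (- x)"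
  by (simp_all add: ZF_def Z_add Z_diff Z_0 Z_minus)

lemma ZF_tsum: "(\<And>j. ZF (f j)) \<Longrightarrow> ZF (tsum f)"
  by (simp add: ZF_def tsum_def Z_sum)

lemma ZF_\<Theta>H: "ZF (\<Theta> q - H q)" and ZF_H\<Theta>: "ZF (H q - \<Theta> q)"
  using Z_\<theta>\<eta> Z_minus[OF Z_\<theta>\<eta>] by (simp_all add: ZF_def)

lemma ZF_KJ: "ZF ((if b then K' else 1) - (if b then J' else 1))" "ZF ((if b then J' else 1) - (if b then K' else 1))"
  using Z_KJ Z_minus[OF Z_KJ] by (auto simp: ZF_def Z_0)

lemma fmap_ZF: "ZF x \<Longrightarrow> fmap \<epsilon> x = 0"
  by (rule fps_ext) (simp add: ZF_def Z_\<epsilon>)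

lemma fmap_ser: "fmap \<epsilon> (ser sce W x) = ser scq (\<lambda>u. fmap \<epsilon> (W u)) x"
proof -
  have "fmap \<epsilon> (fsc sce c * y) = fsc scq c * fmap \<epsilon> y" for c y
    by (rule fps_ext) (simp add: \<epsilon>_sc)
  then show ?thesis by (simp add: ser_def \<epsilon>.fmap_tsum lin_def \<epsilon>.fmap_sum)
qed

lemma fmap_wd_agen: "fmap \<epsilon> (wd (agen T) w) = aword T w"
  unfolding wd_agen by (rule fps_ext) (use \<epsilon>_\<eta>[of _ True] \<epsilon>_\<eta>[of _ False] in simp)

text \<open>Nonempty words contribute nothing as their coproduct annihilates the unit; the empty
  word that is left is what the counit sees.\<close>

lemma fmap_hs_Delta:
  fixes x :: "(sv_gen,'a) ps" and m :: int and \<alpha> :: 'a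
  assumes m: "m \<noteq> 0" and x: "ps_fin x" and k: "kills (fsc sce) \<psi> (sv_rel2 h)"
    and Z: "\<And>g w. ZF (wd (\<lambda>g. hs sce \<psi> (Delta_raw m \<alpha> g)) (g # w))"
  shows "fmap \<epsilon> (hs sce \<psi> (sv_Delta h m \<alpha> x)) = ser scq (\<lambda>u. if u = [] then 1 else 0) x"
proof -
  have "fmap \<epsilon> (wd (\<lambda>g. hs sce \<psi> (Delta_raw m \<alpha> g)) u) = (if u = [] then 1 else 0)" for u
  proof (cases u)
    case Nil
    have "fmap \<epsilon> 1 = 1" by (rule fps_ext) (simp add: \<epsilon>_1)
    then show ?thesis using Nil by simp
  qed (use Z in \<open>simp add: fmap_ZF\<close>)
  then show ?thesis
    using x by (simp add: sv_Delta_def E.hs_hom_ext fmap_ser E.hs_Delta_gen[OF m k])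
qed

end

text \<open>In the opposite ring the annihilator of the unit is a right ideal, so the first letter
  of a word decides; in \<open>biact_left\<close> it is the last one.\<close>

locale biact_right = biact_eval scq sce \<theta> \<eta> J K \<epsilon> Z
  for scq :: "'a::field_char_0 \<Rightarrow> 'q::ring_1" and sce :: "'a \<Rightarrow> 'e::ring_1" and \<theta> \<eta> J K \<epsilon> Z +
  assumes Z_mult: "Z x \<Longrightarrow> Z (x * y)"
    and \<epsilon>_right: "\<epsilon> (\<eta> p * (if b then J else 1) * (\<theta> q * (if c then K else 1))) = p * q"
begin

lemma ZF_mult: "ZF x \<Longrightarrow> ZF (x * y)"
  by (simp add: ZF_def fps_mult_nth Z_sum Z_mult)

text \<open>On the unit F acts as \<open>H u\<close>, by \<open>pw_antipode_left\<close>. What g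
  \<otimes> 1 + 1 \<otimes> g then contributes is S(g) u + u g, which is 0.\<close>

lemma ZF_Delta:
  fixes A :: "sv_gen \<Rightarrow> 'q" and m :: int and \<alpha> :: 'a
  assumes m: "m \<noteq> 0" and A: "sv_rep scq h A"
  defines "X \<equiv> Xel scq m \<alpha> (\<lambda>i. A (Lg i))" and "Y \<equiv> Yel scq m \<alpha> (\<lambda>i. A (Lg i))"
  defines "T \<equiv> \<lambda>g. - (uexp scq (X * Y) * fps_const (A g) * uexp scq (- (X * Y)))"
  shows "ZF (hs sce (case_sum (agen T) (hgen (\<lambda>g. fps_const (A g)))) (Delta_raw m \<alpha> g))"
proof -
  interpret U: calg_XY scq X Y
    by unfold_locales (use Q.Xel_Yel[OF Q.weights_L[OF A m]] in \<open>simp add: X_def Y_def comp_def\<close>)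
  interpret F: calg "fsc scq" by (rule Q.calg_fps)
  let ?N = "\<lambda>g. fps_const (A g)"
  let ?SX = "U.u * fps_const (- X) * U.ui" and ?Y = "fps_const Y"
  have T: "T g = U.u * fps_const (- A g) * U.ui" for g
    by (simp add: T_def U.u_def U.ui_def flip: fps_const_neg)
  have X: "Xel (fsc scq) m \<alpha> (\<lambda>i. T (Lg i)) = ?SX"
    unfolding T Xel_conj[OF F.calg_axioms U.u_ui(1)] Xel_const Xel_minus X_def[symmetric] ..
  define p where "p j = (-1) ^ j * bin (fsc scq) ?SX j" for j
  have eq: "pw sce (\<Theta> ?Y) (H ?SX) = tsum (\<lambda>j. H (p j) * \<Theta> (?Y ^ j))"
  proof -
    have "(-1) ^ j * bin (fsc sce) (H ?SX) j = H (p j)" for j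
    proof -
      have "cm (bin (fsc scq) ?SX j) ((-1) ^ j)" by (intro cm_intros)
      then have "p j = bin (fsc scq) ?SX j * (-1) ^ j" by (simp add: p_def cm_def)
      then show ?thesis unfolding H_bin by (simp add: neg1_power(1)[of j] H_mult)
    qed
    then show ?thesis by (simp add: pw_def \<Theta>_power)
  qed
  have Hu: "H U.u = tsum (\<lambda>j. H (?Y ^ j) * H (p j))"
  proof -
    have "U.u = tsum (\<lambda>j. p j * ?Y ^ j)" using U.pw_antipode_left by (simp add: pw_def p_def)
    then have "H U.u = H (tsum (\<lambda>j. p j * ?Y ^ j))" by simp
    then show ?thesis by (simp add: \<eta>.fmap_tsum H_mult)
  qed
  let ?F = "pw sce (\<Theta> ?Y) (H ?SX)" and ?J = "if sv_par g then J' else 1" and ?K = "if sv_par g then K' else 1"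
  \<comment> \<open>On the unit each power of Y may pass from \<Theta> to H. The antihomomorphism H
    then assembles the factors in the order of \<open>pw_antipode_left\<close>.\<close>
  have ZFu: "ZF (?F - H U.u)"
  proof -
    have "?F = tsum (\<lambda>j. (\<Theta> (?Y ^ j) - H (?Y ^ j)) * H (p j) + H (?Y ^ j) * H (p j))"
      unfolding eq H_comm(5) by (simp add: left_diff_distrib)
    then have "?F - H U.u = tsum (\<lambda>j. (\<Theta> (?Y ^ j) - H (?Y ^ j)) * H (p j))"
      unfolding Hu tsum_add by simp
    then show ?thesis by (simp add: ZF_tsum ZF_mult ZF_\<Theta>H)
  qed
  have JK: "H x * ?K = ?K * H x" "H x * ?J = ?J * H x" for x using H_comm by auto
  have "T g * U.u + U.u * ?N g = 0"
    by (simp add: T mult.assoc flip: fps_const_neg)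
  then have 0: "H (T g * U.u) + H (U.u * ?N g) = 0" by (simp add: \<eta>.fmap_zero flip: \<eta>.fmap_add)
  \<comment> \<open>The first three summands lie in the annihilator: they trade F for
    \<open>H u\<close>, \<Theta> for H and K for J. The last one vanishes by
    \<open>0\<close>.\<close>
  have "?F * (agen T g + hgen ?N g) = (?F - H U.u) * (agen T g + hgen ?N g) + (\<Theta> (?N g) - H (?N g)) * (H U.u * ?K)
      + (?K - ?J) * H (U.u * ?N g) + ?J * (H (T g * U.u) + H (U.u * ?N g))"
  proof -
    have a: "H U.u * agen T g = ?J * H (T g * U.u)"
      unfolding JK(2)[symmetric] unfolding agen_def H_mult by (simp only: mult.assoc)
    have b: "H U.u * hgen ?N g = (\<Theta> (?N g) - H (?N g)) * (H U.u * ?K) + ?K * H (U.u * ?N g)"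
      unfolding JK(1)[symmetric] unfolding hgen_def H_mult
      by (simp only: left_diff_distrib mult.assoc[symmetric] H_comm(5) diff_add_cancel)
    have "?F * (agen T g + hgen ?N g) = (?F - H U.u) * (agen T g + hgen ?N g) + (H U.u * agen T g + H U.u * hgen ?N g)"
      by (simp add: left_diff_distrib distrib_left)
    then show ?thesis unfolding a b by (simp only: left_diff_distrib distrib_left) (simp only: add_ac diff_conv_add_uminus, simp)
  qed
  then have "ZF (?F * (agen T g + hgen ?N g))"
    unfolding 0 using ZFu ZF_\<Theta>H ZF_KJ(1) by (simp add: ZF_add ZF_mult)
  then have "ZF (?F * (agen T g + hgen ?N g) * pw sce (\<Theta> ?Y) (- H ?SX))" by (rule ZF_mult)
  then show ?thesis
    by (simp add: E.hs_Delta_raw Xel_agen Xel_hgen X Xel_const flip: Y_def)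
qed

lemma antipode_right:
  fixes A :: "sv_gen \<Rightarrow> 'q" and m :: int and \<alpha> :: 'a and x :: "(sv_gen,'a) ps"
  assumes m: "m \<noteq> 0" and A: "sv_rep scq h A" and x: "ps_fin x"
  shows "hs scq (\<lambda>g. fps_const (A g)) (sv_mult_S_id h m \<alpha> (sv_Delta h m \<alpha> x)) = ser scq (\<lambda>u. if u = [] then 1 else 0) x"
proof -
  let ?N = "\<lambda>g. fps_const (A g)"
  define T where "T g = hs scq ?N (sv_S_gen h m \<alpha> g)" for g
  note T_eq = Q.ce_S_gen[OF m A, of \<alpha>, folded T_def]
  let ?\<psi> = "case_sum (agen T) (hgen ?N)"
  have u1: "uexp scq x * uexp scq (- x) = 1" "uexp scq (- x) * uexp scq x = 1" for x
    by (rule Q.uexp_inverse)+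
  have T: "sv_rep (fsc sce) h (agen T)" unfolding T_eq[abs_def]
    by (rule sv_rep_agen, rule calg.sv_rep_conj[OF Q.calg_fps], rule Q.sv_rep_const[OF A]) (rule u1)+
  have k: "kills (fsc sce) ?\<psi> (sv_rel2 h)"
    unfolding calg.kills_sv_rel2[OF E.calg_fps]
    by (simp add: comp_def T sv_rep_hgen Q.sv_rep_const A scomm_agen_hgen)
  have raw: "hs scq ?N (ps_smul (tens_sign sv_par sv_par u)
       (ps_mult (ps_aword sv_par (sv_S_gen h m \<alpha>) (lefts u)) (ps_const (fa_word (rights u))))) = fmap \<epsilon> (wd ?\<psi> u)" for u
  proof -
    have "hs scq ?N (ps_smul (tens_sign sv_par sv_par u)
       (ps_mult (ps_aword sv_par (sv_S_gen h m \<alpha>) (lefts u)) (ps_const (fa_word (rights u))))) =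
       fsc scq (tens_sign sv_par sv_par u) * (aword T (lefts u) * fps_const (wd A (rights u)))"
      by (simp add: Q.ser_smul Q.hs_mult ps_fin_aword Q.hs_aword T_def[abs_def] Q.ce_const)
    moreover have "wd ?\<psi> u = fsc sce (tens_sign sv_par sv_par u) * (wd (agen T) (lefts u) * wd (hgen ?N) (rights u))"
      using calg.wd_normal_order[OF E.calg_fps, of sv_par sv_par ?\<psi> u] by (simp add: scomm_agen_hgen)
    moreover have "\<Theta> (wd ?N w) = fps_const (\<theta> (wd A w))" for w
      by (simp add: Q.wd_fps_const \<theta>.fmap_const)
    ultimately show ?thesis unfolding wd_agen wd_hgen
      by (intro fps_ext) (use \<epsilon>_right[of _ True _ True] \<epsilon>_right[of _ True _ False] \<epsilon>_right[of _ False _ True]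
          \<epsilon>_right[of _ False _ False] in \<open>simp add: \<epsilon>_sc\<close>)
  qed
  have Z: "ZF (hs sce ?\<psi> (Delta_raw m \<alpha> g))" for g
    unfolding T_eq[abs_def] by (rule ZF_Delta[OF m A])
  have "hs scq ?N (sv_mult_S_id h m \<alpha> (sv_Delta h m \<alpha> x)) = fmap \<epsilon> (hs sce ?\<psi> (sv_Delta h m \<alpha> x))"
    unfolding sv_mult_S_id_def using x
    by (subst Q.ser_ser_ext) (simp_all add: raw fmap_ser ps_fin_aword)
  also have "\<dots> = ser scq (\<lambda>u. if u = [] then 1 else 0) x"
    by (rule fmap_hs_Delta[OF m x k]) (simp add: ZF_mult Z)
  finally show ?thesis .
qed

text \<open>The super-antihomomorphism S is the homomorphism given by \<open>agen T\<close> followed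
  by evaluation at the unit, so it is enough that \<open>agen T\<close> satisfies the
  relations.\<close>

lemma antipode_kills:
  fixes A :: "sv_gen \<Rightarrow> 'q" and m :: int and \<alpha> :: 'a
  assumes m: "m \<noteq> 0" and A: "sv_rep scq h A" and f: "f \<in> fa_ideal (sv_rel h)"
  shows "hs scq (\<lambda>g. fps_const (A g)) (sv_S h m \<alpha> (ps_const f)) = 0"
proof -
  let ?N = "\<lambda>g. fps_const (A g)"
  interpret FE: calg "fsc sce" by (rule E.calg_fps)
  define T where "T g = hs scq ?N (sv_S_gen h m \<alpha> g)" for g
  note T_eq = Q.ce_S_gen[OF m A, of \<alpha>, folded T_def]
  have "sv_rep (fsc sce) h (agen T)" unfolding T_eq[abs_def]
    by (rule sv_rep_agen, rule calg.sv_rep_conj[OF Q.calg_fps], rule Q.sv_rep_const[OF A]) (rule Q.uexp_inverse)+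
  then have k: "kills (fsc sce) (agen T) (sv_rel h)" by (simp add: FE.kills_sv_rel)
  have f': "fa_fin f \<and> hv (fsc sce) (agen T) f = 0"
    using FE.hv_ideal[OF f, of "agen T"] k good_sv_rel[of h, where 'a = 'a] by (simp add: kills_def good_rel_def)
  then have "hs scq ?N (sv_S h m \<alpha> (ps_const f)) = ser scq (\<lambda>u. fmap \<epsilon> (wd (agen T) u)) (ps_const f)"
    unfolding sv_S_def anti_ext_def
    by (subst Q.ser_ser_ext) (simp_all add: ps_fin_aword Q.hs_aword T_def[abs_def] fmap_wd_agen)
  also have "\<dots> = fmap \<epsilon> (hv (fsc sce) (agen T) f)" by (simp add: E.ser_const flip: fmap_ser)
  finally show ?thesis using f' by (simp add: \<epsilon>.fmap_zero)
qed

end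

locale biact_left = biact_eval scq sce \<theta> \<eta> J K \<epsilon> Z
  for scq :: "'a::field_char_0 \<Rightarrow> 'q::ring_1" and sce :: "'a \<Rightarrow> 'e::ring_1" and \<theta> \<eta> J K \<epsilon> Z +
  assumes Z_mult: "Z x \<Longrightarrow> Z (y * x)"
    and \<epsilon>_left: "\<epsilon> (\<theta> q * (if c then K else 1) * (\<eta> p * (if b then J else 1))) = q * p"
begin

lemma ZF_mult: "ZF x \<Longrightarrow> ZF (y * x)"
  by (simp add: ZF_def fps_mult_nth Z_sum Z_mult)

text \<open>Now the annihilator is a left ideal, so F^-1 meets the unit first and acts there as
  \<open>\<Theta> u^-1\<close>, by \<open>pw_antipode_right\<close>. The remainder is g u^-1 + u^-1
  S(g) = 0.\<close>

lemma ZF_Delta: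
  fixes A :: "sv_gen \<Rightarrow> 'q" and m :: int and \<alpha> :: 'a
  assumes m: "m \<noteq> 0" and A: "sv_rep scq h A"
  defines "X \<equiv> Xel scq m \<alpha> (\<lambda>i. A (Lg i))" and "Y \<equiv> Yel scq m \<alpha> (\<lambda>i. A (Lg i))"
  defines "T \<equiv> \<lambda>g. - (uexp scq (X * Y) * fps_const (A g) * uexp scq (- (X * Y)))"
  shows "ZF (hs sce (case_sum (hgen (\<lambda>g. fps_const (A g))) (agen T)) (Delta_raw m \<alpha> g))"
proof -
  interpret U: calg_XY scq X Y
    by unfold_locales (use Q.Xel_Yel[OF Q.weights_L[OF A m]] in \<open>simp add: X_def Y_def comp_def\<close>)
  interpret F: calg "fsc scq" by (rule Q.calg_fps)
  let ?N = "\<lambda>g. fps_const (A g)"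
  let ?SY = "U.u * fps_const (- Y) * U.ui" and ?X = "fps_const (- X)"
  have T: "T g = U.u * fps_const (- A g) * U.ui" for g
    by (simp add: T_def U.u_def U.ui_def flip: fps_const_neg)
  have Y: "Yel (fsc scq) m \<alpha> (\<lambda>i. T (Lg i)) = ?SY"
    unfolding T Xel_conj[OF F.calg_axioms U.u_ui(1)] Xel_const Xel_minus Y_def[symmetric] ..
  define p where "p j = (-1) ^ j * bin (fsc scq) ?X j" for j
  have eq: "pw sce (H ?SY) (\<Theta> ?X) = tsum (\<lambda>j. \<Theta> (p j) * H (?SY ^ j))"
    by (simp add: pw_def H_power p_def \<Theta>_mult \<Theta>_bin neg1_power(2)[symmetric])
  have Hu: "\<Theta> U.ui = tsum (\<lambda>j. \<Theta> (p j) * \<Theta> (?SY ^ j))"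
  proof -
    have "U.ui = tsum (\<lambda>j. p j * ?SY ^ j)" using U.pw_antipode_right by (simp add: pw_def p_def)
    then have "\<Theta> U.ui = \<Theta> (tsum (\<lambda>j. p j * ?SY ^ j))" by simp
    then show ?thesis by (simp add: \<theta>.fmap_tsum \<Theta>_mult)
  qed
  let ?F = "pw sce (H ?SY) (\<Theta> ?X)" and ?J = "if sv_par g then J' else 1" and ?K = "if sv_par g then K' else 1"
  have ZFu: "ZF (?F - \<Theta> U.ui)"
  proof -
    have "?F = tsum (\<lambda>j. \<Theta> (p j) * (H (?SY ^ j) - \<Theta> (?SY ^ j)) + \<Theta> (p j) * \<Theta> (?SY ^ j))"
      unfolding eq by (simp add: right_diff_distrib)
    then have "?F - \<Theta> U.ui = tsum (\<lambda>j. \<Theta> (p j) * (H (?SY ^ j) - \<Theta> (?SY ^ j)))"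
      unfolding Hu tsum_add by simp
    then show ?thesis by (simp add: ZF_tsum ZF_mult ZF_H\<Theta>)
  qed
  have JK: "\<Theta> x * ?K = ?K * \<Theta> x" "\<Theta> x * ?J = ?J * \<Theta> x" "H x * ?J = ?J * H x" for x using H_comm by auto
  have "?N g * U.ui + U.ui * T g = 0"
    by (simp add: T mult.assoc[symmetric] flip: fps_const_neg)
  then have 0: "\<Theta> (?N g * U.ui) + \<Theta> (U.ui * T g) = 0" by (simp add: \<theta>.fmap_zero flip: \<theta>.fmap_add)
  have "(hgen ?N g + agen T g) * ?F = (hgen ?N g + agen T g) * (?F - \<Theta> U.ui) + \<Theta> U.ui * ?J * (H (T g) - \<Theta> (T g))
      + \<Theta> (U.ui * T g) * (?J - ?K) + (\<Theta> (?N g * U.ui) + \<Theta> (U.ui * T g)) * ?K"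
  proof -
    have a: "hgen ?N g * \<Theta> U.ui = \<Theta> (?N g * U.ui) * ?K"
      unfolding hgen_def \<Theta>_mult by (simp only: mult.assoc JK(1)[of U.ui])
    have b: "agen T g * \<Theta> U.ui = \<Theta> U.ui * ?J * (H (T g) - \<Theta> (T g)) + \<Theta> (U.ui * T g) * ?J"
    proof -
      have "agen T g * \<Theta> U.ui = H (T g) * \<Theta> U.ui * ?J" unfolding agen_def by (simp only: mult.assoc JK(2)[of U.ui])
      also have "\<dots> = \<Theta> U.ui * ?J * H (T g)" unfolding H_comm(5) by (simp only: mult.assoc JK(3))
      finally show ?thesis unfolding \<Theta>_mult by (simp only: right_diff_distrib mult.assoc JK(2)[of "T g"]) simp
    qed
    have "(hgen ?N g + agen T g) * ?F = (hgen ?N g + agen T g) * (?F - \<Theta> U.ui) + (hgen ?N g * \<Theta> U.ui + agen T g * \<Theta> U.ui)"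
      by (simp add: right_diff_distrib distrib_right)
    then show ?thesis unfolding a b by (simp only: right_diff_distrib distrib_right) (simp only: add_ac diff_conv_add_uminus, simp)
  qed
  then have "ZF ((hgen ?N g + agen T g) * ?F)"
    unfolding 0 using ZFu ZF_H\<Theta> ZF_KJ(2) by (simp add: ZF_add ZF_mult)
  then have "ZF (pw sce (H ?SY) (- \<Theta> ?X) * ((hgen ?N g + agen T g) * ?F))" by (rule ZF_mult)
  moreover have "\<Theta> (fps_const X) = - \<Theta> ?X"
    by (simp add: \<theta>.fmap_minus flip: fps_const_neg)
  ultimately show ?thesis
    by (simp add: E.hs_Delta_raw Xel_agen Xel_hgen Y Xel_const X_def[symmetric] mult.assoc)
qed

lemma antipode_left:
  fixes A :: "sv_gen \<Rightarrow> 'q" and m :: int and \<alpha> :: 'a and x :: "(sv_gen,'a) ps"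
  assumes m: "m \<noteq> 0" and A: "sv_rep scq h A" and x: "ps_fin x"
  shows "hs scq (\<lambda>g. fps_const (A g)) (sv_mult_id_S h m \<alpha> (sv_Delta h m \<alpha> x)) = ser scq (\<lambda>u. if u = [] then 1 else 0) x"
proof -
  let ?N = "\<lambda>g. fps_const (A g)"
  define T where "T g = hs scq ?N (sv_S_gen h m \<alpha> g)" for g
  note T_eq = Q.ce_S_gen[OF m A, of \<alpha>, folded T_def]
  let ?\<psi> = "case_sum (hgen ?N) (agen T)"
  have T: "sv_rep (fsc sce) h (agen T)" unfolding T_eq[abs_def]
    by (rule sv_rep_agen, rule calg.sv_rep_conj[OF Q.calg_fps], rule Q.sv_rep_const[OF A]) (rule Q.uexp_inverse)+
  have k: "kills (fsc sce) ?\<psi> (sv_rel2 h)"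
    unfolding calg.kills_sv_rel2[OF E.calg_fps]
    by (simp add: comp_def T sv_rep_hgen Q.sv_rep_const A scomm_hgen_agen)
  have raw: "hs scq ?N (ps_smul (tens_sign sv_par sv_par u)
       (ps_mult (ps_const (fa_word (lefts u))) (ps_aword sv_par (sv_S_gen h m \<alpha>) (rights u)))) = fmap \<epsilon> (wd ?\<psi> u)" for u
  proof -
    have "hs scq ?N (ps_smul (tens_sign sv_par sv_par u)
       (ps_mult (ps_const (fa_word (lefts u))) (ps_aword sv_par (sv_S_gen h m \<alpha>) (rights u)))) =
       fsc scq (tens_sign sv_par sv_par u) * (fps_const (wd A (lefts u)) * aword T (rights u))"
      by (simp add: Q.ser_smul Q.hs_mult ps_fin_aword Q.hs_aword T_def[abs_def] Q.ce_const)
    moreover have "wd ?\<psi> u = fsc sce (tens_sign sv_par sv_par u) * (wd (hgen ?N) (lefts u) * wd (agen T) (rights u))"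
      using calg.wd_normal_order[OF E.calg_fps, of sv_par sv_par ?\<psi> u] by (simp add: scomm_hgen_agen)
    moreover have "\<Theta> (wd ?N w) = fps_const (\<theta> (wd A w))" for w
      by (simp add: Q.wd_fps_const \<theta>.fmap_const)
    ultimately show ?thesis unfolding wd_agen wd_hgen
      by (intro fps_ext) (use \<epsilon>_left[of _ True _ True] \<epsilon>_left[of _ True _ False] \<epsilon>_left[of _ False _ True]
          \<epsilon>_left[of _ False _ False] in \<open>simp add: \<epsilon>_sc mult.assoc\<close>)
  qed
  \<comment> \<open>Only the last letter acts on the unit directly, hence an induction that reaches
    it from the left.\<close>
  have Z: "ZF (wd (\<lambda>g. hs sce ?\<psi> (Delta_raw m \<alpha> g)) (g # w))" for g w
  proof (induction w arbitrary: g)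
    case Nil
    have "ZF (hs sce ?\<psi> (Delta_raw m \<alpha> g))"
      unfolding T_eq[abs_def] by (rule ZF_Delta[OF m A])
    then show ?case by simp
  next
    case (Cons g' w)
    show ?case unfolding list.map(2)[of _ g] prod_list.Cons by (rule ZF_mult) (use Cons.IH[of g'] in simp)
  qed
  have "hs scq ?N (sv_mult_id_S h m \<alpha> (sv_Delta h m \<alpha> x)) = fmap \<epsilon> (hs sce ?\<psi> (sv_Delta h m \<alpha> x))"
    unfolding sv_mult_id_S_def using x
    by (subst Q.ser_ser_ext) (simp_all add: raw fmap_ser ps_fin_aword)
  also have "\<dots> = ser scq (\<lambda>u. if u = [] then 1 else 0) x"
    by (rule fmap_hs_Delta[OF m x k Z])
  finally show ?thesis .
qed

end

section \<open>Realisation by endomorphisms of the doubled algebra, evaluated at its unit\<close>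

definition psum :: "'q::ring_1 \<times> 'q \<Rightarrow> 'q" where "psum x = fst x + snd x"

lemma psum_simps: "psum (x + y) = psum x + psum y" "psum 0 = 0"
  by (simp_all add: psum_def)

lemma at_one_mult:
  "at_one 1 = (1, 0)" "at_one (Lm p * e) = (p * fst (at_one e), p * snd (at_one e))"
  "at_one (Rm p * e) = (fst (at_one e) * p, snd (at_one e) * p)"
  "at_one (Jm * e) = (- snd (at_one e), fst (at_one e))" "at_one (Km * e) = (snd (at_one e), fst (at_one e))"
  by (transfer; simp)+

lemma at_one_gens:
  "at_one (Lm p) = (p, 0)" "at_one (Rm p) = (p, 0)" "at_one Jm = (0, 1)" "at_one Km = (0, 1)"
  by (transfer; simp)+

context calg
begin

lemma central_sc: "central (sc c)"
  by (simp add: central_def sc_comm)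

lemma biact_left_endo:
  "biact_left sc (\<lambda>c. Lm (sc c)) Lm Rm Jm Km (\<lambda>e. psum (at_one e)) (\<lambda>e. at_one e = 0)"
proof
  fix x y p q :: 'b and c d :: 'a and e f :: "'b endo" and b b' :: bool
  show "Lm (sc (c + d)) = Lm (sc c) + Lm (sc d)" "Lm (sc (c * d)) = Lm (sc c) * Lm (sc d)" "Lm (sc 1) = 1"
    by (simp_all add: sc_add sc_mult endo_simps)
  show "e * Lm (sc c) = Lm (sc c) * e" by (rule central_Lm[OF central_sc])
  show "Rm (sc c) = Lm (sc c)" by (rule central_Lm(2)[OF central_sc, symmetric])
  show "at_one e = 0 \<Longrightarrow> at_one (f * e) = 0" by (rule at_one_simps)
  show "psum (at_one (Lm q * (if b' then Km else 1) * (Rm p * (if b then Jm else 1)))) = q * p"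
    by (cases b; cases b') (simp_all add: mult.assoc at_one_mult at_one_gens psum_def)
  show "psum (at_one (Rm p * (if b then Jm else 1))) = p"
    by (cases b) (simp_all add: at_one_mult at_one_gens psum_def)
  show "psum (at_one (Lm (sc c) * e)) = sc c * psum (at_one e)"
    by (simp add: at_one_mult psum_def distrib_left)
qed (simp_all add: endo_simps at_one_simps psum_simps at_one_gens)

lemma biact_right_endo:
  "biact_right sc (\<lambda>c. Opp (Lm (sc c))) (\<lambda>q. Opp (Rm q)) (\<lambda>p. Opp (Lm p)) (Opp Jm) (Opp Km)
    (\<lambda>e. psum (at_one (unopp e))) (\<lambda>e. at_one (unopp e) = 0)"
proof
  fix x y p q :: 'b and c d :: 'a and e f :: "'b endo opp" and b b' :: bool
  show "Opp (Lm (sc (c + d))) = Opp (Lm (sc c)) + Opp (Lm (sc d))" "Opp (Lm (sc (c * d))) = Opp (Lm (sc c)) * Opp (Lm (sc d))"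
    "Opp (Lm (sc 1)) = 1"
    using sc_mult[of d c] by (simp_all add: sc_add endo_simps opp_defs mult.commute)
  show "e * Opp (Lm (sc c)) = Opp (Lm (sc c)) * e"
    by (cases e) (simp add: opp_defs central_Lm(1)[OF central_sc])
  show "Opp (Rm (sc c)) = Opp (Lm (sc c))" by (simp add: central_Lm(2)[OF central_sc])
  show "at_one (unopp e) = 0 \<Longrightarrow> at_one (unopp (e * f)) = 0" by (simp add: opp_defs at_one_simps)
  show "psum (at_one (unopp (Opp (Lm p) * (if b then Opp Jm else 1) * (Opp (Rm q) * (if b' then Opp Km else 1))))) = p * q"
    by (cases b; cases b') (simp_all add: opp_defs mult.assoc at_one_mult at_one_gens psum_def)
  show "psum (at_one (unopp (Opp (Lm p) * (if b then Opp Jm else 1)))) = p"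
    by (cases b) (simp_all add: opp_defs at_one_mult at_one_gens psum_def)
  show "psum (at_one (unopp (Opp (Lm (sc c)) * e))) = sc c * psum (at_one (unopp e))"
    by (simp add: opp_defs central_Lm(1)[OF central_sc] at_one_mult psum_def distrib_left)
qed (simp_all add: opp_defs endo_simps at_one_simps psum_simps at_one_gens)

end

section \<open>Antipode axioms and well-definedness of S and the counit\<close>

lemma evs_eps: "ps_fin x \<Longrightarrow> evs R (sv_eps x) = ser qsc (\<lambda>u. if u = [] then 1 else 0) x"
proof -
  assume x: "ps_fin x"
  have "wd (\<lambda>g. evs R ps_zero) u = (if u = [] then 1 else 0)" for u :: "sv_gen list"
    by (cases u) simp_all
  then show ?thesis using x by (simp add: sv_eps_def qalg.hs_hom_ext)
qed

lemma ps_fin_eps: "ps_fin x \<Longrightarrow> ps_fin (sv_eps x)"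
  by (simp add: sv_eps_def ps_fin_hom_ext)

lemma antipode_S_id:
  assumes "m \<noteq> 0" "ps_fin x"
  shows "ps_eqv (sv_rel h) (sv_mult_S_id h m \<alpha> (sv_Delta h m \<alpha> x)) (sv_eps x)"
  using assms biact_right.antipode_right[OF qalg.biact_right_endo assms(1) sv_rep_qgen assms(2)]
  by (subst ps_eqv_iff)
    (auto simp: evs_eps ps_fin_eps sv_mult_S_id_def ps_fin_aword intro: good_Nil[OF good_sv_rel])

lemma antipode_id_S:
  assumes "m \<noteq> 0" "ps_fin x"
  shows "ps_eqv (sv_rel h) (sv_mult_id_S h m \<alpha> (sv_Delta h m \<alpha> x)) (sv_eps x)"
  using assms biact_left.antipode_left[OF qalg.biact_left_endo assms(1) sv_rep_qgen assms(2)]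
  by (subst ps_eqv_iff)
    (auto simp: evs_eps ps_fin_eps sv_mult_id_S_def ps_fin_aword intro: good_Nil[OF good_sv_rel])

lemma fa_fin_ideal: "good_rel R \<Longrightarrow> f \<in> fa_ideal R \<Longrightarrow> fa_fin f"
  using qalg.hv_ideal[of f R "qgen R"] kills_qgen[of R] by (simp add: good_rel_def kills_def)

lemma antipode_well_defined:
  assumes "m \<noteq> 0" and f: "f \<in> fa_ideal (sv_rel h)"
  shows "ps_eqv (sv_rel h) (sv_S h m \<alpha> (ps_const f)) ps_zero"
  using biact_right.antipode_kills[OF qalg.biact_right_endo assms(1) sv_rep_qgen f] fa_fin_ideal[OF good_sv_rel f]
  by (subst ps_eqv_iff)
    (auto simp: sv_S_def anti_ext_def ps_fin_aword intro: good_Nil[OF good_sv_rel])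

text \<open>The counit sees only the coefficient of the empty word, which is 0 throughout the ideal;
  so equality holds in the free algebra itself.\<close>

lemma counit_well_defined:
  assumes f: "f \<in> fa_ideal (sv_rel h)"
  shows "sv_eps (ps_const f) = ps_zero"
proof -
  have "f [] = 0" using fa_ideal_Nil[OF f] good_sv_rel[of h] by (auto simp: good_rel_def)
  moreover have "ps_mult ps_zero x = ps_zero" for x :: "(sv_gen,'a) ps"
    by (intro ext) (simp add: ps_mult_def ps_zero_def fa_zero_def fa_mult_def)
  then have "ps_word (\<lambda>g. ps_zero) u = (if u = [] then ps_one else ps_zero :: (sv_gen,'a) ps)" for u :: "sv_gen list"
    by (cases u) simp_all
  then have W: "ps_word (\<lambda>g. ps_zero) u n w = (0 :: 'a)" if "u \<noteq> []" for u :: "sv_gen list" and n and w :: "sv_gen list"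
    using that by (simp only: if_False) (simp add: ps_zero_def fa_zero_def)
  have K: "f u * ps_word (\<lambda>g. ps_zero) u n w = 0" for u n and w :: "sv_gen list"
    by (cases "u = []") (simp_all only: \<open>f [] = 0\<close> W mult_zero_left mult_zero_right not_False_eq_True)
  have lin: "lin_ext (ps_word (\<lambda>g. ps_zero)) (ps_const f j) n w = 0" for j n and w :: "sv_gen list"
    by (cases "j = 0") (simp_all only: lin_ext_def ps_const_def K if_True if_False refl sum.neutral_const fa_zero_def mult_zero_left)
  have "sv_eps (ps_const f) n w = 0" for n w
    by (simp only: sv_eps_def hom_ext_def ser_ext_def lin sum.neutral_const)
  then show ?thesis by (intro ext) (simp add: ps_zero_def fa_zero_def)
qed

lemma (in calg) lin_word_left: "fa_fin f \<Longrightarrow> lin sc W (fa_mult (fa_word u) f) = lin sc (\<lambda>v. W (u @ v)) f"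
  by (induction f rule: fa_fin_induct)
    (simp_all add: fa_mult_add_right fa_mult_smul_right fa_mult_word lin_add lin_smul)

lemma (in calg) lin_word_right: "fa_fin f \<Longrightarrow> lin sc W (fa_mult f (fa_word u)) = lin sc (\<lambda>v. W (v @ u)) f"
  by (induction f rule: fa_fin_induct)
    (simp_all add: fa_mult_add_left fa_mult_smul_left fa_mult_word lin_add lin_smul)

section \<open>Noncommutativity and noncocommutativity\<close>

text \<open>On functions of \<open>(False, n)\<close> and \<open>(True, n)\<close>, the coefficients of basis vectors \<open>e\<^sub>n\<close> and \<open>f\<^sub>n\<close>:
\<open>L\<^sub>i e\<^sub>n = n e\<^sub>i\<^sub>+\<^sub>n\<close>, \<open>L\<^sub>i f\<^sub>n = (n + \<epsilon> + i/2) f\<^sub>i\<^sub>+\<^sub>n\<close>, \<open>G\<^sub>j e\<^sub>n = n f\<^sub>j\<^sub>+\<^sub>n\<close>, \<open>G\<^sub>j f\<^sub>n = e\<^sub>j\<^sub>+\<^sub>n\<^sub>+\<^sub>2\<^sub>\<epsilon>\<close>.\<close>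

fun rho_coef :: "bool \<Rightarrow> sv_gen \<Rightarrow> bool \<times> int \<Rightarrow> 'a::field_char_0" where
  "rho_coef h (Lg i) (False, n) = of_int (n - i)"
| "rho_coef h (Lg i) (True, n) = of_int n + eps_val h - of_int i / 2"
| "rho_coef h (Gg j) (False, n) = 1"
| "rho_coef h (Gg j) (True, n) = of_int (n - j)"

fun rho_shift :: "bool \<Rightarrow> sv_gen \<Rightarrow> bool \<times> int \<Rightarrow> bool \<times> int" where
  "rho_shift h (Lg i) (b, n) = (b, n - i)"
| "rho_shift h (Gg j) (False, n) = (True, n - j - (if h then 1 else 0))"
| "rho_shift h (Gg j) (True, n) = (False, n - j)"

fun rho_word :: "bool \<Rightarrow> sv_gen list \<Rightarrow> (bool \<times> int \<Rightarrow> 'a::field_char_0) \<Rightarrow> bool \<times> int \<Rightarrow> 'a" where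
  "rho_word h [] v x = v x"
| "rho_word h (g # u) v x = rho_coef h g x * rho_word h u v (rho_shift h g x)"

lemma calg_id: "calg (\<lambda>c::'a::field_char_0. c)"
  by unfold_locales simp_all

lemmas fld_lin = calg.lin_add[OF calg_id] calg.lin_diff[OF calg_id] calg.lin_smul[OF calg_id]
  calg.lin_word[OF calg_id] calg.lin_word_left[OF calg_id] calg.lin_word_right[OF calg_id]

abbreviation rho :: "bool \<Rightarrow> (sv_gen,'a::field_char_0) fa \<Rightarrow> (bool \<times> int \<Rightarrow> 'a) \<Rightarrow> bool \<times> int \<Rightarrow> 'a" where
  "rho h f v x \<equiv> lin (\<lambda>c. c) (\<lambda>u. rho_word h u v x) f"

lemma rho_word_append: "rho_word h (u @ w) v = rho_word h u (rho_word h w v)"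
proof
  show "rho_word h (u @ w) v x = rho_word h u (rho_word h w v) x" for x
    by (induction u arbitrary: x) simp_all
qed

text \<open>The outer word w acts linearly, so a linear combination over the inner word can be
  formed before w acts. This isolates the middle factor of a product u a w in the ideal.\<close>

lemma rho_word_rho:
  fixes f :: "('g,'a::field_char_0) fa"
  shows "lin (\<lambda>c. c) (\<lambda>u. rho_word h w (\<lambda>y. W u y) x) f = rho_word h w (\<lambda>y. lin (\<lambda>c. c) (\<lambda>u. W u y) f) x"
proof (induction w arbitrary: x)
  case (Cons g w)
  have "lin (\<lambda>c. c) (\<lambda>u. c * V u) f = c * lin (\<lambda>c. c) V f" for c and V :: "_ \<Rightarrow> 'a"
    by (simp add: lin_def sum_distrib_left mult.left_commute)
  then show ?case by (simp add: Cons)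
qed simp

lemma rho_rel:
  assumes "r \<in> sv_rel h" shows "rho h r v x = 0"
proof -
  have "\<exists>g g'. r = fa_diff (fa_diff (fa_word [g, g']) (fa_smul (if sv_par g \<and> sv_par g' then -1 else 1) (fa_word [g', g]))) (sv_br h g g')"
    using assms by (auto simp: sv_rel_def fa_gen_def fa_mult_word)
  then obtain g g' where r: "r = fa_diff (fa_diff (fa_word [g, g']) (fa_smul (if sv_par g \<and> sv_par g' then -1 else 1) (fa_word [g', g]))) (sv_br h g g')"
    by blast
  obtain b n where x: "x = (b, n)" by fastforce
  have a: "n - i - j = n - (i + j)" "n - j - i = n - (i + j)" for i j by simp_all
  show ?thesis
    unfolding r x
    \<comment> \<open>All pairs of generators are checked on both families of basis vectors and for
      both values of \<epsilon>.\<close>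
    by (cases g; cases g'; cases b; cases h)
      (simp_all add: fld_lin sv_br_fin fa_gen_def eps_val_def algebra_simps a, simp_all add: field_simps)
qed

lemma rho_ideal:
  assumes "f \<in> fa_ideal (sv_rel h)" shows "rho h f v x = 0"
  using assms
\<comment> \<open>The vector varies because the right-hand word of a product acts on it
  first.\<close>
proof (induction arbitrary: v x)
  case (rel r)
  then show ?case by (rule rho_rel)
next
  case (add a b)
  then have "fa_fin a" "fa_fin b" using fa_fin_ideal[OF good_sv_rel[of h]] by blast+
  with add.IH show ?case by (simp add: fld_lin)
next
  case (smul a c)
  then have "fa_fin a" using fa_fin_ideal[OF good_sv_rel[of h]] by blast
  with smul.IH show ?case by (simp add: fld_lin)
next
  case (mult a u w)
  then have "fa_fin a" using fa_fin_ideal[OF good_sv_rel[of h]] by blast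
  then have "rho h (fa_mult (fa_word u) (fa_mult a (fa_word w))) v x =
      lin (\<lambda>c. c) (\<lambda>z. rho_word h u (\<lambda>y. rho_word h z (rho_word h w v) y) x) a"
    by (simp add: fld_lin rho_word_append)
  also have "\<dots> = rho_word h u (\<lambda>y. 0) x" unfolding rho_word_rho mult.IH ..
  also have "\<dots> = 0" by (induction u arbitrary: x) simp_all
  finally show ?case .
qed (simp add: calg.lin_zero[OF calg_id])

lemma Yel_neq_0:
  assumes m: "m \<noteq> 0"
  shows "Yel qsc m \<alpha> (\<lambda>i. qgen (sv_rel h) (Lg i)) \<noteq> (0 :: (_,'a::field_char_0) qalg)"
proof
  assume "Yel qsc m \<alpha> (\<lambda>i. qgen (sv_rel h) (Lg i)) = (0 :: (_,'a) qalg)"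
  then have "ev (sv_rel h) (sv_Y m \<alpha> :: (_,'a) fa) = 0" by (simp add: qalg.hv_sv_Y)
  then have Y: "(sv_Y m \<alpha> :: (_,'a) fa) \<in> fa_ideal (sv_rel h)"
    by (subst (asm) ev_eq_0_iff) (auto intro: good_Nil[OF good_sv_rel])
  \<comment> \<open>This is e_1; the vector e_0 would be killed by every L_i. Of the summands of Y
    only L_m maps e_1 to degree 1 + m.\<close>
  let ?v = "\<lambda>x. if x = (False, 1) then 1 else 0 :: 'a"
  have "rho h (sv_Y m \<alpha>) ?v (False, 1 + m) = (1 :: 'a)"
    unfolding sv_Y_def sv_L_def fa_gen_def using m by (simp add: fld_lin)
  then show False using rho_ideal[OF Y, of ?v "(False, 1 + m)"] by simp
qed

text \<open>The commutator is Y, which the module shows to be nonzero.\<close>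

lemma XY_qgen:
  fixes \<alpha> :: "'a::field_char_0" and h :: bool
  assumes "m \<noteq> 0"
  defines "X \<equiv> Xel qsc m \<alpha> (\<lambda>i. qgen (sv_rel h) (Lg i))" and "Y \<equiv> Yel qsc m \<alpha> (\<lambda>i. qgen (sv_rel h) (Lg i)) :: (_,'a) qalg"
  shows "X * Y \<noteq> Y * X"
  using qalg.Xel_Yel[OF qalg.weights_L[OF sv_rep_qgen[of h] assms(1)], of \<alpha>] Yel_neq_0[OF assms(1), of \<alpha> h]
  unfolding X_def Y_def by (auto simp: comp_def)

lemma fps_const_inject: "fps_const a = fps_const b \<longleftrightarrow> a = b"
  by (metis fps_nth_fps_const)

lemma noncommutative:
  fixes \<alpha> :: "'a::field_char_0"
  assumes m: "m \<noteq> 0"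
  shows "\<not> ps_eqv (sv_rel h) (ps_mult (ps_const (sv_X m \<alpha>)) (ps_const (sv_Y m \<alpha>)))
    (ps_mult (ps_const (sv_Y m \<alpha>)) (ps_const (sv_X m \<alpha>)))"
  using XY_qgen[OF m, of \<alpha> h]
  by (subst ps_eqv_iff)
    (auto simp: qalg.hs_mult qalg.ce_const qalg.hv_sv_X qalg.hv_sv_Y fps_const_inject intro: good_Nil[OF good_sv_rel])

section \<open>First-order term of the coproduct of X, and noncocommutativity\<close>

lemma (in calg) Delta_X_nth_1:
  fixes A :: "sv_gen + sv_gen \<Rightarrow> 'b" and m :: int and \<alpha> :: 'a
  assumes m: "m \<noteq> 0" and A: "sv_rep sc h (\<lambda>g. A (Inl g))" "sv_rep sc h (\<lambda>g. A (Inr g))"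
    and AB: "scomm sv_par sv_par (\<lambda>g. A (Inl g)) (\<lambda>g. A (Inr g))"
  shows "ce A (sv_Delta h m \<alpha> (ps_const (sv_X m \<alpha>))) $ 1 =
    Xel sc m \<alpha> (\<lambda>i. A (Inl (Lg i))) * Yel sc m \<alpha> (\<lambda>i. A (Inr (Lg i)))"
proof -
  interpret F: calg "fsc sc" by (rule calg_fps)
  let ?L1 = "\<lambda>i. A (Inl (Lg i))" and ?L2 = "\<lambda>i. A (Inr (Lg i))"
  let ?X1 = "Xel sc m \<alpha> ?L1" and ?X2 = "Xel sc m \<alpha> ?L2" and ?Y2 = "Yel sc m \<alpha> ?L2"
  have cm: "cm ?X1 ?Y2" "cm ?X1 ?X2"
    using scomm_cm[OF AB] by (auto intro!: cm_intros)
  have XY: "?X2 * ?Y2 = ?Y2 * ?X2 + ?Y2"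
    using Xel_Yel[OF weights_L[OF A(2) m], of \<alpha>] by (simp add: comp_def algebra_simps)
  have "ce A (sv_Delta h m \<alpha> (ps_const (sv_X m \<alpha>))) = Xel (fsc sc) m \<alpha> (\<lambda>i. ce A (sv_Delta_gen h m \<alpha> (Lg i)))"
    by (simp add: sv_Delta_def hs_hom_ext ser_const F.hv_sv_X)
  also have "\<dots> = pwc sc ?Y2 ?X1 * fps_const (?X1 + ?X2) * pwc sc ?Y2 (- ?X1)"
    unfolding ce_Delta_gen[OF m A AB] Xel_conj[OF calg_fps pwc_inverse(1)[OF cm(1)]] Xel_const Xel_add ..
  finally have "ce A (sv_Delta h m \<alpha> (ps_const (sv_X m \<alpha>))) $ 1 =
      (pwc sc ?Y2 ?X1 * fps_const (?X1 + ?X2) * pwc sc ?Y2 (- ?X1)) $ 1" by (rule arg_cong)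
  \<comment> \<open>F begins with 1 - X1 Y2 t, so the coefficient of t is the commutator of X1 + X2
    with X1 Y2, which reduces to X1 [X2, Y2].\<close>
  also have "\<dots> = (?X1 + ?X2) * (?X1 * ?Y2) - ?X1 * ?Y2 * (?X1 + ?X2)"
    by (simp add: fps_mult_nth_1 pwc_nth bin_def)
  also have "\<dots> = ?X1 * ?Y2"
  proof -
    have a: "?X1 * ?Y2 * ?X1 = ?X1 * (?X1 * ?Y2)"
      by (simp only: mult.assoc cmD[OF cm(1), symmetric])
    have b: "?X2 * (?X1 * ?Y2) = ?X1 * (?X2 * ?Y2)"
      by (rule cm_left_commute[OF cm(2)[THEN cm_sym]])
    have "?X1 * (?X2 * ?Y2) - ?X1 * ?Y2 * ?X2 = ?X1 * ?Y2"
      by (simp only: XY distrib_left mult.assoc add_diff_cancel_left')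
    then show ?thesis by (simp only: distrib_left distrib_right a b add_diff_cancel_left)
  qed
  finally show ?thesis .
qed

lemma scomm_sym: "scomm p1 p2 A B \<Longrightarrow> scomm p2 p1 B A"
  by (auto simp: scomm_def)

text \<open>Comparing coefficients of t, cocommutativity would force X \<otimes> Y = Y \<otimes> X.
  The map x \<otimes> y to x S0(y) with the untwisted antipode S0, realised by the two-sided action
  at the unit, turns this into X Y = Y X.\<close>

lemma noncocommutative:
  fixes \<alpha> :: "'a::field_char_0"
  assumes m: "m \<noteq> 0"
  shows "\<not> ps_eqv (sv_rel2 h) (sv_flip (sv_Delta h m \<alpha> (ps_const (sv_X m \<alpha>)))) (sv_Delta h m \<alpha> (ps_const (sv_X m \<alpha>)))"
proof
  let ?x = "ps_const (sv_X m \<alpha>)" and ?q = "qgen (sv_rel2 h) :: _ \<Rightarrow> (_,'a) qalg"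
  let ?sw = "\<lambda>c :: sv_gen + sv_gen. (case c of Inl a \<Rightarrow> Inr a | Inr b \<Rightarrow> Inl b)"
  assume "ps_eqv (sv_rel2 h) (sv_flip (sv_Delta h m \<alpha> ?x)) (sv_Delta h m \<alpha> ?x)"
  then have "evs (sv_rel2 h) (sv_flip (sv_Delta h m \<alpha> ?x)) = evs (sv_rel2 h) (sv_Delta h m \<alpha> ?x)"
    by (subst (asm) ps_eqv_iff) (auto simp: sv_flip_def ps_fin_hom_ext intro: good_Nil[OF good_sv_rel2])
  moreover have "evs (sv_rel2 h) (sv_flip (sv_Delta h m \<alpha> ?x)) = qalg.ce (\<lambda>c. ?q (?sw c)) (sv_Delta h m \<alpha> ?x)"
    by (simp add: sv_flip_def qalg.hs_hom_ext)
  ultimately have "qalg.ce (\<lambda>c. ?q (?sw c)) (sv_Delta h m \<alpha> ?x) $ 1 = evs (sv_rel2 h) (sv_Delta h m \<alpha> ?x) $ 1"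
    by simp
  then have e: "Xel qsc m \<alpha> (\<lambda>i. ?q (Inr (Lg i))) * Yel qsc m \<alpha> (\<lambda>i. ?q (Inl (Lg i))) =
      Xel qsc m \<alpha> (\<lambda>i. ?q (Inl (Lg i))) * Yel qsc m \<alpha> (\<lambda>i. ?q (Inr (Lg i)))"
    using qalg.Delta_X_nth_1[OF m, of h "\<lambda>c. ?q (?sw c)" \<alpha>] qalg.Delta_X_nth_1[OF m, of h ?q \<alpha>] sv_rep_qgen2[of h, where 'a = 'a]
      scomm_sym[OF sv_rep_qgen2(3)[of h, where 'a = 'a]]
    by simp
  have "cm (Xel qsc m \<alpha> (\<lambda>i. ?q (Inr (Lg i)))) (Yel qsc m \<alpha> (\<lambda>i. ?q (Inl (Lg i))))"
    using scomm_cm[OF scomm_sym[OF sv_rep_qgen2(3)[of h, where 'a = 'a]]] by (intro qalg.cm_Xel qalg.cm_Yel) auto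
  then have e': "evs (sv_rel2 h) (ps_const (fa_tens (sv_X m \<alpha>) (sv_Y m \<alpha>))) =
      evs (sv_rel2 h) (ps_const (fa_tens (sv_Y m \<alpha>) (sv_X m \<alpha>)))"
    using e by (simp add: qalg.ce_const fa_tens_def qalg.hv_mult qalg.hv_rename comp_def qalg.hv_sv_X qalg.hv_sv_Y cm_def del: map_map)
  let ?A = "qgen (sv_rel h) :: _ \<Rightarrow> (_,'a) qalg" and ?sc = "\<lambda>c. Lm (qsc c) :: (sv_gen,'a) qalg endo"
  let ?N = "\<lambda>g. fps_const (?A g)"
  let ?X = "Xel qsc m \<alpha> (\<lambda>i. ?A (Lg i))" and ?Y = "Yel qsc m \<alpha> (\<lambda>i. ?A (Lg i))"
  interpret B: biact_left "qsc :: 'a \<Rightarrow> (sv_gen,'a) qalg" ?sc Lm Rm Jm Km "\<lambda>e. psum (at_one e)" "\<lambda>e. at_one e = 0"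
    by (rule qalg.biact_left_endo)
  interpret FE: calg "fsc ?sc" by (rule B.E.calg_fps)
  let ?\<psi> = "case_sum (B.hgen ?N) (B.agen (\<lambda>g. - ?N g))"
  have "kills (fsc ?sc) ?\<psi> (sv_rel2 h)"
    unfolding FE.kills_sv_rel2
    by (simp add: comp_def B.scomm_hgen_agen B.sv_rep_hgen B.sv_rep_agen qalg.sv_rep_const sv_rep_qgen)
  from B.E.hs_cong[OF good_sv_rel2 this _ _ e']
  have "hs ?sc ?\<psi> (ps_const (fa_tens (sv_X m \<alpha>) (sv_Y m \<alpha>))) = hs ?sc ?\<psi> (ps_const (fa_tens (sv_Y m \<alpha>) (sv_X m \<alpha>)))"
    by simp
  then have "Lm ?X * Rm (- ?Y) = Lm ?Y * Rm (- ?X)"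
    by (simp add: B.E.ser_const fa_tens_def FE.hv_mult FE.hv_rename comp_def FE.hv_sv_X FE.hv_sv_Y B.Xel_hgen B.Xel_agen
        Xel_minus Xel_const fps_const_inject B.\<theta>.fmap_const B.\<eta>.fmap_const B.\<eta>.fmap_minus B.\<eta>.minus del: map_map)
  then have "at_one (Lm ?X * Rm (- ?Y)) = at_one (Lm ?Y * Rm (- ?X))" by simp
  then have "?X * ?Y = ?Y * ?X" by (simp add: at_one_mult at_one_gens)
  then show False using XY_qgen[OF m, of \<alpha> h] by simp
qed

theorem theorem2p1:
  fixes \<alpha> :: "'a::field_char_0" and m :: int and h :: bool
  assumes "m \<noteq> 0"
  shows
    \<comment> \<open>Delta, epsilon, S are well defined on U(L)[[t]] (respect the defining ideal)\<close>
    "(\<forall>f \<in> fa_ideal (sv_rel h).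
        ps_eqv (sv_rel2 h) (sv_Delta h m \<alpha> (ps_const f)) ps_zero
      \<and> sv_eps (ps_const f) = ps_zero
      \<and> ps_eqv (sv_rel h) (sv_S h m \<alpha> (ps_const f)) ps_zero)
   \<and> (\<forall>x :: (sv_gen,'a) ps. ps_fin x \<longrightarrow>
        \<comment> \<open>coassociativity\<close>
        ps_eqv (sv_rel3 h) (sv_Delta_id h m \<alpha> (sv_Delta h m \<alpha> x))
                           (sv_id_Delta h m \<alpha> (sv_Delta h m \<alpha> x))
        \<comment> \<open>counit\<close>
      \<and> ps_eqv (sv_rel h) (sv_eps_id (sv_Delta h m \<alpha> x)) x
      \<and> ps_eqv (sv_rel h) (sv_id_eps (sv_Delta h m \<alpha> x)) x
        \<comment> \<open>antipode\<close>
      \<and> ps_eqv (sv_rel h) (sv_mult_S_id h m \<alpha> (sv_Delta h m \<alpha> x)) (sv_eps x)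
      \<and> ps_eqv (sv_rel h) (sv_mult_id_S h m \<alpha> (sv_Delta h m \<alpha> x)) (sv_eps x))
    \<comment> \<open>noncommutative\<close>
   \<and> (\<exists>x y :: (sv_gen,'a) ps. ps_fin x \<and> ps_fin y \<and>
        \<not> ps_eqv (sv_rel h) (ps_mult x y) (ps_mult y x))
    \<comment> \<open>noncocommutative\<close>
   \<and> (\<exists>x :: (sv_gen,'a) ps. ps_fin x \<and>
        \<not> ps_eqv (sv_rel2 h) (sv_flip (sv_Delta h m \<alpha> x)) (sv_Delta h m \<alpha> x))"
proof (intro conjI ballI allI impI)
  show "\<exists>x y :: (sv_gen,'a) ps. ps_fin x \<and> ps_fin y \<and> \<not> ps_eqv (sv_rel h) (ps_mult x y) (ps_mult y x)"
    using noncommutative[OF assms, of h \<alpha>] ps_fin_const[OF fa_fin_sv_X] ps_fin_const[OF fa_fin_sv_Y] by blast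
  show "\<exists>x :: (sv_gen,'a) ps. ps_fin x \<and> \<not> ps_eqv (sv_rel2 h) (sv_flip (sv_Delta h m \<alpha> x)) (sv_Delta h m \<alpha> x)"
    using noncocommutative[OF assms, of h \<alpha>] ps_fin_const[OF fa_fin_sv_X] by blast
qed (simp_all add: assms Delta_well_defined counit_well_defined antipode_well_defined coassociativity
    counit_left counit_right antipode_S_id antipode_id_S)

end
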